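(* Let $d\ge 1$ and let $D$ be a bounded open connected subset of $\mathbb{R}^d$ with boundary $\partial D$. Let $f:\mathbb{R}\times \partial D \to \mathbb{R}$ be any bounded measurable function. Let $B=(B_t)_{t\ge 0}$ be a $d$-dimensional standard Brownian motion, and let $\mathbb{E}_x$ denote the conditional expectation given that $B_0=x$. Let $X$ be a standard Cauchy random variable and $Z$ be a standard normal random variable, independent of $B$ and independent of each other. Let $\tau$ be the minimum $t$ such that $B_t\in\partial D$. For $t\in\mathbb{R}_+$ and $x\in D$, define \[ u(t,x) := \mathbb{E}_x f\bigl(tX+\sqrt{\tau}\,Z,\; B_\tau\bigr). \] Then $u$ is twice continuously differentiable in all coordinates and satisfies the wave equation $\partial_t^2 u = \Delta u$ in $\mathbb{R}_+\times D$.
   Context: Here $\mathbb{R}_+=(0,\infty)$, and $\Delta$ denotes the $d$-dimensional Laplacian with respect to the $x$ variable, $\Delta=\sum_{i=1}^d \partial_{x_i}^2$. The standard Cauchy distribution is the probability distribution on $\mathbb{R}$ with density $\frac{1}{\pi(1+z^2)}$. The independence assumption means that $B$, $X$ and $Z$ are mutually independent. Measurable means Borel measurable. *)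

theory Defs
  imports "HOL-Probability.Probability"
begin

section \<open>Brownian motion\<close>

text \<open>Time is the half-line of nonnegative reals; the values of \<^term>\<open>B\<close> at negative times are
  irrelevant. Paths are continuous everywhere on the sample space (not merely almost surely), so
  that hitting times are measurable without completing the measure.\<close>

definition brownian_motion_from ::
  "'w measure \<Rightarrow> real ^ 'd \<Rightarrow> (real \<Rightarrow> 'w \<Rightarrow> real ^ 'd) \<Rightarrow> bool" where
  "brownian_motion_from M x B \<longleftrightarrow>
     prob_space M \<and>
     (\<forall>t\<ge>0. B t \<in> borel_measurable M) \<and>
     (AE \<omega> in M. B 0 \<omega> = x) \<and>
     (\<forall>\<omega>\<in>space M. continuous_on {0..} (\<lambda>t. B t \<omega>)) \<and>
     (\<forall>s t. 0 \<le> s \<and> s < t \<longrightarrow>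
        distributed M lborel (\<lambda>\<omega>. B t \<omega> - B s \<omega>)
          (\<lambda>y. ennreal (\<Prod>i\<in>UNIV. normal_density 0 (sqrt (t - s)) (y $ i)))) \<and>
     (\<forall>(n::nat) T. 0 \<le> T 0 \<and> (\<forall>i<n. T i < T (Suc i)) \<longrightarrow>
        prob_space.indep_vars M (\<lambda>_. borel) (\<lambda>i \<omega>. B (T (Suc i)) \<omega> - B (T i) \<omega>) {..<n})"

definition hits :: "(real \<Rightarrow> 'w \<Rightarrow> 'a) \<Rightarrow> 'a set \<Rightarrow> 'w \<Rightarrow> bool" where
  "hits B A \<omega> \<longleftrightarrow> (\<exists>t\<ge>0. B t \<omega> \<in> A)"

text \<open>Unspecified if the path never hits \<^term>\<open>A\<close>; the minimum is attained for a continuous path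
  that hits a closed set.\<close>

definition hitting_time :: "(real \<Rightarrow> 'w \<Rightarrow> 'a) \<Rightarrow> 'a set \<Rightarrow> 'w \<Rightarrow> real" where
  "hitting_time B A \<omega> = (LEAST t. 0 \<le> t \<and> B t \<omega> \<in> A)"

section \<open>Distributions and independence\<close>

definition cauchy_density :: "real \<Rightarrow> real" where
  "cauchy_density z = 1 / (pi * (1 + z\<^sup>2))"

definition sigma_of_process :: "'w measure \<Rightarrow> (real \<Rightarrow> 'w \<Rightarrow> real ^ 'd) \<Rightarrow> 'w set set" where
  "sigma_of_process M B =
     sets (vimage_algebra (space M) (\<lambda>\<omega>. \<lambda>t\<in>{0..}. B t \<omega>) (Pi\<^sub>M {0..} (\<lambda>_. borel)))"

definition sigma_of_rv :: "'w measure \<Rightarrow> ('w \<Rightarrow> real) \<Rightarrow> 'w set set" where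
  "sigma_of_rv M Y = sets (vimage_algebra (space M) Y borel)"

text \<open>Stated through generated \<open>\<sigma>\<close>-algebras because \<^const>\<open>prob_space.indep_vars\<close> needs a common
  codomain type.\<close>

definition mutually_independent ::
  "'w measure \<Rightarrow> (real \<Rightarrow> 'w \<Rightarrow> real ^ 'd) \<Rightarrow> ('w \<Rightarrow> real) \<Rightarrow> ('w \<Rightarrow> real) \<Rightarrow> bool" where
  "mutually_independent M B X Z \<longleftrightarrow>
     prob_space.indep_sets M
       (\<lambda>i. [sigma_of_process M B, sigma_of_rv M X, sigma_of_rv M Z] ! i) {..<3}"

section \<open>Partial derivatives\<close>

definition partial_deriv :: "'a::euclidean_space \<Rightarrow> ('a \<Rightarrow> real) \<Rightarrow> 'a \<Rightarrow> real" where
  "partial_deriv b g p = deriv (\<lambda>h. g (p + h *\<^sub>R b)) 0"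

text \<open>Existence and joint continuity on \<^term>\<open>S\<close> (meant to be open) of all partial derivatives,
  mixed ones included, up to order \<^term>\<open>k\<close>.\<close>

primrec cont_diff_on :: "nat \<Rightarrow> 'a::euclidean_space set \<Rightarrow> ('a \<Rightarrow> real) \<Rightarrow> bool" where
  "cont_diff_on 0 S g \<longleftrightarrow> continuous_on S g"
| "cont_diff_on (Suc k) S g \<longleftrightarrow>
     continuous_on S g \<and>
     (\<forall>b\<in>Basis. (\<forall>p\<in>S. (\<lambda>h. g (p + h *\<^sub>R b)) differentiable (at 0)) \<and>
                cont_diff_on k S (partial_deriv b g))"

text \<open>For a function of \<open>(t, x)\<close>: the second time derivative, and the Laplacian in \<open>x\<close> only.\<close>

definition dtt :: "(real \<times> (real ^ 'd) \<Rightarrow> real) \<Rightarrow> real \<times> (real ^ 'd) \<Rightarrow> real" where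
  "dtt g = partial_deriv (1, 0) (partial_deriv (1, 0) g)"

definition laplacian_x :: "(real \<times> (real ^ 'd) \<Rightarrow> real) \<Rightarrow> real \<times> (real ^ 'd) \<Rightarrow> real" where
  "laplacian_x g p =
     (\<Sum>i\<in>UNIV. partial_deriv (0, axis i 1) (partial_deriv (0, axis i 1) g) p)"

end

theory Submission
  imports Defs
begin

text \<open>
  Integrating out \<open>X\<close> and \<open>Z\<close> first gives \<open>u(t, x) = E\<^sub>x F(t, \<tau>, B\<^sub>\<tau>)\<close>, where \<open>F(t, s, y)\<close> is the
  average of \<open>f(\<sqdot>, y)\<close> against the convolution of the Poisson kernel at \<open>t\<close> with the Gaussian of
  variance \<open>s\<close>. The Poisson kernel is harmonic and the Gaussian solves the heat equation, so
  \<open>\<partial>\<^sub>s F = - \<partial>\<^sub>t\<^sup>2 F / 2\<close>, and \<open>F\<close> is smooth in \<open>t\<close> with bounded derivatives. Put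
  \<open>U(t, s, x) = E\<^sub>x F(t, s + \<tau>, B\<^sub>\<tau>)\<close>, so that \<open>u(t, x) = U(t, 0, x)\<close>.

  No strong Markov property is needed. The Markov property at a fixed time \<open>r\<close> and the bound
  \<open>O(r\<^sup>2)\<close> for the probability of leaving a ball before time \<open>r\<close> show that, locally uniformly in
  \<open>D\<close>, \<open>U(t, s, \<sqdot>)\<close> differs from \<open>P\<^sub>r U(t, s + r, \<sqdot>)\<close> by \<open>O(r\<^sup>2)\<close>, with \<open>P\<^sub>r\<close> the heat semigroup on the
  whole space. Let \<open>V\<^sub>s = P\<^sub>s U(t, s, \<sqdot>)\<close>. Then \<open>V\<^sub>s\<^sub>+\<^sub>r - V\<^sub>s = P\<^sub>s (P\<^sub>r U(t, s + r, \<sqdot>) - U(t, s, \<sqdot>))\<close>, and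
  since up to two space derivatives of \<open>P\<^sub>s\<close> cost only a factor \<open>O(1/s)\<close>, all derivatives of order
  at most two of \<open>V\<^sub>s\<close> converge locally uniformly as \<open>s = 2\<^sup>-\<^sup>n\<close> tends to \<open>0\<close>, and \<open>V\<^sub>s\<close> itself to \<open>u\<close>. So \<open>u\<close> is
  twice continuously differentiable. Finally \<open>\<partial>\<^sub>s V\<^sub>s = (\<Delta> - \<partial>\<^sub>t\<^sup>2) V\<^sub>s / 2\<close> while
  \<open>V\<^sub>s - u = O(s\<^sup>2)\<close>, which forces \<open>\<Delta> u = \<partial>\<^sub>t\<^sup>2 u\<close>.
\<close>

section \<open>Differentiation under the integral sign\<close>

text \<open>The exponent 2 in the defect \<open>O(r\<^sup>2)\<close> carries the argument. Two space
  derivatives of the heat semigroup cost \<open>1/s\<close>, so over the step from \<open>s\<close>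
  to \<open>2 * s\<close> a defect of order \<open>s\<^sup>2\<close> becomes \<open>O(s)\<close>,
  summable over dyadic \<open>s\<close>; a defect of order \<open>s\<close> would give only
  boundedness. In the last step the same bound, divided by the length of a dyadic interval, still
  tends to \<open>0\<close>. The extra time \<open>s\<close> makes a restart exact: a path restarted
  at time \<open>r\<close> before it reaches the boundary hits it \<open>r\<close> earlier and at
  the same place, and passing from \<open>s\<close> to \<open>s + r\<close> repays the loss. Only
  paths that leave a small ball before \<open>r\<close> contribute to the defect. The obstacle is
  that each starting point \<open>x\<close> has its own measure \<open>P x\<close>, while
  \<open>U(t, s, x)\<close> has to be one measurable function of \<open>x\<close> that the heat
  semigroup can average; moreover a hitting time looks at uncountably many times. Both difficulties
  disappear on the space of paths sampled at rational times: the law there is fixed by the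
  finite-dimensional distributions, so a single law, translated by \<open>x\<close>, serves all
  starting points.\<close>

lemma borel_measurable_real_derivative:
  fixes g g' :: "real \<Rightarrow> 'a \<Rightarrow> real"
  assumes "a < h" "h < b"
    and meas: "\<And>k. a < k \<Longrightarrow> k < b \<Longrightarrow> g k \<in> borel_measurable M"
    and der: "\<And>\<omega>. \<omega> \<in> space M \<Longrightarrow> ((\<lambda>h. g h \<omega>) has_real_derivative g' h \<omega>) (at h)"
  shows "g' h \<in> borel_measurable M"
proof -
  define d where "d n = (b - h) / (real n + 2)" for n
  have d: "d n > 0" "h + d n < b" for n
  proof -
    show "d n > 0" using assms(1,2) by (auto simp: d_def)
    have "d n < (b - h) / 1" unfolding d_def using assms(2) by (intro divide_strict_left_mono) auto
    then show "h + d n < b" by simp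
  qed
  have d0: "d \<longlonglongrightarrow> 0"
    unfolding d_def by real_asymp
  show ?thesis
  proof (rule borel_measurable_LIMSEQ_real)
    show "(\<lambda>\<omega>. (g (h + d n) \<omega> - g h \<omega>) / d n) \<in> borel_measurable M" for n
      using d[of n] assms(1,2) by (intro borel_measurable_divide borel_measurable_diff meas) auto
    fix \<omega> assume \<omega>: "\<omega> \<in> space M"
    have "filterlim d (at 0) sequentially"
      using d0 d by (auto simp: filterlim_at intro!: always_eventually) (metis less_irrefl)
    with der[OF \<omega>] show "(\<lambda>n. (g (h + d n) \<omega> - g h \<omega>) / d n) \<longlonglongrightarrow> g' h \<omega>"
      unfolding DERIV_def by (rule filterlim_compose)
  qed
qed

text \<open>Dominated convergence for difference quotients. The mean value theorem turns the bound
  \<open>w\<close> on the derivative into the same bound on every quotient whose increment stays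
  between \<open>a\<close> and \<open>b\<close>.\<close>

lemma has_real_derivative_lebesgue_integral:
  fixes g g' :: "real \<Rightarrow> 'a \<Rightarrow> real"
  assumes "a < h0" "h0 < b"
    and int: "\<And>h. a < h \<Longrightarrow> h < b \<Longrightarrow> integrable M (g h)"
    and der: "\<And>h \<omega>. a < h \<Longrightarrow> h < b \<Longrightarrow> \<omega> \<in> space M \<Longrightarrow>
      ((\<lambda>h. g h \<omega>) has_real_derivative g' h \<omega>) (at h)"
    and bnd: "\<And>h \<omega>. a < h \<Longrightarrow> h < b \<Longrightarrow> \<omega> \<in> space M \<Longrightarrow> \<bar>g' h \<omega>\<bar> \<le> w \<omega>"
    and w: "integrable M w"
  shows "((\<lambda>h. \<integral>\<omega>. g h \<omega> \<partial>M) has_real_derivative (\<integral>\<omega>. g' h0 \<omega> \<partial>M)) (at h0)"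
proof -
  have meas': "g' h0 \<in> borel_measurable M"
    by (rule borel_measurable_real_derivative[where g=g and a=a and b=b])
      (use assms in \<open>auto dest: int\<close>)
  show ?thesis
    unfolding DERIV_def tendsto_at_iff_sequentially comp_def
  proof (intro allI impI)
    fix X :: "nat \<Rightarrow> real"
    assume X0: "\<forall>i. X i \<in> UNIV - {0}" and X: "X \<longlonglongrightarrow> 0"
    \<comment> \<open>Dropping finitely many terms of \<open>X\<close> keeps \<open>h0 + X n\<close>
      inside the interval on which the hypotheses hold.\<close>
    define e where "e = min (h0 - a) (b - h0)"
    have "e > 0" using assms by (auto simp: e_def)
    then obtain N where N: "\<And>n. n \<ge> N \<Longrightarrow> \<bar>X n\<bar> < e"
      using X by (auto simp: LIMSEQ_iff)
    define Y where "Y n = X (n + N)" for n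
    have Y0: "Y n \<noteq> 0" and Ye: "\<bar>Y n\<bar> < e" for n
      using X0 N by (auto simp: Y_def)
    have Yl: "Y \<longlonglongrightarrow> 0" unfolding Y_def using X by (rule LIMSEQ_ignore_initial_segment)
    have Yab: "a < h0 + Y n" "h0 + Y n < b" for n using Ye[of n] by (auto simp: e_def)
    have "(\<lambda>n. \<integral>\<omega>. (g (h0 + Y n) \<omega> - g h0 \<omega>) / Y n \<partial>M) \<longlonglongrightarrow> (\<integral>\<omega>. g' h0 \<omega> \<partial>M)"
    proof (rule integral_dominated_convergence[OF meas' _ w])
      show "(\<lambda>\<omega>. (g (h0 + Y n) \<omega> - g h0 \<omega>) / Y n) \<in> borel_measurable M" for n
        using int[OF Yab] int[OF assms(1,2)] by (intro borel_measurable_divide borel_measurable_diff) auto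
      show "AE \<omega> in M. (\<lambda>n. (g (h0 + Y n) \<omega> - g h0 \<omega>) / Y n) \<longlonglongrightarrow> g' h0 \<omega>"
      proof (rule AE_I2)
        fix \<omega> assume \<omega>: "\<omega> \<in> space M"
        have "filterlim Y (at 0) sequentially"
          using Yl Y0 by (auto simp: filterlim_at)
        with der[OF assms(1,2) \<omega>]
        show "(\<lambda>n. (g (h0 + Y n) \<omega> - g h0 \<omega>) / Y n) \<longlonglongrightarrow> g' h0 \<omega>"
          unfolding DERIV_def by (rule filterlim_compose)
      qed
      show "AE \<omega> in M. norm ((g (h0 + Y n) \<omega> - g h0 \<omega>) / Y n) \<le> w \<omega>" for n
      proof (rule AE_I2)
        fix \<omega> assume \<omega>: "\<omega> \<in> space M"
        have "\<exists>z. a < z \<and> z < b \<and> (g (h0 + Y n) \<omega> - g h0 \<omega>) / Y n = g' z \<omega>"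
        proof (cases "Y n > 0")
          case True
          then obtain z where "h0 < z" "z < h0 + Y n"
            "g (h0 + Y n) \<omega> - g h0 \<omega> = (h0 + Y n - h0) * g' z \<omega>"
            using MVT2[of h0 "h0 + Y n" "\<lambda>h. g h \<omega>" "\<lambda>h. g' h \<omega>"] der[OF _ _ \<omega>] Yab[of n] assms(1,2)
            by auto
          then show ?thesis using Yab[of n] assms(1,2) True by (intro exI[of _ z]) auto
        next
          case False
          then have "Y n < 0" using Y0[of n] by linarith
          then obtain z where "h0 + Y n < z" "z < h0"
            "g h0 \<omega> - g (h0 + Y n) \<omega> = (h0 - (h0 + Y n)) * g' z \<omega>"
            using MVT2[of "h0 + Y n" h0 "\<lambda>h. g h \<omega>" "\<lambda>h. g' h \<omega>"] der[OF _ _ \<omega>] Yab[of n] assms(1,2)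
            by auto
          then show ?thesis using Yab[of n] assms(1,2) \<open>Y n < 0\<close>
            by (intro exI[of _ z]) (auto simp: field_simps)
        qed
        then show "norm ((g (h0 + Y n) \<omega> - g h0 \<omega>) / Y n) \<le> w \<omega>" using bnd \<omega> by force
      qed
    qed
    also have "(\<lambda>n. \<integral>\<omega>. (g (h0 + Y n) \<omega> - g h0 \<omega>) / Y n \<partial>M) =
        (\<lambda>n. ((\<integral>\<omega>. g (h0 + Y n) \<omega> \<partial>M) - (\<integral>\<omega>. g h0 \<omega> \<partial>M)) / Y n)"
      by (simp add: int Yab assms)
    finally show "(\<lambda>n. ((\<integral>\<omega>. g (h0 + X n) \<omega> \<partial>M) - (\<integral>\<omega>. g h0 \<omega> \<partial>M)) / X n) \<longlonglongrightarrow> (\<integral>\<omega>. g' h0 \<omega> \<partial>M)"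
      unfolding Y_def by (rule LIMSEQ_offset)
  qed
qed

lemma continuous_within_lebesgue_integral:
  fixes g :: "'b::metric_space \<Rightarrow> 'a \<Rightarrow> real"
  assumes "p \<in> N"
    and meas: "\<And>q. q \<in> N \<Longrightarrow> g q \<in> borel_measurable M"
    and cont: "\<And>\<omega>. \<omega> \<in> space M \<Longrightarrow> continuous (at p within N) (\<lambda>q. g q \<omega>)"
    and bnd: "\<And>q \<omega>. q \<in> N \<Longrightarrow> \<omega> \<in> space M \<Longrightarrow> \<bar>g q \<omega>\<bar> \<le> w \<omega>"
    and w: "integrable M w"
  shows "continuous (at p within N) (\<lambda>q. \<integral>\<omega>. g q \<omega> \<partial>M)"
  unfolding continuous_within tendsto_at_iff_sequentially comp_def
proof (intro allI impI)
  fix X assume X: "\<forall>i. X i \<in> N - {p}" "X \<longlonglongrightarrow> p"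
  show "(\<lambda>n. \<integral>\<omega>. g (X n) \<omega> \<partial>M) \<longlonglongrightarrow> (\<integral>\<omega>. g p \<omega> \<partial>M)"
  proof (rule integral_dominated_convergence[OF _ _ w])
    show "AE \<omega> in M. (\<lambda>n. g (X n) \<omega>) \<longlonglongrightarrow> g p \<omega>"
      using cont X unfolding continuous_within tendsto_at_iff_sequentially comp_def
      by (auto intro!: AE_I2)
  qed (use meas bnd X assms(1) in auto)
qed

lemma has_real_derivative_uniform_limit:
  fixes f f' :: "nat \<Rightarrow> real \<Rightarrow> real"
  assumes "\<eta> > 0"
    and der: "\<And>n h. \<bar>h\<bar> < \<eta> \<Longrightarrow> (f n has_real_derivative f' n h) (at h)"
    and unif: "uniform_limit {-\<eta><..<\<eta>} f' g' sequentially"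
    and lim: "\<And>h. \<bar>h\<bar> < \<eta> \<Longrightarrow> (\<lambda>n. f n h) \<longlonglongrightarrow> g h"
  shows "(g has_real_derivative g' 0) (at 0)"
proof -
  let ?S = "{-\<eta><..<\<eta>}"
  have "\<exists>k. \<forall>x\<in>?S. (\<lambda>n. f n x) \<longlonglongrightarrow> k x \<and> (k has_derivative (*) (g' x)) (at x within ?S)"
  proof (rule has_derivative_sequence[where ?x0.0=0 and f'="\<lambda>n x. (*) (f' n x)"])
    show "convex ?S" by simp
    show "(f n has_derivative (*) (f' n x)) (at x within ?S)" if "x \<in> ?S" for n x
      using der[of x n] that by (auto simp: has_field_derivative_def intro: has_derivative_at_withinI)
    show "\<forall>\<^sub>F n in sequentially. \<forall>x\<in>?S. \<forall>h. norm (f' n x * h - g' x * h) \<le> e * norm h" if "e > 0" for e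
      using uniform_limitD[OF unif \<open>e > 0\<close>]
      by eventually_elim
        (force simp: dist_real_def left_diff_distrib[symmetric] abs_mult
          intro: mult_right_mono[OF less_imp_le])
    show "(\<lambda>n. f n 0) \<longlonglongrightarrow> g 0" using lim[of 0] assms(1) by simp
  qed (use assms(1) in auto)
  then obtain k where k: "\<And>x. x \<in> ?S \<Longrightarrow> (\<lambda>n. f n x) \<longlonglongrightarrow> k x"
    "\<And>x. x \<in> ?S \<Longrightarrow> (k has_derivative (*) (g' x)) (at x within ?S)" by blast
  have kg: "k x = g x" if "x \<in> ?S" for x
    using LIMSEQ_unique[OF k(1)[OF that] lim[of x]] that by auto
  have "(k has_derivative (*) (g' 0)) (at 0)"
    using k(2)[of 0] assms(1) by (simp add: at_within_open[of _ ?S])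
  then have "(k has_real_derivative g' 0) (at 0)" by (simp add: has_field_derivative_def)
  then show ?thesis
    by (rule has_field_derivative_transform_within_open[of _ _ _ ?S]) (use kg assms(1) in auto)
qed

section \<open>The heat kernel\<close>

text \<open>The density of a centred Gaussian vector with covariance \<open>s\<close> times the
  identity, that is, the transition density of Brownian motion; its generator is therefore half the
  Laplacian.\<close>

definition heat_kernel :: "real \<Rightarrow> 'a::euclidean_space \<Rightarrow> real" where
  "heat_kernel s z = (1 / sqrt (2 * pi * s)) ^ DIM('a) * exp (- (z \<bullet> z) / (2 * s))"

text \<open>Derivatives along the listed directions; lists of length above two are never used.\<close>

fun heat_deriv :: "'a::euclidean_space list \<Rightarrow> real \<Rightarrow> 'a \<Rightarrow> real" where
  "heat_deriv [] s z = heat_kernel s z"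
| "heat_deriv [b] s z = - (z \<bullet> b) / s * heat_kernel s z"
| "heat_deriv [b, c] s z = ((z \<bullet> b) * (z \<bullet> c) / s\<^sup>2 - (b \<bullet> c) / s) * heat_kernel s z"
| "heat_deriv (_ # _ # _ # _) s z = 0"

lemma heat_kernel_nonneg: "s > 0 \<Longrightarrow> 0 \<le> heat_kernel s z"
  by (simp add: heat_kernel_def)

lemma continuous_on_divide_const:
  fixes g :: "'a::topological_space \<Rightarrow> real"
  shows "continuous_on S g \<Longrightarrow> continuous_on S (\<lambda>x. g x / c)"
  unfolding divide_inverse by (intro continuous_intros)

lemma continuous_on_heat_kernel: "continuous_on UNIV (heat_kernel s)"
  unfolding heat_kernel_def by (intro continuous_intros continuous_on_divide_const)

lemma continuous_on_heat_deriv: "continuous_on UNIV (heat_deriv l s)"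
proof (cases "(l, s, 0 :: 'a)" rule: heat_deriv.cases)
  case (1 s' z)
  then have "heat_deriv l s = heat_kernel s" by (auto simp: fun_eq_iff)
  then show ?thesis by (simp add: continuous_on_heat_kernel)
next
  case (2 b s' z)
  then have "heat_deriv l s = (\<lambda>z. - (z \<bullet> b) / s * heat_kernel s z)" by (auto simp: fun_eq_iff)
  then show ?thesis by (simp only:) (intro continuous_intros continuous_on_divide_const continuous_on_heat_kernel)
next
  case (3 b c s' z)
  then have "heat_deriv l s = (\<lambda>z. ((z \<bullet> b) * (z \<bullet> c) / s\<^sup>2 - (b \<bullet> c) / s) * heat_kernel s z)"
    by (auto simp: fun_eq_iff)
  then show ?thesis by (simp only:) (intro continuous_intros continuous_on_divide_const continuous_on_heat_kernel)
next
  case 4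
  then have "heat_deriv l s = (\<lambda>z. 0)" by (auto simp: fun_eq_iff)
  then show ?thesis by simp
qed

lemma borel_measurable_heat_deriv[measurable]: "heat_deriv l s \<in> borel_measurable borel"
  by (rule borel_measurable_continuous_onI[OF continuous_on_heat_deriv])

lemma borel_measurable_heat_kernel[measurable]: "heat_kernel s \<in> borel_measurable borel"
  by (rule borel_measurable_continuous_onI[OF continuous_on_heat_kernel])

lemma inner_line_square:
  "((z :: 'a::real_inner) + h *\<^sub>R b) \<bullet> (z + h *\<^sub>R b) = z \<bullet> z + 2 * h * (z \<bullet> b) + h\<^sup>2 * (b \<bullet> b)"
  by (simp add: inner_simps inner_commute power2_eq_square algebra_simps)

lemma heat_kernel_has_derivative_line:
  assumes "s > 0"
  shows "((\<lambda>h. heat_kernel s ((z :: 'a::euclidean_space) + h *\<^sub>R b)) has_real_derivative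
    - ((z + h *\<^sub>R b) \<bullet> b) / s * heat_kernel s (z + h *\<^sub>R b)) (at h)"
proof -
  have "((\<lambda>h. - (z \<bullet> z + 2 * h * (z \<bullet> b) + h\<^sup>2 * (b \<bullet> b)) / (2 * s)) has_real_derivative
      - (z \<bullet> b + h * (b \<bullet> b)) / s) (at h)"
    using assms by (auto intro!: derivative_eq_intros simp: field_simps)
  from DERIV_cmult[OF DERIV_fun_exp[OF this], of "(1 / sqrt (2 * pi * s)) ^ DIM('a)"] show ?thesis
    unfolding heat_kernel_def inner_line_square by (rule DERIV_cong) (simp add: inner_simps)
qed

lemma heat_deriv_has_derivative_line:
  assumes "s > 0" "length l \<le> 1"
  shows "((\<lambda>h. heat_deriv l s (z + h *\<^sub>R b)) has_real_derivative
    heat_deriv (b # l) s (z + h *\<^sub>R b)) (at h)"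
proof (cases l)
  case Nil
  then show ?thesis using heat_kernel_has_derivative_line[OF assms(1)] by simp
next
  case (Cons c l')
  then have l: "l = [c]" using assms by simp
  have "((\<lambda>h. - ((z + h *\<^sub>R b) \<bullet> c) / s) has_real_derivative - (b \<bullet> c) / s) (at h)"
    using assms by (auto intro!: derivative_eq_intros simp: inner_simps)
  note 1 = DERIV_mult[OF this heat_kernel_has_derivative_line[OF assms(1), of z b h]]
  have "- (b \<bullet> c) / s * p + - (v \<bullet> b) / s * p * (- (v \<bullet> c) / s) =
      ((v \<bullet> b) * (v \<bullet> c) / s\<^sup>2 - (b \<bullet> c) / s) * p" for v p
    by (simp add: algebra_simps power2_eq_square)
  from this[of "heat_kernel s (z + h *\<^sub>R b)" "z + h *\<^sub>R b"]
  show ?thesis unfolding l heat_deriv.simps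
    by (intro DERIV_cong[OF 1]) simp
qed

text \<open>Trades Gaussian decay for two powers of time: with \<open>y\<close> proportional to
  \<open>1 / s\<close> the right side is of order \<open>s\<^sup>2\<close>. All the quadratic error
  bounds start here.\<close>

lemma exp_minus_le_inverse_square:
  fixes y :: real
  assumes "y > 0" shows "exp (- y) \<le> 2 / y\<^sup>2"
proof -
  have "y\<^sup>2 / 2 \<le> exp y" using exp_lower_Taylor_quadratic[of y] assms by simp
  then show ?thesis using assms by (simp add: exp_minus field_simps)
qed

text \<open>Relative to the kernel, the prefactor contributes \<open>- DIM('a) / (2 * s)\<close> and
  the exponent \<open>(z \<bullet> z) / (2 * s\<^sup>2)\<close>; the pure second space derivatives
  add up to twice this.\<close>

lemma heat_kernel_DERIV_time:
  fixes z :: "'a::euclidean_space"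
  assumes "s > 0"
  shows "((\<lambda>s. heat_kernel s z) has_real_derivative (\<Sum>b\<in>Basis. heat_deriv [b, b] s z) / 2) (at s)"
proof -
  have 1: "((\<lambda>s. 1 / sqrt (2 * pi * s)) has_real_derivative - (1 / sqrt (2 * pi * s)) / (2 * s)) (at s)"
    using assms by (auto intro!: derivative_eq_intros simp: field_simps real_sqrt_mult)
  have 2: "((\<lambda>s. exp (- (z \<bullet> z) / (2 * s))) has_real_derivative
     exp (- (z \<bullet> z) / (2 * s)) * ((z \<bullet> z) / (2 * s\<^sup>2))) (at s)"
    using assms by (auto intro!: derivative_eq_intros simp: field_simps power2_eq_square)
  have 3: "real DIM('a) * c ^ (DIM('a) - Suc 0) * (- c / (2 * s)) = - (real DIM('a) / (2 * s)) * c ^ DIM('a)" for c :: real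
    by (cases "DIM('a)") auto
  have 4: "(\<Sum>b\<in>Basis. heat_deriv [b, b] s z) =
     ((z \<bullet> z) / s\<^sup>2 - real DIM('a) / s) * heat_kernel s z"
    by (simp add: sum_distrib_right[symmetric] sum_subtractf sum_divide_distrib[symmetric]
        euclidean_inner[of z z])
  have "((\<lambda>s. heat_kernel s z) has_real_derivative
     (real DIM('a) * (1 / sqrt (2 * pi * s)) ^ (DIM('a) - Suc 0) * (- (1 / sqrt (2 * pi * s)) / (2 * s))) * exp (- (z \<bullet> z) / (2 * s)) +
     exp (- (z \<bullet> z) / (2 * s)) * ((z \<bullet> z) / (2 * s\<^sup>2)) * (1 / sqrt (2 * pi * s)) ^ DIM('a)) (at s)"
    unfolding heat_kernel_def by (rule DERIV_mult'[OF DERIV_power[OF 1] 2, THEN DERIV_cong]) (simp add: mult_ac)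
  then show ?thesis
    unfolding 3 4 by (rule DERIV_cong) (simp add: heat_kernel_def left_diff_distrib right_diff_distrib diff_divide_distrib mult_ac)
qed

lemma nn_integral_heat_kernel:
  assumes "s > 0"
  shows "(\<integral>\<^sup>+z. ennreal (heat_kernel s (z :: 'a::euclidean_space)) \<partial>lborel) = 1"
proof -
  have n: "normal_density 0 (sqrt s) x = 1 / sqrt (2 * pi * s) * exp (- x\<^sup>2 / (2 * s))" for x
    using assms by (simp add: normal_density_def)
  have "heat_kernel s z = (\<Prod>b\<in>Basis. normal_density 0 (sqrt s) (z \<bullet> b))" for z :: 'a
    unfolding n prod.distrib heat_kernel_def
    by (simp add: exp_sum[symmetric] euclidean_inner[of z z] sum_negf sum_divide_distrib power2_eq_square)
  then have "(\<integral>\<^sup>+z. ennreal (heat_kernel s (z :: 'a)) \<partial>lborel) =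
      (\<integral>\<^sup>+z. (\<Prod>b\<in>Basis. ennreal (normal_density 0 (sqrt s) ((z :: 'a) \<bullet> b))) \<partial>lborel)"
    by (simp add: prod_ennreal)
  also have "\<dots> = (\<Prod>b\<in>(Basis::'a set). (\<integral>\<^sup>+x. ennreal (normal_density 0 (sqrt s) x) \<partial>lborel))"
    by (rule nn_integral_lborel_prod) auto
  also have "(\<integral>\<^sup>+x. ennreal (normal_density 0 (sqrt s) x) \<partial>lborel) = 1"
    using assms by (subst nn_integral_eq_integral) (auto simp: integral_normal_density)
  finally show ?thesis by simp
qed

lemma integrable_heat_kernel:
  assumes "s > 0" shows "integrable lborel (heat_kernel s :: 'a::euclidean_space \<Rightarrow> real)"
  using nn_integral_heat_kernel[OF assms, where 'a='a] heat_kernel_nonneg[OF assms]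
  by (intro integrableI_nonneg) auto

lemma integral_heat_kernel:
  assumes "s > 0" shows "(\<integral>z. heat_kernel s (z :: 'a::euclidean_space) \<partial>lborel) = 1"
  using nn_integral_heat_kernel[OF assms, where 'a='a] heat_kernel_nonneg[OF assms]
  by (subst integral_eq_nn_integral) auto

lemma heat_kernel_minus: "heat_kernel s (- z) = heat_kernel s z"
  by (simp add: heat_kernel_def)

lemma lborel_distr_diff: "distr lborel borel (\<lambda>z. (x :: 'a::euclidean_space) - z) = lborel"
  by (subst (2) lborel_affine[of "-1" x]) (auto simp: density_1)

lemma integral_lborel_diff:
  fixes f :: "'a::euclidean_space \<Rightarrow> real"
  assumes [measurable]: "f \<in> borel_measurable borel"
  shows "(\<integral>z. f (x - z) \<partial>lborel) = (\<integral>z. f z \<partial>lborel)"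
  by (subst (2) lborel_distr_diff[of x, symmetric]) (simp add: integral_distr)

lemma integrable_lborel_diff:
  fixes f :: "'a::euclidean_space \<Rightarrow> real"
  assumes "integrable lborel f"
  shows "integrable lborel (\<lambda>z. f (x - z))"
  using assms integrable_distr_eq[of "\<lambda>z. x - z" lborel borel f]
  by (simp add: lborel_distr_diff)

lemma integral_lborel_shift:
  fixes f :: "'a::euclidean_space \<Rightarrow> real"
  assumes [measurable]: "f \<in> borel_measurable borel"
  shows "(\<integral>z. f (c + z) \<partial>lborel) = (\<integral>z. f z \<partial>lborel)"
  by (subst (2) lborel_distr_plus[of c, symmetric]) (simp add: integral_distr)

text \<open>Half of the Gaussian exponent is set aside to pay for polynomial factors or for
  distance; the other half is a kernel of doubled variance, which still has integral one.\<close>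

lemma heat_kernel_double:
  fixes z :: "'a::euclidean_space"
  assumes "s > 0"
  shows "heat_kernel s z = sqrt 2 ^ DIM('a) * exp (- (z \<bullet> z) / (4 * s)) * heat_kernel (2 * s) z"
proof -
  have "sqrt (2 * pi * (2 * s)) = sqrt 2 * sqrt (2 * pi * s)"
    by (simp add: real_sqrt_mult)
  then have "1 / sqrt (2 * pi * s) = sqrt 2 * (1 / sqrt (2 * pi * (2 * s)))" using assms by simp
  moreover have "exp (- (z \<bullet> z) / (2 * s)) = exp (- (z \<bullet> z) / (4 * s)) * exp (- (z \<bullet> z) / (2 * (2 * s)))"
    using assms by (simp add: exp_add[symmetric] field_simps)
  ultimately show ?thesis
    unfolding heat_kernel_def by (simp only: power_mult_distrib mult_ac)
qed

text \<open>Up to order two the polynomial factor is at most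
  \<open>1 + 1 / s + n\<^sup>2 / s\<^sup>2\<close> with \<open>n = norm z\<close>, and the spare
  half of the exponent absorbs the quadratic term. This is the source of the cost
  \<open>1 / s\<close> of two derivatives.\<close>

lemma heat_deriv_bound:
  fixes z :: "'a::euclidean_space"
  assumes "s > 0" and l: "\<forall>b\<in>set l. norm b \<le> 1"
  shows "\<bar>heat_deriv l s z\<bar> \<le> 5 * sqrt 2 ^ DIM('a) * (1 + 1 / s) * heat_kernel (2 * s) z"
proof -
  define n where "n = norm z"
  have zb: "\<bar>z \<bullet> b\<bar> \<le> n" if "norm b \<le> 1" for b
    using Cauchy_Schwarz_ineq2[of z b] that mult_left_mono[OF that norm_ge_zero[of z]]
    by (simp add: n_def)
  have n0: "n \<ge> 0" and zz: "z \<bullet> z = n\<^sup>2" by (simp_all add: n_def power2_norm_eq_inner)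
  have p0: "heat_kernel s z \<ge> 0" "heat_kernel (2 * s) z \<ge> 0"
    using assms by (simp_all add: heat_kernel_nonneg)
  have "\<bar>heat_deriv l s z\<bar> \<le> (1 + 1 / s + n\<^sup>2 / s\<^sup>2) * heat_kernel s z"
  proof (cases "(l, s, z)" rule: heat_deriv.cases)
    case 1
    then show ?thesis using assms p0 by (auto simp: mult_le_cancel_right1)
  next
    case (2 b)
    have "2 * (n / s) \<le> 1 + (n / s)\<^sup>2"
      using zero_le_power2[of "n / s - 1"] by (simp add: power2_diff)
    moreover have "0 \<le> n / s" using n0 assms by simp
    ultimately have "n / s \<le> 1 + n\<^sup>2 / s\<^sup>2" by (simp add: power_divide)
    moreover have "\<bar>z \<bullet> b\<bar> / s \<le> n / s" using zb[of b] l 2 assms by (auto simp: divide_right_mono)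
    moreover have "0 \<le> 1 / s" using assms by simp
    ultimately have "\<bar>z \<bullet> b\<bar> / s \<le> 1 + 1 / s + n\<^sup>2 / s\<^sup>2"
      by linarith
    from mult_right_mono[OF this p0(1)] show ?thesis
      using 2 p0 assms by (auto simp: abs_mult)
  next
    case (3 b c)
    have "\<bar>(z \<bullet> b) * (z \<bullet> c) / s\<^sup>2\<bar> \<le> n\<^sup>2 / s\<^sup>2"
      using zb[of b] zb[of c] l 3 n0 assms
      by (auto simp: abs_mult power2_eq_square intro!: divide_right_mono mult_mono)
    moreover have "\<bar>b \<bullet> c\<bar> \<le> 1"
      using Cauchy_Schwarz_ineq2[of b c] mult_mono[of "norm b" 1 "norm c" 1] l 3 by auto
    then have "\<bar>b \<bullet> c / s\<bar> \<le> 1 / s" using assms by (simp add: divide_right_mono)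
    ultimately have "\<bar>(z \<bullet> b) * (z \<bullet> c) / s\<^sup>2 - (b \<bullet> c) / s\<bar> \<le> 1 + 1 / s + n\<^sup>2 / s\<^sup>2"
      by linarith
    then show ?thesis using 3 p0 by (auto simp: abs_mult intro!: mult_right_mono)
  next
    case 4
    then show ?thesis using assms p0 by auto
  qed
  also have "\<dots> = ((1 + 1 / s + n\<^sup>2 / s\<^sup>2) * exp (- n\<^sup>2 / (4 * s))) * (sqrt 2 ^ DIM('a) * heat_kernel (2 * s) z)"
    by (subst heat_kernel_double[OF assms(1)]) (simp add: zz)
  also have "\<dots> \<le> (5 * (1 + 1 / s)) * (sqrt 2 ^ DIM('a) * heat_kernel (2 * s) z)"
  proof (rule mult_right_mono)
    \<comment> \<open>In this variable \<open>n\<^sup>2 / s\<^sup>2\<close> equals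
      \<open>4 / s * y\<close>, and \<open>y * exp (- y)\<close> is at most 1; hence the constant 5
      = 1 + 4.\<close>
    define y where "y = n\<^sup>2 / (4 * s)"
    have y: "y \<ge> 0" using assms by (simp add: y_def)
    have e: "exp (- y) \<le> 1" "y * exp (- y) \<le> 1"
      using y exp_ge_add_one_self[of y] by (simp_all add: exp_minus divide_simps del: exp_ge_add_one_self)
    have "(1 + 1 / s + n\<^sup>2 / s\<^sup>2) * exp (- y) = (1 + 1 / s) * exp (- y) + 4 / s * (y * exp (- y))"
      using assms by (simp add: y_def field_simps power2_eq_square)
    also have "\<dots> \<le> (1 + 1 / s) * 1 + 4 / s * 1"
      using assms e by (intro add_mono mult_left_mono) auto
    also have "\<dots> \<le> 5 * (1 + 1 / s)" by (simp add: field_simps)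
    finally show "(1 + 1 / s + n\<^sup>2 / s\<^sup>2) * exp (- n\<^sup>2 / (4 * s)) \<le> 5 * (1 + 1 / s)"
      by (simp add: y_def)
  qed (use p0 in auto)
  finally show ?thesis by (simp only: mult_ac)
qed

text \<open>Expanding the square of \<open>z + 2 *\<^sub>R w\<close> shows that a shift by
  \<open>w\<close> costs at most half of the exponent and a factor depending on \<open>w\<close>
  alone. For shifts of norm at most 1 this gives one integrable majorant, as differentiation and
  continuity in \<open>x\<close> require.\<close>

lemma heat_kernel_translate:
  fixes z :: "'a::euclidean_space"
  assumes "s > 0"
  shows "heat_kernel s (z + w) \<le> sqrt 2 ^ DIM('a) * exp ((w \<bullet> w) / (2 * s)) * heat_kernel (2 * s) z"
proof -
  have "0 \<le> (z + 2 *\<^sub>R w) \<bullet> (z + 2 *\<^sub>R w)" by simp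
  then have "(z \<bullet> z) / 2 - w \<bullet> w \<le> (z + w) \<bullet> (z + w)"
    by (simp add: inner_simps inner_commute)
  then have e: "exp (- ((z + w) \<bullet> (z + w)) / (2 * s)) \<le> exp ((w \<bullet> w) / (2 * s)) * exp (- (z \<bullet> z) / (2 * (2 * s)))"
    using assms by (simp add: exp_add[symmetric] field_simps)
  have "sqrt (2 * pi * (2 * s)) = sqrt 2 * sqrt (2 * pi * s)"
    by (simp add: real_sqrt_mult)
  then have c: "1 / sqrt (2 * pi * s) = sqrt 2 * (1 / sqrt (2 * pi * (2 * s)))" using assms by simp
  have "heat_kernel s (z + w) \<le> (1 / sqrt (2 * pi * s)) ^ DIM('a) * (exp ((w \<bullet> w) / (2 * s)) * exp (- (z \<bullet> z) / (2 * (2 * s))))"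
    unfolding heat_kernel_def using assms e by (intro mult_left_mono) auto
  then show ?thesis unfolding c heat_kernel_def by (simp only: power_mult_distrib mult_ac)
qed

lemma heat_deriv_translate_bound:
  fixes z :: "'a::euclidean_space"
  assumes "s > 0" and l: "\<forall>b\<in>set l. norm b \<le> 1" and w: "norm w \<le> 1"
  shows "\<bar>heat_deriv l s (z + w)\<bar> \<le>
    5 * 2 ^ DIM('a) * (1 + 1 / s) * exp (1 / (4 * s)) * heat_kernel (4 * s) z"
proof -
  have ww: "w \<bullet> w \<le> 1" using w by (simp add: norm_le_square)
  have "\<bar>heat_deriv l s (z + w)\<bar> \<le> 5 * sqrt 2 ^ DIM('a) * (1 + 1 / s) * heat_kernel (2 * s) (z + w)"
    by (rule heat_deriv_bound) fact+
  also have "\<dots> \<le> 5 * sqrt 2 ^ DIM('a) * (1 + 1 / s) *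
     (sqrt 2 ^ DIM('a) * exp ((w \<bullet> w) / (2 * (2 * s))) * heat_kernel (2 * (2 * s)) z)"
    using assms by (intro mult_left_mono heat_kernel_translate) auto
  also have "\<dots> \<le> 5 * sqrt 2 ^ DIM('a) * (1 + 1 / s) *
     (sqrt 2 ^ DIM('a) * exp (1 / (4 * s)) * heat_kernel (2 * (2 * s)) z)"
    using assms ww by (intro mult_left_mono mult_right_mono heat_kernel_nonneg) (auto simp: divide_right_mono)
  also have "\<dots> = 5 * (sqrt 2 ^ DIM('a) * sqrt 2 ^ DIM('a)) * (1 + 1 / s) * exp (1 / (4 * s)) * heat_kernel (4 * s) z"
    by (simp add: mult_ac)
  also have "sqrt 2 ^ DIM('a) * sqrt 2 ^ DIM('a) = 2 ^ DIM('a)"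
    by (simp add: power_mult_distrib[symmetric])
  finally show ?thesis .
qed

text \<open>A majorant valid for all \<open>s\<close> near \<open>s0\<close>. As
  \<open>2 * s\<close> lies between \<open>s0\<close> and \<open>4 * s0\<close>, the prefactor is
  largest at \<open>s0\<close> and the exponential at \<open>4 * s0\<close>; rewriting the prefactor
  for \<open>4 * s0\<close> costs \<open>2 ^ DIM('a)\<close>.\<close>

lemma heat_deriv_time_bound:
  fixes z :: "'a::euclidean_space"
  assumes "s0 > 0" "s0 / 2 < s" "s < 2 * s0" and l: "\<forall>b\<in>set l. norm b \<le> 1"
  shows "\<bar>heat_deriv l s z\<bar> \<le>
    5 * sqrt 2 ^ DIM('a) * (1 + 2 / s0) * 2 ^ DIM('a) * heat_kernel (4 * s0) z"
proof -
  have s: "s > 0" using assms by linarith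
  have "\<bar>heat_deriv l s z\<bar> \<le> 5 * sqrt 2 ^ DIM('a) * (1 + 1 / s) * heat_kernel (2 * s) z"
    by (rule heat_deriv_bound) fact+
  also have "\<dots> \<le> 5 * sqrt 2 ^ DIM('a) * (1 + 2 / s0) * (2 ^ DIM('a) * heat_kernel (4 * s0) z)"
  proof (intro mult_mono)
    show "1 + 1 / s \<le> 1 + 2 / s0" using assms s by (simp add: field_simps)
    have "1 / sqrt (2 * pi * (2 * s)) \<le> 1 / sqrt (2 * pi * s0)"
      using assms by (intro divide_left_mono) auto
    also have "sqrt (2 * pi * (4 * s0)) = sqrt (4 * (2 * pi * s0))" by (simp add: mult_ac)
    then have "sqrt (2 * pi * (4 * s0)) = 2 * sqrt (2 * pi * s0)" unfolding real_sqrt_mult[of 4] by simp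
    then have "1 / sqrt (2 * pi * s0) = 2 * (1 / sqrt (2 * pi * (4 * s0)))" by simp
    finally have "(1 / sqrt (2 * pi * (2 * s))) ^ DIM('a) \<le> (2 * (1 / sqrt (2 * pi * (4 * s0)))) ^ DIM('a)"
      using s by (intro power_mono) auto
    moreover have "exp (- (z \<bullet> z) / (2 * (2 * s))) \<le> exp (- (z \<bullet> z) / (2 * (4 * s0)))"
      using assms s by (auto simp: divide_left_mono)
    ultimately have "heat_kernel (2 * s) z \<le> (2 * (1 / sqrt (2 * pi * (4 * s0)))) ^ DIM('a) * exp (- (z \<bullet> z) / (2 * (4 * s0)))"
      unfolding heat_kernel_def using s assms by (intro mult_mono) auto
    then show "heat_kernel (2 * s) z \<le> 2 ^ DIM('a) * heat_kernel (4 * s0) z"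
      by (simp only: heat_kernel_def power_mult_distrib mult_ac)
  qed (use s assms in \<open>auto simp: heat_kernel_nonneg\<close>)
  finally show ?thesis by (simp add: mult_ac)
qed

lemma heat_kernel_convolution:
  fixes x :: "'a::euclidean_space"
  assumes "s > 0" "r > 0"
  shows "(\<integral>y. heat_kernel s (x - y) * heat_kernel r y \<partial>lborel) = heat_kernel (s + r) x"
    and "integrable lborel (\<lambda>y. heat_kernel s (x - y) * heat_kernel r y)"
proof -
  \<comment> \<open>Completing the square in \<open>y\<close>: \<open>q\<close> and \<open>m\<close>
    are the variance and the mean of a Brownian bridge from 0 to \<open>x\<close> over the time
    \<open>s + r\<close>, observed at time \<open>r\<close>.\<close>
  define q where "q = s * r / (s + r)"
  define m where "m = (r / (s + r)) *\<^sub>R x"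
  have q: "q > 0" using assms by (simp add: q_def)
  have *: "heat_kernel s (x - y) * heat_kernel r y = heat_kernel (s + r) x * heat_kernel q (m - y)" for y
  proof -
    have "sqrt (2 * pi * s) * sqrt (2 * pi * r) = sqrt (2 * pi * (s + r)) * sqrt (2 * pi * q)"
      using assms by (simp add: q_def real_sqrt_mult[symmetric])
    then have 1: "1 / sqrt (2 * pi * s) * (1 / sqrt (2 * pi * r)) = 1 / sqrt (2 * pi * (s + r)) * (1 / sqrt (2 * pi * q))"
      by simp
    have "- ((x - y) \<bullet> (x - y)) / (2 * s) + - (y \<bullet> y) / (2 * r) =
       - (x \<bullet> x) / (2 * (s + r)) + - ((m - y) \<bullet> (m - y)) / (2 * q)"
    proof -
      define T where "T = s + r"
      have T: "T > 0" using assms by (simp add: T_def)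
      have "((m - y) \<bullet> (m - y)) / q = ((r / T)\<^sup>2 * (x \<bullet> x) - 2 * (r / T) * (x \<bullet> y) + y \<bullet> y) * (T / (s * r))"
        by (simp add: q_def m_def T_def inner_simps inner_commute[of y x] power2_eq_square right_diff_distrib diff_divide_distrib)
      also have "\<dots> = r / (T * s) * (x \<bullet> x) - 2 / s * (x \<bullet> y) + T / (s * r) * (y \<bullet> y)"
        using assms T by (simp add: field_simps power2_eq_square)
      also have "r / (T * s) = 1 / s - 1 / T" using assms T by (simp add: field_simps T_def)
      also have "T / (s * r) = 1 / s + 1 / r" using assms T by (simp add: field_simps T_def)
      finally have "((m - y) \<bullet> (m - y)) / q =
        (1 / s - 1 / T) * (x \<bullet> x) - 2 / s * (x \<bullet> y) + (1 / s + 1 / r) * (y \<bullet> y)" .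
      moreover have "((x - y) \<bullet> (x - y)) / s = (1 / s) * (x \<bullet> x) - 2 / s * (x \<bullet> y) + (1 / s) * (y \<bullet> y)"
        by (simp add: inner_simps inner_commute[of y x] diff_divide_distrib add_divide_distrib)
      ultimately have "((x - y) \<bullet> (x - y)) / s + (y \<bullet> y) / r = (x \<bullet> x) / T + ((m - y) \<bullet> (m - y)) / q"
        by (simp add: left_diff_distrib distrib_right)
      then show ?thesis unfolding T_def[symmetric]
        by (metis (no_types, opaque_lifting) add_divide_distrib divide_divide_eq_left' minus_add_distrib minus_divide_left)
    qed
    then have 2: "exp (- ((x - y) \<bullet> (x - y)) / (2 * s)) * exp (- (y \<bullet> y) / (2 * r)) =
       exp (- (x \<bullet> x) / (2 * (s + r))) * exp (- ((m - y) \<bullet> (m - y)) / (2 * q))"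
      by (simp add: exp_add[symmetric])
    have "heat_kernel s (x - y) * heat_kernel r y =
      (1 / sqrt (2 * pi * s) * (1 / sqrt (2 * pi * r))) ^ DIM('a) *
      (exp (- ((x - y) \<bullet> (x - y)) / (2 * s)) * exp (- (y \<bullet> y) / (2 * r)))"
      unfolding heat_kernel_def by (simp only: power_mult_distrib mult_ac)
    also have "\<dots> = heat_kernel (s + r) x * heat_kernel q (m - y)"
      unfolding 1 2 heat_kernel_def by (simp only: power_mult_distrib mult_ac)
    finally show ?thesis .
  qed
  show "(\<integral>y. heat_kernel s (x - y) * heat_kernel r y \<partial>lborel) = heat_kernel (s + r) x"
    unfolding * by (simp add: integral_lborel_diff[of "heat_kernel q"] integral_heat_kernel[OF q])
  show "integrable lborel (\<lambda>y. heat_kernel s (x - y) * heat_kernel r y)"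
    unfolding * by (intro integrable_mult_right integrable_lborel_diff integrable_heat_kernel q)
qed

section \<open>The heat semigroup on bounded measurable functions, with all derivatives carried by
  the kernel\<close>

definition heat_int :: "'a::euclidean_space list \<Rightarrow> real \<Rightarrow> ('a \<Rightarrow> real) \<Rightarrow> 'a \<Rightarrow> real" where
  "heat_int l s g x = (\<integral>z. heat_deriv l s (x - z) * g z \<partial>lborel)"

lemma integrable_heat_deriv:
  assumes "s > 0" "\<forall>b\<in>set l. norm b \<le> 1"
  shows "integrable lborel (heat_deriv l s :: 'a::euclidean_space \<Rightarrow> real)"
proof (rule Bochner_Integration.integrable_bound)
  show "integrable lborel (\<lambda>z::'a. 5 * sqrt 2 ^ DIM('a) * (1 + 1 / s) * heat_kernel (2 * s) z)"
    using assms by (intro integrable_mult_right integrable_heat_kernel) auto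
qed (use heat_deriv_bound[OF assms] in \<open>auto intro!: AE_I2 order_trans[OF _ abs_ge_self]\<close>)

lemma integrable_mult_bounded:
  fixes f g :: "'a \<Rightarrow> real"
  assumes f: "integrable M f" and [measurable]: "g \<in> borel_measurable M"
    and bnd: "\<And>z. z \<in> space M \<Longrightarrow> \<bar>g z\<bar> \<le> K"
  shows "integrable M (\<lambda>z. f z * g z)"
proof (rule Bochner_Integration.integrable_bound)
  show "integrable M (\<lambda>z. K * f z)" using f by simp
  show "(\<lambda>z. f z * g z) \<in> borel_measurable M" using f by measurable
  show "AE x in M. norm (f x * g x) \<le> norm (K * f x)"
  proof (rule AE_I2)
    fix z assume z: "z \<in> space M"
    have "\<bar>f z\<bar> * \<bar>g z\<bar> \<le> \<bar>f z\<bar> * \<bar>K\<bar>"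
      using bnd[OF z] by (intro mult_left_mono) auto
    then show "norm (f z * g z) \<le> norm (K * f z)" by (simp add: abs_mult mult.commute)
  qed
qed

lemma integrable_heat_int:
  fixes g :: "'a::euclidean_space \<Rightarrow> real"
  assumes "s > 0" "\<forall>b\<in>set l. norm b \<le> 1" "g \<in> borel_measurable borel" "\<And>z. \<bar>g z\<bar> \<le> K"
  shows "integrable lborel (\<lambda>z. heat_deriv l s (x - z) * g z)"
  using assms
  by (intro integrable_mult_bounded[where K=K] integrable_lborel_diff integrable_heat_deriv) auto

lemma heat_int_diff:
  fixes g h :: "'a::euclidean_space \<Rightarrow> real"
  assumes "s > 0" "\<forall>b\<in>set l. norm b \<le> 1" "g \<in> borel_measurable borel" "\<And>z. \<bar>g z\<bar> \<le> K"
    "h \<in> borel_measurable borel" "\<And>z. \<bar>h z\<bar> \<le> K'"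
  shows "heat_int l s (\<lambda>z. g z - h z) x = heat_int l s g x - heat_int l s h x"
  unfolding heat_int_def right_diff_distrib
  by (rule Bochner_Integration.integral_diff) (intro integrable_heat_int; use assms in auto)+

lemma borel_measurable_heat_int[measurable]:
  assumes [measurable]: "g \<in> borel_measurable borel"
  shows "heat_int l s g \<in> borel_measurable (borel :: 'a::euclidean_space measure)"
proof -
  have "(\<lambda>(x, z). heat_deriv l s (x - z) * g z) \<in> borel_measurable (borel \<Otimes>\<^sub>M (lborel :: 'a measure))"
    by measurable
  then show ?thesis unfolding heat_int_def
    by (rule sigma_finite_measure.borel_measurable_lebesgue_integral[OF sigma_finite_lborel, simplified])
qed

lemma heat_int_bound:
  fixes g :: "'a::euclidean_space \<Rightarrow> real"
  assumes "s > 0" "g \<in> borel_measurable borel" "\<And>z. \<bar>g z\<bar> \<le> K"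
  shows "\<bar>heat_int [] s g x\<bar> \<le> K"
proof -
  have "\<bar>heat_int [] s g x\<bar> \<le> (\<integral>z. heat_kernel s (x - z) * K \<partial>lborel)"
    unfolding heat_int_def using assms
    by (intro integral_abs_bound_integral integrable_heat_int integrable_mult_left
        integrable_lborel_diff integrable_heat_kernel)
      (auto simp: abs_mult heat_kernel_nonneg intro!: mult_left_mono)
  also have "\<dots> = K"
    using assms by (simp add: integral_lborel_diff[of "heat_kernel s"] integral_heat_kernel)
  finally show ?thesis .
qed

lemma heat_int_has_derivative_line:
  fixes g :: "'a::euclidean_space \<Rightarrow> real"
  assumes s: "s > 0" and l: "\<forall>b\<in>set l. norm b \<le> 1" "length l \<le> 1" and b: "norm b \<le> 1"
    and g[measurable]: "g \<in> borel_measurable borel" "\<And>z. \<bar>g z\<bar> \<le> K"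
  shows "((\<lambda>h. heat_int l s g (x + h *\<^sub>R b)) has_real_derivative heat_int (b # l) s g x) (at 0)"
proof -
  define C where "C = 5 * 2 ^ DIM('a) * (1 + 1 / s) * exp (1 / (4 * s))"
  have lb: "\<forall>c\<in>set (b # l). norm c \<le> 1" using l b by simp
  have "((\<lambda>h. \<integral>z. heat_deriv l s (x + h *\<^sub>R b - z) * g z \<partial>lborel) has_real_derivative
     (\<integral>z. heat_deriv (b # l) s (x + 0 *\<^sub>R b - z) * g z \<partial>lborel)) (at 0)"
  proof (rule has_real_derivative_lebesgue_integral[where a="-1" and b=1 and
        w="\<lambda>z. C * heat_kernel (4 * s) (x - z) * K"])
    show "integrable lborel (\<lambda>z. heat_deriv l s (x + h *\<^sub>R b - z) * g z)" for h
      by (rule integrable_heat_int) (use assms in auto)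
    show "((\<lambda>h. heat_deriv l s (x + h *\<^sub>R b - z) * g z) has_real_derivative
       heat_deriv (b # l) s (x + h *\<^sub>R b - z) * g z) (at h)" for h z
      using DERIV_cmult_right[OF heat_deriv_has_derivative_line[OF s l(2), of "x - z" b h], of "g z"]
      by (simp add: algebra_simps)
    show "\<bar>heat_deriv (b # l) s (x + h *\<^sub>R b - z) * g z\<bar> \<le> C * heat_kernel (4 * s) (x - z) * K"
      if "-1 < h" "h < 1" for h z
    proof -
      have "norm (h *\<^sub>R b) \<le> 1" using that b by (simp add: mult_le_one)
      from heat_deriv_translate_bound[OF s lb this, of "x - z"]
      have "\<bar>heat_deriv (b # l) s (x + h *\<^sub>R b - z)\<bar> \<le> C * heat_kernel (4 * s) (x - z)"
        by (simp add: C_def algebra_simps)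
      then show ?thesis unfolding abs_mult using g(2)[of z] by (intro mult_mono) auto
    qed
    show "integrable lborel (\<lambda>z. C * heat_kernel (4 * s) (x - z) * K)"
      using s by (intro integrable_mult_left integrable_mult_right integrable_lborel_diff integrable_heat_kernel) auto
  qed auto
  then show ?thesis unfolding heat_int_def by simp
qed

text \<open>Time enters twice, through the kernel and through the function averaged. The product
  rule separates the two, and the heat equation for the kernel turns the first contribution into
  half the Laplacian.\<close>

lemma heat_int_time_derivative:
  fixes U U' :: "real \<Rightarrow> 'a::euclidean_space \<Rightarrow> real"
  assumes s0: "s0 > 0"
    and U[measurable]: "\<And>s. s > 0 \<Longrightarrow> U s \<in> borel_measurable borel" "\<And>s z. s > 0 \<Longrightarrow> \<bar>U s z\<bar> \<le> K"
    and U': "\<And>s z. s > 0 \<Longrightarrow> ((\<lambda>s. U s z) has_real_derivative U' s z) (at s)"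
      "\<And>s z. s > 0 \<Longrightarrow> \<bar>U' s z\<bar> \<le> K'"
  shows "((\<lambda>s. heat_int [] s (U s) x) has_real_derivative
    (\<Sum>b\<in>Basis. heat_int [b, b] s0 (U s0) x) / 2 + heat_int [] s0 (U' s0) x) (at s0)"
proof -
  define C where "C = 5 * sqrt 2 ^ DIM('a) * (1 + 2 / s0) * 2 ^ DIM('a)"
  have C: "\<bar>heat_deriv l s z\<bar> \<le> C * heat_kernel (4 * s0) z"
    if "s0 / 2 < s" "s < 2 * s0" "\<forall>b\<in>set l. norm b \<le> 1" for l s and z :: 'a
    using heat_deriv_time_bound[OF s0 that] by (simp add: C_def)
  have mU'[measurable]: "U' s \<in> borel_measurable borel" if "s > 0" for s
    by (rule borel_measurable_real_derivative[of 0 s "s + 1" U]) (use that U U' in auto)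
  have "((\<lambda>s. \<integral>z. heat_deriv [] s (x - z) * U s z \<partial>lborel) has_real_derivative
     (\<integral>z. (\<Sum>b\<in>Basis. heat_deriv [b, b] s0 (x - z)) / 2 * U s0 z + U' s0 z * heat_deriv [] s0 (x - z) \<partial>lborel)) (at s0)"
  proof (rule has_real_derivative_lebesgue_integral[where a="s0 / 2" and b="2 * s0" and
        w="\<lambda>z. (DIM('a) * (C * heat_kernel (4 * s0) (x - z))) / 2 * K + K' * (C * heat_kernel (4 * s0) (x - z))"])
    fix s assume s: "s0 / 2 < s" "s < 2 * s0"
    then have s1: "s > 0" using s0 by simp
    show "integrable lborel (\<lambda>z. heat_deriv [] s (x - z) * U s z)"
      by (rule integrable_heat_int) (use s1 U in auto)
    fix z
    show "((\<lambda>s. heat_deriv [] s (x - z) * U s z) has_real_derivative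
        (\<Sum>b\<in>Basis. heat_deriv [b, b] s (x - z)) / 2 * U s z + U' s z * heat_deriv [] s (x - z)) (at s)"
      using DERIV_mult[OF heat_kernel_DERIV_time[OF s1, of "x - z"] U'(1)[OF s1, of z]] by simp
    have "\<bar>\<Sum>b\<in>Basis. heat_deriv [b, b] s (x - z)\<bar> \<le> DIM('a) * (C * heat_kernel (4 * s0) (x - z))"
      by (intro order_trans[OF sum_abs] sum_bounded_above C[OF s]) auto
    then have "\<bar>(\<Sum>b\<in>Basis. heat_deriv [b, b] s (x - z)) / 2 * U s z\<bar> \<le>
       (DIM('a) * (C * heat_kernel (4 * s0) (x - z))) / 2 * K"
      unfolding abs_mult using U(2)[OF s1, of z] by (intro mult_mono) auto
    moreover have "\<bar>U' s z * heat_deriv [] s (x - z)\<bar> \<le> K' * (C * heat_kernel (4 * s0) (x - z))"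
      unfolding abs_mult using U'(2)[OF s1, of z] C[OF s, of "[]" "x - z"] by (intro mult_mono) auto
    ultimately show "\<bar>(\<Sum>b\<in>Basis. heat_deriv [b, b] s (x - z)) / 2 * U s z + U' s z * heat_deriv [] s (x - z)\<bar> \<le>
      (DIM('a) * (C * heat_kernel (4 * s0) (x - z))) / 2 * K + K' * (C * heat_kernel (4 * s0) (x - z))"
      by linarith
  next
    show "integrable lborel (\<lambda>z. (DIM('a) * (C * heat_kernel (4 * s0) (x - z))) / 2 * K + K' * (C * heat_kernel (4 * s0) (x - z)))"
      using s0 by (intro Bochner_Integration.integrable_add integrable_mult_left integrable_mult_right integrable_divide
          integrable_lborel_diff integrable_heat_kernel) auto
  qed (use s0 in auto)
  also have "(\<integral>z. (\<Sum>b\<in>Basis. heat_deriv [b, b] s0 (x - z)) / 2 * U s0 z + U' s0 z * heat_deriv [] s0 (x - z) \<partial>lborel) =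
    (\<integral>z. (\<Sum>b\<in>Basis. heat_deriv [b, b] s0 (x - z) * U s0 z) / 2 + heat_deriv [] s0 (x - z) * U' s0 z \<partial>lborel)"
    by (simp add: sum_distrib_right mult.commute[of "U' _ _"])
  also have "\<dots> = (\<Sum>b\<in>Basis. heat_int [b, b] s0 (U s0) x) / 2 + heat_int [] s0 (U' s0) x"
  proof -
    have 1: "integrable lborel (\<lambda>z. heat_deriv [b, b] s0 (x - z) * U s0 z)" if "b \<in> Basis" for b
      by (rule integrable_heat_int) (use s0 U that in auto)
    have 2: "integrable lborel (\<lambda>z. heat_deriv [] s0 (x - z) * U' s0 z)"
      by (rule integrable_heat_int) (use s0 U' mU' in auto)
    show ?thesis unfolding heat_int_def
      using 1 2 by (subst Bochner_Integration.integral_add) (auto simp: Bochner_Integration.integral_sum)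
  qed
  finally show ?thesis unfolding heat_int_def .
qed

text \<open>The localisation estimate: a function small only near \<open>x\<close> still has small
  derivatives of its heat average at \<open>x\<close>. Where \<open>dist x z\<close> is at least
  \<open>\<delta>\<close>, doubling the variance once more, from \<open>2 * s\<close> to
  \<open>4 * s\<close>, yields the factor \<open>exp (- \<delta>\<^sup>2 / (8 * s))\<close>.\<close>

lemma heat_int_near_far_bound:
  fixes g :: "'a::euclidean_space \<Rightarrow> real"
  assumes s: "s > 0" and l: "\<forall>b\<in>set l. norm b \<le> 1" and "\<delta> > 0"
    and g[measurable]: "g \<in> borel_measurable borel" "\<And>z. \<bar>g z\<bar> \<le> K"
    and near: "\<And>z. dist x z < \<delta> \<Longrightarrow> \<bar>g z\<bar> \<le> \<epsilon>" and "\<epsilon> \<ge> 0"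
  shows "\<bar>heat_int l s g x\<bar> \<le>
    5 * sqrt 2 ^ DIM('a) * (1 + 1 / s) * (\<epsilon> + sqrt 2 ^ DIM('a) * exp (- \<delta>\<^sup>2 / (8 * s)) * K)"
proof -
  define A where "A = 5 * sqrt 2 ^ DIM('a) * (1 + 1 / s)"
  define E where "E = sqrt 2 ^ DIM('a) * exp (- \<delta>\<^sup>2 / (8 * s))"
  have A: "A \<ge> 0" using s by (simp add: A_def)
  have E: "E \<ge> 0" by (simp add: E_def)
  have K: "K \<ge> 0" using g(2)[of 0] by linarith
  have pw: "\<bar>heat_deriv l s (x - z) * g z\<bar> \<le> A * (\<epsilon> * heat_kernel (2 * s) (x - z) + E * K * heat_kernel (4 * s) (x - z))" for z
  proof -
    have p: "heat_kernel (2 * s) (x - z) \<ge> 0" "heat_kernel (4 * s) (x - z) \<ge> 0"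
      using s by (simp_all add: heat_kernel_nonneg)
    have "heat_kernel (2 * s) (x - z) * \<bar>g z\<bar> \<le> \<epsilon> * heat_kernel (2 * s) (x - z) + E * K * heat_kernel (4 * s) (x - z)"
    proof (cases "dist x z < \<delta>")
      case True
      then show ?thesis using near[OF True] p E K mult_left_mono[OF near[OF True] p(1)]
        by (auto simp: mult_ac intro: add_increasing2)
    next
      case False
      then have "\<delta>\<^sup>2 \<le> (x - z) \<bullet> (x - z)"
        using \<open>\<delta> > 0\<close> by (simp add: dist_norm power2_norm_eq_inner[symmetric] power_mono)
      then have "exp (- ((x - z) \<bullet> (x - z)) / (4 * (2 * s))) \<le> exp (- \<delta>\<^sup>2 / (8 * s))"
        using s by (simp add: divide_right_mono)
      then have "heat_kernel (2 * s) (x - z) \<le> E * heat_kernel (4 * s) (x - z)"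
        using p s unfolding E_def by (subst heat_kernel_double) (auto intro!: mult_right_mono mult_left_mono)
      then have "heat_kernel (2 * s) (x - z) * \<bar>g z\<bar> \<le> (E * heat_kernel (4 * s) (x - z)) * K"
        using g(2)[of z] p E by (intro mult_mono) auto
      then show ?thesis using \<open>\<epsilon> \<ge> 0\<close> p by (auto simp: mult_ac intro: add_increasing)
    qed
    moreover have "\<bar>heat_deriv l s (x - z) * g z\<bar> \<le> A * (heat_kernel (2 * s) (x - z) * \<bar>g z\<bar>)"
      unfolding abs_mult mult.assoc[symmetric] A_def
      by (intro mult_right_mono heat_deriv_bound s l) auto
    ultimately show ?thesis using A by (meson mult_left_mono order_trans)
  qed
  have "\<bar>heat_int l s g x\<bar> \<le> (\<integral>z. A * (\<epsilon> * heat_kernel (2 * s) (x - z) + E * K * heat_kernel (4 * s) (x - z)) \<partial>lborel)"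
    unfolding heat_int_def
    using s l g pw
    by (intro integral_abs_bound_integral integrable_heat_int integrable_mult_right Bochner_Integration.integrable_add
        integrable_lborel_diff integrable_heat_kernel) auto
  also have "\<dots> = A * (\<epsilon> + E * K)"
    using s by (simp add: integral_lborel_diff[of "heat_kernel _"] integral_heat_kernel
        integrable_lborel_diff integrable_heat_kernel)
  finally show ?thesis by (simp add: A_def E_def mult_ac)
qed

text \<open>Fubini and the convolution identity of the kernels. Absolute integrability holds because
  the inner integral of the absolute value is \<open>heat_int [] r\<close> of
  \<open>\<bar>g z\<bar>\<close>, which is bounded by \<open>K\<close>.\<close>

lemma heat_int_semigroup:
  fixes g :: "'a::euclidean_space \<Rightarrow> real"
  assumes s: "s > 0" and r: "r > 0" and g[measurable]: "g \<in> borel_measurable borel" "\<And>z. \<bar>g z\<bar> \<le> K"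
  shows "heat_int [] (s + r) g x = heat_int [] s (heat_int [] r g) x"
proof -
  define k where "k y z = heat_kernel s (x - y) * (heat_kernel r (y - z) * g z)" for y z
  have [measurable]: "(\<lambda>(y, z). k y z) \<in> borel_measurable (lborel \<Otimes>\<^sub>M lborel)"
    unfolding k_def by measurable
  have int_r: "integrable lborel (\<lambda>z. heat_kernel r (y - z) * g z)" for y
    using integrable_heat_int[of r "[]" g K y] r g by simp
  have 1: "heat_int [] s (heat_int [] r g) x = (\<integral>y. (\<integral>z. k y z \<partial>lborel) \<partial>lborel)"
    by (simp add: heat_int_def k_def)
  have "integrable (lborel \<Otimes>\<^sub>M lborel) (\<lambda>(y, z). k y z)"
  proof (rule lborel_pair.Fubini_integrable)
    show "AE y in lborel. integrable lborel (\<lambda>z. case (y, z) of (y, z) \<Rightarrow> k y z)"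
      using int_r by (auto simp: k_def)
    have a: "(\<integral>z. norm (k y z) \<partial>lborel) = heat_kernel s (x - y) * heat_int [] r (\<lambda>z. \<bar>g z\<bar>) y" for y
      using s r by (simp add: k_def heat_int_def abs_mult heat_kernel_nonneg)
    have "\<bar>heat_int [] r (\<lambda>z. \<bar>g z\<bar>) y\<bar> \<le> K" for y
      by (rule heat_int_bound) (use r g in auto)
    then have "integrable lborel (\<lambda>y. heat_kernel s (x - y) * heat_int [] r (\<lambda>z. \<bar>g z\<bar>) y)"
      using s by (intro integrable_mult_bounded[where K=K] integrable_lborel_diff integrable_heat_kernel) auto
    then show "integrable lborel (\<lambda>y. \<integral>z. norm (case (y, z) of (y, z) \<Rightarrow> k y z) \<partial>lborel)"
      unfolding prod.case a .
  qed measurable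
  from lborel_pair.Fubini_integral[OF this]
  have 2: "heat_int [] s (heat_int [] r g) x = (\<integral>z. (\<integral>y. k y z \<partial>lborel) \<partial>lborel)"
    unfolding 1 by simp
  have "(\<integral>y. k y z \<partial>lborel) = heat_kernel (s + r) (x - z) * g z" for z
  proof -
    have "(\<integral>y. k y z \<partial>lborel) = (\<integral>y. heat_kernel s (x - y) * heat_kernel r (y - z) \<partial>lborel) * g z"
      unfolding k_def mult.assoc[symmetric] by simp
    also have "(\<integral>y. heat_kernel s (x - y) * heat_kernel r (y - z) \<partial>lborel) =
       (\<integral>y. heat_kernel s (x - (z + y)) * heat_kernel r ((z + y) - z) \<partial>lborel)"
      by (rule integral_lborel_shift[symmetric]) measurable
    also have "\<dots> = heat_kernel (s + r) (x - z)"
      using heat_kernel_convolution(1)[OF s r, of "x - z"] by (simp add: algebra_simps)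
    finally show ?thesis .
  qed
  then show ?thesis unfolding 2 by (simp add: heat_int_def)
qed

lemma continuous_on_heat_int:
  fixes G :: "real \<Rightarrow> 'a::euclidean_space \<Rightarrow> real"
  assumes s: "s > 0" and l: "\<forall>b\<in>set l. norm b \<le> 1" and T: "open T"
    and G: "\<And>t. t \<in> T \<Longrightarrow> G t \<in> borel_measurable borel" "\<And>t z. t \<in> T \<Longrightarrow> \<bar>G t z\<bar> \<le> K"
      "\<And>z. continuous_on T (\<lambda>t. G t z)"
  shows "continuous_on (T \<times> UNIV) (\<lambda>(t, x). heat_int l s (G t) x)"
proof (rule continuous_at_imp_continuous_on, safe)
  fix t and x :: 'a assume t: "t \<in> T"
  define N where "N = T \<times> ball x 1"
  have N: "open N" "(t, x) \<in> N" using T t by (auto simp: N_def open_Times)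
  define C where "C = 5 * 2 ^ DIM('a) * (1 + 1 / s) * exp (1 / (4 * s))"
  have "continuous (at (t, x) within N)
    (\<lambda>q. \<integral>z. heat_deriv l s (snd q - z) * G (fst q) z \<partial>lborel)"
  proof (rule continuous_within_lebesgue_integral[where w="\<lambda>z. C * heat_kernel (4 * s) (x - z) * K"])
    show "(\<lambda>z. heat_deriv l s (snd q - z) * G (fst q) z) \<in> borel_measurable lborel" if "q \<in> N" for q
    proof -
      have [measurable]: "G (fst q) \<in> borel_measurable borel" using G(1) that by (auto simp: N_def)
      show ?thesis by measurable
    qed
    show "continuous (at (t, x) within N) (\<lambda>q. heat_deriv l s (snd q - z) * G (fst q) z)" for z
    proof -
      have "continuous_on N (\<lambda>q. heat_deriv l s (snd q - z) * G (fst q) z)"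
        by (intro continuous_intros continuous_on_compose2[OF continuous_on_heat_deriv]
           continuous_on_compose2[OF G(3)]) (auto simp: N_def)
      then show ?thesis using N(2) by (auto simp: continuous_on_eq_continuous_within)
    qed
    show "\<bar>heat_deriv l s (snd q - z) * G (fst q) z\<bar> \<le> C * heat_kernel (4 * s) (x - z) * K"
      if "q \<in> N" for q z
    proof -
      have "norm (snd q - x) \<le> 1" using that by (auto simp: N_def dist_norm norm_minus_commute)
      from heat_deriv_translate_bound[OF s l this, of "x - z"]
      have "\<bar>heat_deriv l s (snd q - z)\<bar> \<le> C * heat_kernel (4 * s) (x - z)"
        by (simp add: C_def)
      then show ?thesis unfolding abs_mult using G(2)[of "fst q" z] that by (intro mult_mono) (auto simp: N_def)
    qed
    show "integrable lborel (\<lambda>z. C * heat_kernel (4 * s) (x - z) * K)"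
      using s by (intro integrable_mult_left integrable_mult_right integrable_lborel_diff integrable_heat_kernel) auto
  qed (use N in auto)
  then show "isCont (\<lambda>(t, x). heat_int l s (G t) x) (t, x)"
    using N by (simp add: at_within_open[OF N(2) N(1)] heat_int_def split_def)
qed

lemma heat_int_param_derivative:
  fixes G G' :: "real \<Rightarrow> 'a::euclidean_space \<Rightarrow> real"
  assumes s: "s > 0" and l: "\<forall>b\<in>set l. norm b \<le> 1" and t: "a < t" "t < b"
    and G: "\<And>t. a < t \<Longrightarrow> t < b \<Longrightarrow> G t \<in> borel_measurable borel"
      "\<And>t z. a < t \<Longrightarrow> t < b \<Longrightarrow> \<bar>G t z\<bar> \<le> K"
    and G': "\<And>t z. a < t \<Longrightarrow> t < b \<Longrightarrow> ((\<lambda>t. G t z) has_real_derivative G' t z) (at t)"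
      "\<And>t z. a < t \<Longrightarrow> t < b \<Longrightarrow> \<bar>G' t z\<bar> \<le> K'"
  shows "((\<lambda>t. heat_int l s (G t) x) has_real_derivative heat_int l s (G' t) x) (at t)"
  unfolding heat_int_def
proof (rule has_real_derivative_lebesgue_integral[where a=a and b=b and
      w="\<lambda>z. \<bar>heat_deriv l s (x - z)\<bar> * K'"])
  show "integrable lborel (\<lambda>z. heat_deriv l s (x - z) * G h z)" if "a < h" "h < b" for h
    by (rule integrable_heat_int) (use s l G that in auto)
  show "integrable lborel (\<lambda>z. \<bar>heat_deriv l s (x - z)\<bar> * K')"
    using s l by (intro integrable_mult_left integrable_abs integrable_lborel_diff integrable_heat_deriv) auto
  show "((\<lambda>h. heat_deriv l s (x - z) * G h z) has_real_derivative heat_deriv l s (x - z) * G' h z) (at h)"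
    if "a < h" "h < b" for h z using G'(1)[OF that] by (rule DERIV_cmult)
  show "\<bar>heat_deriv l s (x - z) * G' h z\<bar> \<le> \<bar>heat_deriv l s (x - z)\<bar> * K'"
    if "a < h" "h < b" for h z using G'(2)[OF that, of z] by (simp add: abs_mult mult_left_mono)
qed (use t in auto)

text \<open>Both sides are derivatives along \<open>b\<close> of functions that agree by induction
  at every point. All derivatives thus fall on the outer factor of time \<open>s\<close>, and the
  inner average is only required to be bounded.\<close>

lemma heat_int_deriv_semigroup:
  fixes g :: "'a::euclidean_space \<Rightarrow> real"
  assumes s: "s > 0" and r: "r > 0" and l: "\<forall>b\<in>set l. norm b \<le> 1" "length l \<le> 2"
    and g[measurable]: "g \<in> borel_measurable borel" "\<And>z. \<bar>g z\<bar> \<le> K"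
  shows "heat_int l (s + r) g x = heat_int l s (heat_int [] r g) x"
  using l
proof (induction l arbitrary: x)
  case Nil
  show ?case by (rule heat_int_semigroup) fact+
next
  case (Cons b l)
  have 1: "((\<lambda>h. heat_int l (s + r) g (x + h *\<^sub>R b)) has_real_derivative heat_int (b # l) (s + r) g x) (at 0)"
    by (rule heat_int_has_derivative_line) (use s r Cons.prems g in auto)
  have 2: "((\<lambda>h. heat_int l s (heat_int [] r g) (x + h *\<^sub>R b)) has_real_derivative
      heat_int (b # l) s (heat_int [] r g) x) (at 0)"
    by (rule heat_int_has_derivative_line[where K=K])
      (use s r Cons.prems g heat_int_bound[OF r g] in auto)
  have "heat_int l (s + r) g (x + h *\<^sub>R b) = heat_int l s (heat_int [] r g) (x + h *\<^sub>R b)" for h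
    using Cons by simp
  with 1 2 show ?case by (simp add: DERIV_unique)
qed

section \<open>Regularity from an approximate Markov property\<close>

lemma partial_deriv_eqI:
  "((\<lambda>h. g (p + h *\<^sub>R b)) has_real_derivative d) (at 0) \<Longrightarrow> partial_deriv b g p = d"
  unfolding partial_deriv_def by (rule DERIV_imp_deriv)

lemma eventually_line_in_open:
  fixes p b :: "'a::real_normed_vector"
  assumes "open cylinder" "p \<in> cylinder"
  shows "\<forall>\<^sub>F h in nhds (0::real). p + h *\<^sub>R b \<in> cylinder"
proof -
  have "((\<lambda>h::real. p + h *\<^sub>R b) \<longlongrightarrow> p + 0 *\<^sub>R b) (nhds 0)"
    by (intro tendsto_intros filterlim_ident)
  then show ?thesis using assms by (auto simp: tendsto_def)
qed

text \<open>The function \<open>u\<close> is prescribed on the space-time domain only and is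
  arbitrary elsewhere; openness makes its line derivatives there depend on the prescribed values
  alone.\<close>

lemma DERIV_line_cong:
  fixes p b :: "'a::real_normed_vector"
  assumes "open cylinder" "p \<in> cylinder" "\<And>q. q \<in> cylinder \<Longrightarrow> f q = g q"
  shows "((\<lambda>h. f (p + h *\<^sub>R b)) has_real_derivative d) (at 0) \<longleftrightarrow>
    ((\<lambda>h. g (p + h *\<^sub>R b)) has_real_derivative d) (at 0)"
  by (rule DERIV_cong_ev) (use eventually_line_in_open[OF assms(1,2), of b] assms(3) in \<open>auto elim: eventually_mono\<close>)

lemma cont_diff_on_cong:
  assumes "open cylinder" "\<And>p. p \<in> cylinder \<Longrightarrow> f p = g p" "cont_diff_on k cylinder f"
  shows "cont_diff_on k cylinder g"
  using assms(2,3)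
proof (induction k arbitrary: f g)
  case 0
  then show ?case using continuous_on_cong[of cylinder cylinder f g] by auto
next
  case (Suc k)
  have "partial_deriv b f p = partial_deriv b g p" if "p \<in> cylinder" for b p
    unfolding partial_deriv_def deriv_def
    using DERIV_line_cong[where f=f and g=g, OF assms(1) that Suc.prems(1)] by simp
  moreover have "(\<lambda>h. g (p + h *\<^sub>R b)) differentiable at 0"
    if "(\<lambda>h. f (p + h *\<^sub>R b)) differentiable at 0" "p \<in> cylinder" for b p
    using that DERIV_line_cong[where f=f and g=g, OF assms(1) that(2) Suc.prems(1)] by (auto simp: real_differentiable_def)
  moreover have "cont_diff_on k cylinder (partial_deriv b g)"
    if "cont_diff_on k cylinder (partial_deriv b f)" for b
    using Suc.IH[OF _ that] \<open>\<And>p b. p \<in> cylinder \<Longrightarrow> partial_deriv b f p = partial_deriv b g p\<close> by blast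
  ultimately show ?case
    using Suc.prems continuous_on_cong[of cylinder cylinder f g] by simp
qed

lemma cont_diff_on_SucI:
  assumes "open cylinder" "continuous_on cylinder f"
    and "\<And>b. b \<in> Basis \<Longrightarrow> \<exists>f'. (\<forall>p\<in>cylinder. ((\<lambda>h. f (p + h *\<^sub>R b)) has_real_derivative f' p) (at 0)) \<and>
      cont_diff_on k cylinder f'"
  shows "cont_diff_on (Suc k) cylinder f"
  unfolding cont_diff_on.simps
proof (intro conjI ballI assms(2))
  fix b :: 'a assume "b \<in> Basis"
  then obtain f' where f': "\<And>p. p \<in> cylinder \<Longrightarrow> ((\<lambda>h. f (p + h *\<^sub>R b)) has_real_derivative f' p) (at 0)"
    "cont_diff_on k cylinder f'" using assms(3) by blast
  show "(\<lambda>h. f (p + h *\<^sub>R b)) differentiable at 0" if "p \<in> cylinder" for p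
    using f'(1)[OF that] by (auto simp: real_differentiable_def)
  show "cont_diff_on k cylinder (partial_deriv b f)"
    by (rule cont_diff_on_cong[OF assms(1) _ f'(2)]) (simp add: partial_deriv_eqI[OF f'(1)])
qed

lemma cont_diff_on_empty: "cont_diff_on k {} g"
  by (induction k arbitrary: g) auto

text \<open>The hypothesis speaks of parameter \<open>0\<close> on the line through each
  \<open>q\<close>. Sliding \<open>q\<close> along the line through \<open>p\<close> makes it a
  statement at every small parameter, where term-by-term differentiation applies.\<close>

lemma partial_derivative_uniform_limit:
  fixes p b :: "'a::real_normed_vector"
  assumes N: "open N" "p \<in> N"
    and der: "\<And>n q. q \<in> N \<Longrightarrow> ((\<lambda>h. A n (q + h *\<^sub>R b)) has_real_derivative B n q) (at 0)"
    and lim: "\<And>q. q \<in> N \<Longrightarrow> (\<lambda>n. A n q) \<longlonglongrightarrow> A' q"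
    and unif: "uniform_limit N B B' sequentially"
  shows "((\<lambda>h. A' (p + h *\<^sub>R b)) has_real_derivative B' p) (at 0)"
proof -
  obtain \<eta> :: real where \<eta>: "\<eta> > 0" "\<And>h. \<bar>h\<bar> < \<eta> \<Longrightarrow> p + h *\<^sub>R b \<in> N"
    using eventually_line_in_open[OF N, of b] by (auto simp: eventually_nhds_metric dist_real_def)
  have "((\<lambda>h. A' (p + h *\<^sub>R b)) has_real_derivative B' (p + 0 *\<^sub>R b)) (at 0)"
  proof (rule has_real_derivative_uniform_limit[OF \<eta>(1)])
    fix n and h :: real assume "\<bar>h\<bar> < \<eta>"
    from der[OF \<eta>(2)[OF this], of n]
    have "((\<lambda>k. A n (p + (k + h) *\<^sub>R b)) has_real_derivative B n (p + h *\<^sub>R b)) (at 0)"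
      by (simp add: algebra_simps)
    then show "((\<lambda>h. A n (p + h *\<^sub>R b)) has_real_derivative B n (p + h *\<^sub>R b)) (at h)"
      using DERIV_shift[of "\<lambda>h. A n (p + h *\<^sub>R b)" _ 0 h] by simp
  next
    show "(\<lambda>n. A n (p + h *\<^sub>R b)) \<longlonglongrightarrow> A' (p + h *\<^sub>R b)" if "\<bar>h\<bar> < \<eta>" for h
      by (rule lim) (rule \<eta>(2)[OF that])
    show "uniform_limit {-\<eta><..<\<eta>} (\<lambda>n h. B n (p + h *\<^sub>R b)) (\<lambda>h. B' (p + h *\<^sub>R b)) sequentially"
      by (rule uniform_limit_compose'[OF unif]) (auto intro!: \<eta>(2))
  qed
  then show ?thesis by simp
qed

lemma geometric_Cauchy:
  fixes a :: "nat \<Rightarrow> real"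
  assumes a: "\<And>n. \<bar>a n - a (Suc n)\<bar> \<le> C * (1/2) ^ Suc n"
  shows "a \<longlonglongrightarrow> lim a" and "\<bar>a n - lim a\<bar> \<le> C * (1/2) ^ n"
proof -
  have C: "C \<ge> 0" using order_trans[OF abs_ge_zero a[of 0]] by simp
  have *: "\<bar>a n - a (n + k)\<bar> \<le> C * ((1/2) ^ n - (1/2) ^ (n + k))" for n k
  proof (induction k)
    case (Suc k)
    have "\<bar>a n - a (n + Suc k)\<bar> \<le> \<bar>a n - a (n + k)\<bar> + \<bar>a (n + k) - a (Suc (n + k))\<bar>" by simp
    also have "\<dots> \<le> C * ((1/2) ^ n - (1/2) ^ (n + k)) + C * (1/2) ^ Suc (n + k)"
      by (intro add_mono Suc.IH a)
    also have "\<dots> = C * ((1/2) ^ n - (1/2) ^ (n + Suc k))" by (simp add: algebra_simps)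
    finally show ?case .
  qed simp
  have **: "\<bar>a n - a m\<bar> \<le> C * (1/2) ^ n" if "n \<le> m" for n m
  proof -
    have "\<bar>a n - a m\<bar> \<le> C * ((1/2) ^ n - (1/2) ^ m)" using *[of n "m - n"] that by simp
    also have "\<dots> \<le> C * (1/2) ^ n" using C by (intro mult_left_mono) auto
    finally show ?thesis .
  qed
  have z: "(\<lambda>n. C * (1/2) ^ n) \<longlonglongrightarrow> 0"
    by (intro tendsto_mult_right_zero LIMSEQ_realpow_zero) auto
  have "Cauchy a"
  proof (rule metric_CauchyI)
    fix e :: real assume "e > 0"
    then obtain M where M: "C * (1/2) ^ M < e"
      using order_tendstoD(2)[OF z] by (auto simp: eventually_sequentially)
    have le: "dist (a m) (a n) < e" if "m \<ge> M" "n \<ge> m" for m n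
    proof -
      have "C * (1/2) ^ m \<le> C * (1/2) ^ M" using that C by (intro mult_left_mono power_decreasing) auto
      then show ?thesis using **[OF that(2)] M unfolding dist_real_def by linarith
    qed
    then have "dist (a m) (a n) < e" if "m \<ge> M" "n \<ge> M" for m n
      using that le[of n m] by (cases "m \<le> n") (auto simp: dist_commute)
    then show "\<exists>M. \<forall>m\<ge>M. \<forall>n\<ge>M. dist (a m) (a n) < e" by blast
  qed
  then show l: "a \<longlonglongrightarrow> lim a" by (simp add: Cauchy_convergent convergent_LIMSEQ_iff[symmetric])
  have "(\<lambda>m. \<bar>a n - a m\<bar>) \<longlonglongrightarrow> \<bar>a n - lim a\<bar>" by (intro tendsto_intros l)
  then show "\<bar>a n - lim a\<bar> \<le> C * (1/2) ^ n"
    by (rule LIMSEQ_le_const2) (use ** in blast)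
qed

text \<open>The interface between probability and analysis. The index \<open>j\<close> counts
  \<open>t\<close>-derivatives and \<open>s\<close> is the time added to the exit time. Bounds and
  measurability are asked on the whole space, since the heat semigroup averages over all of it; the
  Markov defect is controlled only at points whose distance from the complement of \<open>S\<close>
  is at least \<open>\<delta>\<close>.\<close>

locale caloric_family =
  fixes U :: "nat \<Rightarrow> real \<Rightarrow> real \<Rightarrow> 'a::euclidean_space \<Rightarrow> real" and S :: "'a set"
  assumes open_S: "open S"
    and measurable_U: "\<And>j t s. 0 < t \<Longrightarrow> 0 \<le> s \<Longrightarrow> U j t s \<in> borel_measurable borel"
    and bounded_U: "\<And>j a b. 0 < a \<Longrightarrow> \<exists>K. \<forall>t\<in>{a..b}. \<forall>s\<ge>0. \<forall>z. \<bar>U j t s z\<bar> \<le> K"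
    and time_derivative_U: "\<And>j t s z. 0 < t \<Longrightarrow> 0 \<le> s \<Longrightarrow>
      ((\<lambda>t. U j t s z) has_real_derivative U (Suc j) t s z) (at t)"
    and heat_derivative_U: "\<And>t s z. 0 < t \<Longrightarrow> 0 < s \<Longrightarrow>
      ((\<lambda>s. U 0 t s z) has_real_derivative - U 2 t s z / 2) (at s)"
    and approx_Markov: "\<And>j a b \<delta>. 0 < a \<Longrightarrow> 0 < \<delta> \<Longrightarrow>
      \<exists>K. \<forall>t\<in>{a..b}. \<forall>s\<ge>0. \<forall>r\<in>{0<..1}. \<forall>z. ball z \<delta> \<subseteq> S \<longrightarrow>
        \<bar>heat_int [] r (U j t (s + r)) z - U j t s z\<bar> \<le> K * r\<^sup>2"
begin

section \<open>Convergence of the heat averages and their derivatives along dyadic times\<close>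

definition V :: "'a list \<Rightarrow> nat \<Rightarrow> real \<Rightarrow> real \<times> 'a \<Rightarrow> real" where
  "V l j s p = heat_int l s (U j (fst p) s) (snd p)"

definition cylinder :: "(real \<times> 'a) set" where
  "cylinder = {0<..} \<times> S"

definition dirs :: "nat \<Rightarrow> 'a list set" where
  "dirs n = {l. set l \<subseteq> Basis \<and> length l \<le> n}"

lemma dirs_norm: "l \<in> dirs n \<Longrightarrow> \<forall>b\<in>set l. norm b \<le> 1"
  by (auto simp: dirs_def)

lemma open_cylinder: "open cylinder"
  unfolding cylinder_def by (intro open_Times open_S) auto

lemma bounded_UE:
  assumes "0 < a"
  obtains K where "\<And>t s z. a \<le> t \<Longrightarrow> t \<le> b \<Longrightarrow> 0 \<le> s \<Longrightarrow> \<bar>U j t s z\<bar> \<le> K"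
  using bounded_U[OF assms, of b j] by (metis atLeastAtMost_iff)

lemma approx_MarkovE:
  assumes "0 < a" "0 < \<delta>"
  obtains K where "\<And>t s r z. a \<le> t \<Longrightarrow> t \<le> b \<Longrightarrow> 0 \<le> s \<Longrightarrow> 0 < r \<Longrightarrow> r \<le> 1 \<Longrightarrow> ball z \<delta> \<subseteq> S \<Longrightarrow>
    \<bar>heat_int [] r (U j t (s + r)) z - U j t s z\<bar> \<le> K * r\<^sup>2"
  using approx_Markov[OF assms, of b j] by (metis atLeastAtMost_iff greaterThanAtMost_iff)

text \<open>By the semigroup law the increment is \<open>heat_int l s\<close> of the Markov defect
  \<open>g\<close>. Within \<open>\<epsilon>\<close> of \<open>x\<close> the defect is quadratic in
  \<open>r\<close>, hence in \<open>s\<close>, and elsewhere it is at most \<open>2 * K\<close>,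
  damped by a Gaussian tail of at most \<open>128 * s\<^sup>2 / \<epsilon> ^ 4\<close>. Two
  derivatives cost \<open>2 / s\<close>, which leaves a bound linear in \<open>s\<close>.\<close>

lemma V_increment:
  assumes "0 < a" "0 < \<delta>" and x0: "ball x0 (2 * \<delta>) \<subseteq> S" and l: "l \<in> dirs 2"
  shows "\<exists>C. \<forall>t\<in>{a..b}. \<forall>x\<in>ball x0 \<delta>. \<forall>s r. 0 < r \<and> r \<le> s \<and> s \<le> 1 \<longrightarrow>
    \<bar>V l j (s + r) (t, x) - V l j s (t, x)\<bar> \<le> C * s"
proof -
  \<comment> \<open>If \<open>z\<close> is within \<open>\<epsilon>\<close> of \<open>x\<close>,
    then the \<open>\<epsilon>\<close>-ball around \<open>z\<close> stays within
    \<open>\<delta> + \<epsilon> + \<epsilon> = 2 * \<delta>\<close> of \<open>x0\<close>, hence in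
    \<open>S\<close>.\<close>
  define \<epsilon> where "\<epsilon> = \<delta> / 2"
  have \<epsilon>: "\<epsilon> > 0" using assms by (simp add: \<epsilon>_def)
  obtain K where K: "\<And>t s z. a \<le> t \<Longrightarrow> t \<le> b \<Longrightarrow> 0 \<le> s \<Longrightarrow> \<bar>U j t s z\<bar> \<le> K"
    using bounded_UE[OF \<open>0 < a\<close>] by blast
  obtain K' where K': "\<And>t s r z. a \<le> t \<Longrightarrow> t \<le> b \<Longrightarrow> 0 \<le> s \<Longrightarrow> 0 < r \<Longrightarrow> r \<le> 1 \<Longrightarrow> ball z \<epsilon> \<subseteq> S \<Longrightarrow>
      \<bar>heat_int [] r (U j t (s + r)) z - U j t s z\<bar> \<le> K' * r\<^sup>2"
    using approx_MarkovE[OF \<open>0 < a\<close> \<epsilon>] by blast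
  define D where "D = sqrt 2 ^ DIM('a)"
  define C where "C = 5 * D * 2 * (\<bar>K'\<bar> + D * (128 / \<epsilon> ^ 4) * (2 * K))"
  have "\<bar>V l j (s + r) (t, x) - V l j s (t, x)\<bar> \<le> C * s"
    if t: "t \<in> {a..b}" and x: "x \<in> ball x0 \<delta>" and sr: "0 < r" "r \<le> s" "s \<le> 1" for t x s r
  proof -
    have s: "s > 0" using sr by simp
    have t0: "t > 0" using t assms by simp
    have [measurable]: "U j t s' \<in> borel_measurable borel" if "0 \<le> s'" for s'
      using measurable_U[OF t0 that] .
    have K0: "K \<ge> 0" using K[of t 0 0] t by simp
    define g where "g z = heat_int [] r (U j t (s + r)) z - U j t s z" for z
    have hb: "\<bar>heat_int [] r (U j t (s + r)) z\<bar> \<le> K" for z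
      by (rule heat_int_bound) (use K t s sr in auto)
    have eq: "V l j (s + r) (t, x) - V l j s (t, x) = heat_int l s g x"
    proof -
      have "heat_int l (s + r) (U j t (s + r)) x = heat_int l s (heat_int [] r (U j t (s + r))) x"
        by (rule heat_int_deriv_semigroup[where K=K])
          (use s sr dirs_norm[OF l] l K t in \<open>auto simp: dirs_def\<close>)
      moreover have "heat_int l s g x = heat_int l s (heat_int [] r (U j t (s + r))) x - heat_int l s (U j t s) x"
        unfolding g_def
        by (rule heat_int_diff[where K=K and K'=K]) (use s sr dirs_norm[OF l] K t hb in auto)
      ultimately show ?thesis by (simp add: V_def)
    qed
    have "\<bar>heat_int l s g x\<bar> \<le> 5 * D * (1 + 1 / s) * (\<bar>K'\<bar> * s\<^sup>2 + D * exp (- \<epsilon>\<^sup>2 / (8 * s)) * (2 * K))"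
      unfolding D_def
    proof (rule heat_int_near_far_bound[OF s dirs_norm[OF l] \<epsilon>])
      show "g \<in> borel_measurable borel" unfolding g_def
        using s sr t0 by (intro borel_measurable_diff borel_measurable_heat_int measurable_U) auto
      show "\<bar>g z\<bar> \<le> 2 * K" for z unfolding g_def using hb[of z] K[of t s z] s t by fastforce
      show "\<bar>g z\<bar> \<le> \<bar>K'\<bar> * s\<^sup>2" if "dist x z < \<epsilon>" for z
      proof -
        have "ball z \<epsilon> \<subseteq> ball x0 (2 * \<delta>)"
        proof
          fix y assume "y \<in> ball z \<epsilon>"
          then have "dist x0 y < \<delta> + \<epsilon> + \<epsilon>"
            using x that dist_triangle[of x0 y x] dist_triangle[of x y z] by (simp add: dist_commute)
          then show "y \<in> ball x0 (2 * \<delta>)" by (simp add: \<epsilon>_def)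
        qed
        then have "\<bar>g z\<bar> \<le> K' * r\<^sup>2" unfolding g_def using x0 sr s t by (intro K') auto
        also have "\<dots> \<le> \<bar>K'\<bar> * s\<^sup>2" using sr by (intro mult_mono power_mono) auto
        finally show ?thesis .
      qed
    qed auto
    also have "\<dots> \<le> 5 * D * (2 / s) * (\<bar>K'\<bar> * s\<^sup>2 + D * (128 * s\<^sup>2 / \<epsilon> ^ 4) * (2 * K))"
    proof (intro mult_mono add_mono mult_left_mono mult_right_mono)
      show "1 + 1 / s \<le> 2 / s" using s sr by (simp add: field_simps)
      define y where "y = \<epsilon>\<^sup>2 / (8 * s)"
      have y: "y > 0" using \<epsilon> s by (simp add: y_def)
      have "exp (- y) \<le> 2 / y\<^sup>2" by (rule exp_minus_le_inverse_square[OF y])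
      also have "2 / y\<^sup>2 = 128 * s\<^sup>2 / \<epsilon> ^ 4"
        by (simp add: y_def power_divide power_mult_distrib flip: power_mult)
      finally show "exp (- \<epsilon>\<^sup>2 / (8 * s)) \<le> 128 * s\<^sup>2 / \<epsilon> ^ 4" by (simp add: y_def)
    qed (use s K0 in \<open>auto simp: D_def\<close>)
    also have "\<dots> = C * s" using s by (simp add: C_def field_simps power2_eq_square)
    finally show ?thesis unfolding eq .
  qed
  then show ?thesis by blast
qed

text \<open>Since \<open>lim\<close> is total, the value is meaningful only where convergence is
  proved: at points of \<open>cylinder\<close>, with at most two directions in
  \<open>l\<close>.\<close>

definition L :: "'a list \<Rightarrow> nat \<Rightarrow> real \<times> 'a \<Rightarrow> real" where
  "L l j p = lim (\<lambda>n. V l j ((1/2) ^ n) p)"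

lemma cylinder_neighbourhood:
  assumes "p \<in> cylinder"
  obtains a b x0 \<delta> where "0 < a" "0 < \<delta>" "ball x0 (2 * \<delta>) \<subseteq> S" "p \<in> {a<..<b} \<times> ball x0 \<delta>"
    "{a<..<b} \<times> ball x0 \<delta> \<subseteq> cylinder"
proof -
  obtain t x where p: "p = (t, x)" "t > 0" "x \<in> S" using assms by (auto simp: cylinder_def)
  obtain e where e: "e > 0" "ball x e \<subseteq> S" using open_S p(3) openE by blast
  show thesis
  proof (rule that[of "t / 2" "e / 2" x "t + 1"])
    show "{t/2<..<t + 1} \<times> ball x (e / 2) \<subseteq> cylinder" using e p by (force simp: cylinder_def)
  qed (use p e in auto)
qed

text \<open>The last clause also controls times between consecutive dyadic ones; the mean value
  theorem in the proof of the wave equation produces such a time.\<close>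

lemma V_geometric:
  assumes "0 < a" "0 < \<delta>" "ball x0 (2 * \<delta>) \<subseteq> S" "l \<in> dirs 2"
  obtains C where "\<And>n p. p \<in> {a<..<b} \<times> ball x0 \<delta> \<Longrightarrow> \<bar>V l j ((1/2) ^ n) p - L l j p\<bar> \<le> C * (1/2) ^ n"
    "\<And>p. p \<in> {a<..<b} \<times> ball x0 \<delta> \<Longrightarrow> (\<lambda>n. V l j ((1/2) ^ n) p) \<longlonglongrightarrow> L l j p"
    "\<And>n p r. p \<in> {a<..<b} \<times> ball x0 \<delta> \<Longrightarrow> 0 < r \<Longrightarrow> r \<le> (1/2) ^ n \<Longrightarrow>
       \<bar>V l j ((1/2) ^ n + r) p - V l j ((1/2) ^ n) p\<bar> \<le> C * (1/2) ^ n"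
proof -
  obtain C where C: "\<And>t x s r. t \<in> {a..b} \<Longrightarrow> x \<in> ball x0 \<delta> \<Longrightarrow> 0 < r \<Longrightarrow> r \<le> s \<Longrightarrow> s \<le> 1 \<Longrightarrow>
    \<bar>V l j (s + r) (t, x) - V l j s (t, x)\<bar> \<le> C * s"
    using V_increment[OF assms, of b j] by blast
  have 1: "\<bar>V l j ((1/2) ^ n) p - V l j ((1/2) ^ Suc n) p\<bar> \<le> C * (1/2) ^ Suc n"
    if "p \<in> {a<..<b} \<times> ball x0 \<delta>" for n p
  proof -
    \<comment> \<open>Taking both \<open>s\<close> and \<open>r\<close> equal to
      \<open>(1/2) ^ Suc n\<close>, the extreme case of \<open>r \<le> s\<close>, links consecutive
      dyadic times.\<close>
    have "(1/2 :: real) ^ Suc n + (1/2) ^ Suc n = (1/2) ^ n" by simp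
    moreover have "(1/2 :: real) ^ Suc n \<le> 1" by (rule power_le_one) auto
    ultimately show ?thesis
      using C[of "fst p" "snd p" "(1/2) ^ Suc n" "(1/2) ^ Suc n"] that by (auto simp del: power_Suc)
  qed
  show thesis
  proof (rule that[of C])
    show "\<bar>V l j ((1/2) ^ n) p - L l j p\<bar> \<le> C * (1/2) ^ n" if "p \<in> {a<..<b} \<times> ball x0 \<delta>" for n p
      unfolding L_def using geometric_Cauchy(2)[of "\<lambda>n. V l j ((1/2) ^ n) p", OF 1[OF that]] .
    show "(\<lambda>n. V l j ((1/2) ^ n) p) \<longlonglongrightarrow> L l j p" if "p \<in> {a<..<b} \<times> ball x0 \<delta>" for p
      unfolding L_def using geometric_Cauchy(1)[of "\<lambda>n. V l j ((1/2) ^ n) p", OF 1[OF that]] .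
    show "\<bar>V l j ((1/2) ^ n + r) p - V l j ((1/2) ^ n) p\<bar> \<le> C * (1/2) ^ n"
      if "p \<in> {a<..<b} \<times> ball x0 \<delta>" "0 < r" "r \<le> (1/2) ^ n" for n p r
      using C[of "fst p" "snd p" r "(1/2) ^ n"] that by (auto simp: power_le_one)
  qed
qed

lemma V_uniform_limit:
  assumes "0 < a" "0 < \<delta>" "ball x0 (2 * \<delta>) \<subseteq> S" "l \<in> dirs 2"
  shows "uniform_limit ({a<..<b} \<times> ball x0 \<delta>) (\<lambda>n. V l j ((1/2) ^ n)) (L l j) sequentially"
proof -
  obtain C where C: "\<And>n p. p \<in> {a<..<b} \<times> ball x0 \<delta> \<Longrightarrow> \<bar>V l j ((1/2) ^ n) p - L l j p\<bar> \<le> C * (1/2) ^ n"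
    using V_geometric[OF assms] by metis
  show ?thesis
  proof (rule uniform_limitI)
    fix e :: real assume "e > 0"
    have "(\<lambda>n. C * (1/2) ^ n) \<longlonglongrightarrow> 0" by (intro tendsto_mult_right_zero LIMSEQ_realpow_zero) auto
    from order_tendstoD(2)[OF this \<open>e > 0\<close>]
    show "\<forall>\<^sub>F n in sequentially. \<forall>p\<in>{a<..<b} \<times> ball x0 \<delta>. dist (V l j ((1/2) ^ n) p) (L l j p) < e"
    proof eventually_elim
      case (elim n)
      then show ?case using C[of _ n] unfolding dist_real_def by (blast intro: le_less_trans)
    qed
  qed
qed

lemma V_continuous:
  assumes "0 < a" "s > 0" "l \<in> dirs 2"
  shows "continuous_on ({a<..<b} \<times> UNIV) (V l j s)"
proof -
  obtain K where K: "\<And>t s z. a \<le> t \<Longrightarrow> t \<le> b \<Longrightarrow> 0 \<le> s \<Longrightarrow> \<bar>U j t s z\<bar> \<le> K"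
    using bounded_UE[OF \<open>0 < a\<close>] by blast
  have "continuous_on ({a<..<b} \<times> UNIV) (\<lambda>(t, x). heat_int l s (U j t s) x)"
  proof (rule continuous_on_heat_int[where K=K])
    show "continuous_on {a<..<b} (\<lambda>t. U j t s z)" for z
      by (intro continuous_at_imp_continuous_on ballI DERIV_isCont[OF time_derivative_U]) (use assms in auto)
  qed (use assms K dirs_norm measurable_U in auto)
  then show ?thesis by (simp add: V_def[abs_def] split_def)
qed

lemma L_continuous:
  assumes "l \<in> dirs 2"
  shows "continuous_on cylinder (L l j)"
proof (rule continuous_at_imp_continuous_on, rule ballI)
  fix p assume "p \<in> cylinder"
  then obtain a b x0 \<delta> where N: "0 < a" "0 < \<delta>" "ball x0 (2 * \<delta>) \<subseteq> S" "p \<in> {a<..<b} \<times> ball x0 \<delta>"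
    by (rule cylinder_neighbourhood)
  have "continuous_on ({a<..<b} \<times> ball x0 \<delta>) (L l j)"
    by (rule uniform_limit_theorem[OF _ V_uniform_limit[OF N(1-3) assms]])
      (auto intro!: always_eventually continuous_on_subset[OF V_continuous[OF N(1) _ assms]])
  then show "isCont (L l j) p"
    using N(4) by (subst (asm) continuous_on_eq_continuous_at) (auto intro: open_Times)
qed

lemma L_partial_derivative:
  assumes p: "p \<in> cylinder" and l: "l \<in> dirs 2" "l' \<in> dirs 2"
    and der: "\<And>s q. s > 0 \<Longrightarrow> q \<in> cylinder \<Longrightarrow> ((\<lambda>h. V l j s (q + h *\<^sub>R b)) has_real_derivative V l' j' s q) (at 0)"
  shows "((\<lambda>h. L l j (p + h *\<^sub>R b)) has_real_derivative L l' j' p) (at 0)"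
proof -
  obtain a d x0 \<delta> where N: "0 < a" "0 < \<delta>" "ball x0 (2 * \<delta>) \<subseteq> S" "p \<in> {a<..<d} \<times> ball x0 \<delta>"
    "{a<..<d} \<times> ball x0 \<delta> \<subseteq> cylinder"
    using p by (rule cylinder_neighbourhood)
  show ?thesis
  proof (rule partial_derivative_uniform_limit[OF _ N(4), where A="\<lambda>n. V l j ((1/2) ^ n)"])
    show "(\<lambda>n. V l j ((1/2) ^ n) q) \<longlonglongrightarrow> L l j q" if "q \<in> {a<..<d} \<times> ball x0 \<delta>" for q
      using V_geometric[OF N(1-3) l(1)] that by metis
    show "uniform_limit ({a<..<d} \<times> ball x0 \<delta>) (\<lambda>n. V l' j' ((1/2) ^ n)) (L l' j') sequentially"
      by (rule V_uniform_limit) fact+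
  qed (use N(5) in \<open>auto intro!: open_Times der\<close>)
qed

lemma V_space_derivative:
  assumes "p \<in> cylinder" "s > 0" "l \<in> dirs 1" "b \<in> Basis"
  shows "((\<lambda>h. V l j s (p + h *\<^sub>R (0, b))) has_real_derivative V (b # l) j s p) (at 0)"
proof -
  have t: "0 < fst p" using assms by (auto simp: cylinder_def)
  obtain K where K: "\<And>t s z. fst p \<le> t \<Longrightarrow> t \<le> fst p \<Longrightarrow> 0 \<le> s \<Longrightarrow> \<bar>U j t s z\<bar> \<le> K"
    using bounded_UE[OF t] by blast
  have "((\<lambda>h. heat_int l s (U j (fst p) s) (snd p + h *\<^sub>R b)) has_real_derivative
      heat_int (b # l) s (U j (fst p) s) (snd p)) (at 0)"
    by (rule heat_int_has_derivative_line[where K=K])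
      (use assms K dirs_norm[OF assms(3)] in \<open>auto simp: dirs_def cylinder_def intro!: measurable_U\<close>)
  then show ?thesis by (simp add: V_def)
qed

lemma V_time_derivative:
  assumes "p \<in> cylinder" "s > 0" "l \<in> dirs 2"
  shows "((\<lambda>h. V l j s (p + h *\<^sub>R (1, 0))) has_real_derivative V l (Suc j) s p) (at 0)"
proof -
  define t where "t = fst p"
  have t: "t > 0" using assms by (auto simp: cylinder_def t_def)
  then have t2: "t / 2 > 0" by simp
  obtain K where K: "\<And>t' s z. t/2 \<le> t' \<Longrightarrow> t' \<le> t + 1 \<Longrightarrow> 0 \<le> s \<Longrightarrow> \<bar>U j t' s z\<bar> \<le> K"
    using bounded_UE[OF t2] by blast
  obtain K' where K': "\<And>t' s z. t/2 \<le> t' \<Longrightarrow> t' \<le> t + 1 \<Longrightarrow> 0 \<le> s \<Longrightarrow> \<bar>U (Suc j) t' s z\<bar> \<le> K'"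
    using bounded_UE[OF t2] by blast
  have "((\<lambda>t. heat_int l s (U j t s) (snd p)) has_real_derivative
      heat_int l s (U (Suc j) t s) (snd p)) (at t)"
    by (rule heat_int_param_derivative[where a="t/2" and b="t+1" and K=K and K'=K'])
      (use assms K K' dirs_norm[OF assms(3)] t in \<open>auto intro!: measurable_U time_derivative_U\<close>)
  then have "((\<lambda>h. heat_int l s (U j (h + t) s) (snd p)) has_real_derivative
      heat_int l s (U (Suc j) t s) (snd p)) (at 0)"
    using DERIV_shift[of "\<lambda>t. heat_int l s (U j t s) (snd p)" _ 0 t] by simp
  then show ?thesis by (simp add: V_def t_def add.commute)
qed

lemma L_space_derivative:
  assumes "p \<in> cylinder" "l \<in> dirs 1" "b \<in> Basis"
  shows "((\<lambda>h. L l j (p + h *\<^sub>R (0, b))) has_real_derivative L (b # l) j p) (at 0)"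
  using assms by (intro L_partial_derivative V_space_derivative) (auto simp: dirs_def)

lemma L_time_derivative:
  assumes "p \<in> cylinder" "l \<in> dirs 2"
  shows "((\<lambda>h. L l j (p + h *\<^sub>R (1, 0))) has_real_derivative L l (Suc j) p) (at 0)"
  using assms by (intro L_partial_derivative V_time_derivative)

text \<open>For \<open>s = 0\<close> the Markov defect is the difference between the heat average
  and \<open>U j t 0 x\<close> itself, so the quadratic bound holds at once.\<close>

lemma Markov_approximation:
  assumes "(t, x) \<in> cylinder"
  obtains K where "\<And>n. \<bar>V [] j ((1/2) ^ n) (t, x) - U j t 0 x\<bar> \<le> K * ((1/2) ^ n)\<^sup>2"
proof -
  obtain e where e: "e > 0" "ball x e \<subseteq> S" using open_S assms by (auto simp: cylinder_def elim: openE)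
  have t: "0 < t" using assms by (simp add: cylinder_def)
  obtain K where K: "\<And>t' s r z. t \<le> t' \<Longrightarrow> t' \<le> t \<Longrightarrow> 0 \<le> s \<Longrightarrow> 0 < r \<Longrightarrow> r \<le> 1 \<Longrightarrow> ball z e \<subseteq> S \<Longrightarrow>
      \<bar>heat_int [] r (U j t' (s + r)) z - U j t' s z\<bar> \<le> K * r\<^sup>2"
    using approx_MarkovE[OF t e(1)] by blast
  show thesis
  proof (rule that)
    show "\<bar>V [] j ((1/2) ^ n) (t, x) - U j t 0 x\<bar> \<le> K * ((1/2) ^ n)\<^sup>2" for n
      using K[of t 0 "(1/2) ^ n" x] e by (simp add: V_def power_le_one)
  qed
qed

lemma L_eq_U:
  assumes "(t, x) \<in> cylinder"
  shows "L [] j (t, x) = U j t 0 x"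
proof -
  obtain K where K: "\<And>n. \<bar>V [] j ((1/2) ^ n) (t, x) - U j t 0 x\<bar> \<le> K * ((1/2) ^ n)\<^sup>2"
    using Markov_approximation[OF assms] by metis
  have "(\<lambda>n::nat. K * ((1/2) ^ n)\<^sup>2) \<longlonglongrightarrow> K * 0\<^sup>2"
    by (intro tendsto_intros LIMSEQ_realpow_zero) auto
  then have 0: "(\<lambda>n::nat. K * ((1/2) ^ n)\<^sup>2) \<longlonglongrightarrow> 0" by simp
  have "(\<lambda>n. V [] j ((1/2) ^ n) (t, x) - U j t 0 x) \<longlonglongrightarrow> 0"
    by (rule Lim_null_comparison[OF _ 0], rule always_eventually) (unfold real_norm_def, intro allI K)
  then have "(\<lambda>n. V [] j ((1/2) ^ n) (t, x)) \<longlonglongrightarrow> U j t 0 x"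
    by (rule LIM_zero_cancel)
  then show ?thesis unfolding L_def by (rule limI)
qed

lemma V_heat_derivative:
  assumes "p \<in> cylinder" "s > 0"
  shows "((\<lambda>s. V [] 0 s p) has_real_derivative ((\<Sum>b\<in>Basis. V [b, b] 0 s p) - V [] 2 s p) / 2) (at s)"
proof -
  define t where "t = fst p"
  have t: "t > 0" using assms by (auto simp: cylinder_def t_def)
  obtain K where K: "\<And>t' s z. t \<le> t' \<Longrightarrow> t' \<le> t \<Longrightarrow> 0 \<le> s \<Longrightarrow> \<bar>U 0 t' s z\<bar> \<le> K"
    using bounded_UE[OF t] by blast
  obtain K' where K': "\<And>t' s z. t \<le> t' \<Longrightarrow> t' \<le> t \<Longrightarrow> 0 \<le> s \<Longrightarrow> \<bar>U 2 t' s z\<bar> \<le> K'"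
    using bounded_UE[OF t] by blast
  have "((\<lambda>s. heat_int [] s (U 0 t s) (snd p)) has_real_derivative
    (\<Sum>b\<in>Basis. heat_int [b, b] s (U 0 t s) (snd p)) / 2 + heat_int [] s (\<lambda>z. - U 2 t s z / 2) (snd p)) (at s)"
  proof (rule heat_int_time_derivative[where K=K and K'=K'])
    show "\<bar>- U 2 t s z / 2\<bar> \<le> K'" if "s > 0" for s z using K'[of t s z] that by simp
    show "((\<lambda>s. U 0 t s z) has_real_derivative - U 2 t s z / 2) (at s)" if "s > 0" for s z
      using heat_derivative_U[OF t that] .
  qed (use assms t K in \<open>auto intro!: measurable_U\<close>)
  also have "heat_int [] s (\<lambda>z. - U 2 t s z / 2) (snd p) = - heat_int [] s (U 2 t s) (snd p) / 2"
    unfolding heat_int_def by simp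
  finally show ?thesis by (simp add: V_def t_def diff_divide_distrib)
qed

text \<open>Here \<open>\<psi>\<close> is the \<open>s\<close>-derivative of
  \<open>V [] 0 s p\<close>, and its limit is half the difference of the two sides. Both endpoint
  values on a dyadic interval lie within \<open>K * (\<sigma> n)\<^sup>2\<close> of the same number,
  so \<open>\<psi>\<close> is of order \<open>\<sigma> n\<close> at some intermediate time. As
  \<open>\<psi>\<close> varies over the interval by the same order only, it tends to 0.\<close>

lemma wave_equation:
  assumes p: "p \<in> cylinder"
  shows "L [] 2 p = (\<Sum>b\<in>Basis. L [b, b] 0 p)"
proof -
  define \<psi> where "\<psi> s = ((\<Sum>b\<in>Basis. V [b, b] 0 s p) - V [] 2 s p) / 2" for s
  define \<sigma> where "\<sigma> n = (1/2 :: real) ^ n" for n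
  have \<sigma>: "\<sigma> n > 0" "\<sigma> n = 2 * \<sigma> (Suc n)" for n by (simp_all add: \<sigma>_def)
  obtain a d x0 \<delta> where N: "0 < a" "0 < \<delta>" "ball x0 (2 * \<delta>) \<subseteq> S" "p \<in> {a<..<d} \<times> ball x0 \<delta>"
    using p by (rule cylinder_neighbourhood)
  have bb: "[b, b] \<in> dirs 2" if "b \<in> Basis" for b using that by (simp add: dirs_def)
  have e: "[] \<in> dirs 2" by (simp add: dirs_def)
  obtain K where K: "\<And>n. \<bar>V [] 0 (\<sigma> n) p - U 0 (fst p) 0 (snd p)\<bar> \<le> K * (\<sigma> n)\<^sup>2"
    unfolding \<sigma>_def using Markov_approximation[of "fst p" "snd p" 0] p by auto
  have K0: "K \<ge> 0" using K[of 0] by (simp add: \<sigma>_def)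
  have lim: "(\<lambda>n. V l j (\<sigma> n) p) \<longlonglongrightarrow> L l j p" if "l \<in> dirs 2" for l j
    unfolding \<sigma>_def using V_geometric[OF N(1-3) that] N(4) by metis
  have lim\<psi>: "(\<lambda>n. \<psi> (\<sigma> n)) \<longlonglongrightarrow> ((\<Sum>b\<in>Basis. L [b, b] 0 p) - L [] 2 p) / 2"
    unfolding \<psi>_def by (intro tendsto_intros lim bb e) auto
  have "\<exists>C. \<forall>n r. 0 < r \<longrightarrow> r \<le> \<sigma> n \<longrightarrow> \<bar>V l j (\<sigma> n + r) p - V l j (\<sigma> n) p\<bar> \<le> C * \<sigma> n"
    if "l \<in> dirs 2" for l j
    unfolding \<sigma>_def using V_geometric[OF N(1-3) that] N(4) by metis
  then obtain C where C: "\<And>l j n r. l \<in> dirs 2 \<Longrightarrow> 0 < r \<Longrightarrow> r \<le> \<sigma> n \<Longrightarrow>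
     \<bar>V l j (\<sigma> n + r) p - V l j (\<sigma> n) p\<bar> \<le> C l j * \<sigma> n"
    by metis
  define C' where "C' = ((\<Sum>b\<in>Basis. C [b, b] 0) + C [] 2) / 2"
  have \<psi>_inc: "\<bar>\<psi> (\<sigma> n + r) - \<psi> (\<sigma> n)\<bar> \<le> C' * \<sigma> n" if "0 < r" "r \<le> \<sigma> n" for n r
  proof -
    have "\<bar>\<Sum>b\<in>Basis. V [b, b] 0 (\<sigma> n + r) p - V [b, b] 0 (\<sigma> n) p\<bar> \<le> (\<Sum>b\<in>Basis. C [b, b] 0 * \<sigma> n)"
      using that by (intro order_trans[OF sum_abs] sum_mono C bb)
    moreover have "\<bar>V [] 2 (\<sigma> n + r) p - V [] 2 (\<sigma> n) p\<bar> \<le> C [] 2 * \<sigma> n"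
      using that by (intro C e)
    ultimately show ?thesis
      by (simp add: \<psi>_def C'_def sum_subtractf sum_distrib_right[symmetric] distrib_right
          diff_divide_distrib[symmetric] add_divide_distrib)
  qed
  have small: "\<bar>\<psi> (\<sigma> (Suc n))\<bar> \<le> (10 * K + C') * \<sigma> (Suc n)" for n
  proof -
    let ?s = "\<sigma> (Suc n)"
    have s: "?s > 0" using \<sigma> by blast
    have "?s < \<sigma> n" using \<sigma>(2)[of n] s by simp
    moreover have "((\<lambda>s. V [] 0 s p) has_real_derivative \<psi> s) (at s)" if "?s \<le> s" for s
      unfolding \<psi>_def using V_heat_derivative[OF p] that s by simp
    ultimately obtain z where z: "?s < z" "z < \<sigma> n"
      "V [] 0 (\<sigma> n) p - V [] 0 ?s p = (\<sigma> n - ?s) * \<psi> z"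
      using MVT2[of ?s "\<sigma> n" "\<lambda>s. V [] 0 s p" \<psi>] by blast
    have "\<bar>\<psi> z\<bar> * ?s = \<bar>V [] 0 (\<sigma> n) p - V [] 0 ?s p\<bar>"
      using z(3) \<sigma>(2)[of n] s by (simp add: abs_mult mult.commute)
    also have "\<dots> \<le> K * (\<sigma> n)\<^sup>2 + K * ?s\<^sup>2"
      using K[of n] K[of "Suc n"] by linarith
    \<comment> \<open>As \<open>\<sigma> n\<close> is twice \<open>?s\<close>, the sum is
      \<open>5 * K * ?s\<^sup>2\<close>; the constant 10 leaves slack.\<close>
    also have "\<dots> \<le> (10 * K * ?s) * ?s"
      using K0 \<sigma>(2)[of n] by (simp add: power2_eq_square mult_right_mono)
    finally have "\<bar>\<psi> z\<bar> \<le> 10 * K * ?s" using s by (simp add: mult_le_cancel_right)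
    moreover have "\<bar>\<psi> z - \<psi> ?s\<bar> \<le> C' * ?s"
      using \<psi>_inc[of "z - ?s" "Suc n"] z \<sigma>(2)[of n] by simp
    ultimately have "\<bar>\<psi> ?s\<bar> \<le> 10 * K * ?s + C' * ?s" by linarith
    then show ?thesis by (simp add: distrib_right)
  qed
  have "(\<lambda>n. (10 * K + C') * \<sigma> (Suc n)) \<longlonglongrightarrow> 0"
    unfolding \<sigma>_def by (intro tendsto_mult_right_zero LIMSEQ_Suc[OF LIMSEQ_realpow_zero]) auto
  then have "(\<lambda>n. \<psi> (\<sigma> (Suc n))) \<longlonglongrightarrow> 0"
    by (rule Lim_null_comparison[rotated], intro always_eventually) (unfold real_norm_def, intro allI small)
  from LIMSEQ_unique[OF this LIMSEQ_Suc[OF lim\<psi>]] show ?thesis by simp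
qed

lemma Basis_cases:
  assumes "b \<in> (Basis :: (real \<times> 'a) set)"
  obtains (time) "b = (1, 0)" | (space) c where "b = (0, c)" "c \<in> Basis"
  using assms by (auto simp: Basis_prod_def)

text \<open>The family \<open>L l j\<close> is closed under differentiation: a time derivative
  raises \<open>j\<close>, a space derivative lengthens \<open>l\<close>. Two steps from
  \<open>L [] 0\<close>, mixed ones included, never leave \<open>dirs 2\<close>, where continuity is
  known.\<close>

theorem wave_solution:
  assumes u: "\<And>t x. (t, x) \<in> cylinder \<Longrightarrow> u (t, x) = U 0 t 0 x"
  shows "cont_diff_on 2 cylinder u"
    and "p \<in> cylinder \<Longrightarrow> partial_deriv (1, 0) (partial_deriv (1, 0) u) p =
      (\<Sum>b\<in>Basis. partial_deriv (0, b) (partial_deriv (0, b) u) p)"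
proof -
  have uL: "L [] 0 p = u p" if "p \<in> cylinder" for p
    using u[of "fst p" "snd p"] L_eq_U[of "fst p" "snd p" 0] that by simp
  have 0: "cont_diff_on 0 cylinder (L l j)" if "l \<in> dirs 2" for l j
    using L_continuous[OF that] by simp
  have 1: "cont_diff_on (Suc 0) cylinder (L l j)" if l: "l \<in> dirs 1" for l j
  proof (rule cont_diff_on_SucI[OF open_cylinder])
    have l2: "l \<in> dirs 2" using l by (simp add: dirs_def)
    show "continuous_on cylinder (L l j)" using L_continuous[OF l2] .
    fix b :: "real \<times> 'a" assume "b \<in> Basis"
    then show "\<exists>f'. (\<forall>p\<in>cylinder. ((\<lambda>h. L l j (p + h *\<^sub>R b)) has_real_derivative f' p) (at 0)) \<and> cont_diff_on 0 cylinder f'"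
    proof (cases rule: Basis_cases)
      case b: time
      then show ?thesis unfolding b using L_time_derivative[OF _ l2, of _ j] 0[OF l2, of "Suc j"]
        by (intro exI[of _ "L l (Suc j)"]) simp
    next
      case (space c)
      then have "c # l \<in> dirs 2" using l by (simp add: dirs_def)
      then show ?thesis using L_space_derivative[OF _ l space(2), of _ j] 0[of "c # l" j] space
        by (intro exI[of _ "L (c # l) j"]) simp
    qed
  qed
  have "cont_diff_on (Suc (Suc 0)) cylinder (L [] 0)"
  proof (rule cont_diff_on_SucI[OF open_cylinder])
    show "continuous_on cylinder (L [] 0)" using L_continuous by (simp add: dirs_def)
    fix b :: "real \<times> 'a" assume "b \<in> Basis"
    then show "\<exists>f'. (\<forall>p\<in>cylinder. ((\<lambda>h. L [] 0 (p + h *\<^sub>R b)) has_real_derivative f' p) (at 0)) \<and> cont_diff_on (Suc 0) cylinder f'"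
    proof (cases rule: Basis_cases)
      case b: time
      then show ?thesis using b L_time_derivative[of _ "[]" 0] 1[of "[]" 1]
        by (intro exI[of _ "L [] 1"]) (simp add: dirs_def)
    next
      case (space c)
      then show ?thesis using L_space_derivative[of _ "[]" c 0] 1[of "[c]" 0] space
        by (intro exI[of _ "L [c] 0"]) (simp add: dirs_def)
    qed
  qed
  then show "cont_diff_on 2 cylinder u"
    unfolding numeral_2_eq_2 by (rule cont_diff_on_cong[OF open_cylinder uL, rotated])
  assume p: "p \<in> cylinder"
  have second: "partial_deriv b (partial_deriv b u) p = d"
    if f': "\<And>q. q \<in> cylinder \<Longrightarrow> ((\<lambda>h. L [] 0 (q + h *\<^sub>R b)) has_real_derivative f' q) (at 0)"
      and d: "((\<lambda>h. f' (p + h *\<^sub>R b)) has_real_derivative d) (at 0)" for b f' d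
  proof -
    have "partial_deriv b u q = f' q" if "q \<in> cylinder" for q
      using f'[OF that] DERIV_line_cong[where f="L [] 0" and g=u, OF open_cylinder that uL] by (intro partial_deriv_eqI) simp
    then show ?thesis
      using d DERIV_line_cong[where f="partial_deriv b u" and g=f', OF open_cylinder p] by (intro partial_deriv_eqI) simp
  qed
  have "partial_deriv (1, 0) (partial_deriv (1, 0) u) p = L [] 2 p"
    by (rule second[where f'="L [] 1"])
      (use L_time_derivative[of _ "[]"] p in \<open>simp_all add: dirs_def numeral_2_eq_2\<close>)
  moreover have "partial_deriv (0, b) (partial_deriv (0, b) u) p = L [b, b] 0 p" if "b \<in> Basis" for b
    by (rule second[where f'="L [b] 0"])
      (use L_space_derivative[of _ "[]" b] L_space_derivative[of p "[b]" b] p that in \<open>simp_all add: dirs_def\<close>)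
  ultimately show "partial_deriv (1, 0) (partial_deriv (1, 0) u) p =
      (\<Sum>b\<in>Basis. partial_deriv (0, b) (partial_deriv (0, b) u) p)"
    using wave_equation[OF p] by simp
qed

end

section \<open>The Poisson kernel of the half-plane\<close>

text \<open>The \<open>j\<close>-th \<open>t\<close>-derivative of
  \<open>t / (pi * (t\<^sup>2 + r\<^sup>2))\<close>. Written as the real part of a holomorphic
  function of \<open>t + \<i> * r\<close>, all derivatives become powers of the inverse and each
  \<open>r\<close>-derivative is a \<open>t\<close>-derivative times \<open>\<i>\<close>.\<close>

definition poisson :: "nat \<Rightarrow> real \<Rightarrow> real \<Rightarrow> real" where
  "poisson j t r = (-1) ^ j * fact j / pi * Re (inverse (of_real t + \<i> * of_real r) ^ Suc j)"

definition poisson_dr :: "real \<Rightarrow> real \<Rightarrow> real" where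
  "poisson_dr t r = 1 / pi * Re (- \<i> * inverse (of_real t + \<i> * of_real r) ^ 2)"

lemma poisson_0: "poisson 0 t r = t / (pi * (t\<^sup>2 + r\<^sup>2))"
  by (simp add: poisson_def complex_inverse Re_divide cmod_def power2_eq_square)

lemma DERIV_inverse_power:
  fixes g :: "'a::real_normed_field \<Rightarrow> 'a"
  assumes "(g has_field_derivative d) (at w)" "g w \<noteq> 0"
  shows "((\<lambda>w. inverse (g w) ^ Suc n) has_field_derivative - of_nat (Suc n) * inverse (g w) ^ Suc (Suc n) * d) (at w)"
  by (rule DERIV_power[OF DERIV_inverse_fun[OF assms], THEN DERIV_cong])
    (simp add: power_inverse algebra_simps)

lemma poisson_has_time_derivative:
  assumes "t > 0"
  shows "((\<lambda>t. poisson j t r) has_real_derivative poisson (Suc j) t r) (at t)"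
proof -
  let ?z = "of_real t + \<i> * of_real r :: complex"
  have z: "?z \<noteq> 0" using assms by (auto simp: complex_eq_iff)
  have i: "((\<lambda>w. w + \<i> * of_real r) has_field_derivative 1) (at (of_real t))"
    by (auto intro!: derivative_eq_intros)
  have "((\<lambda>w. inverse (w + \<i> * of_real r) ^ Suc j) has_field_derivative
      - of_nat (Suc j) * inverse ?z ^ Suc (Suc j)) (at (of_real t))"
    by (rule DERIV_inverse_power[OF i z, THEN DERIV_cong]) simp
  from has_vector_derivative_real_field[OF this, of UNIV]
  have "((\<lambda>t. inverse (of_real t + \<i> * of_real r) ^ Suc j) has_vector_derivative
      - of_nat (Suc j) * inverse ?z ^ Suc (Suc j)) (at t)" .
  from bounded_linear.has_vector_derivative[OF bounded_linear_Re this]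
  have "((\<lambda>t. Re (inverse (of_real t + \<i> * of_real r) ^ Suc j)) has_real_derivative
      Re (- of_nat (Suc j) * inverse ?z ^ Suc (Suc j))) (at t)"
    by (simp only: has_real_derivative_iff_has_vector_derivative)
  from DERIV_cmult[OF this, of "(-1) ^ j * fact j / pi"]
  have "((\<lambda>t. poisson j t r) has_real_derivative
     (-1) ^ j * fact j / pi * Re (of_real (- of_nat (Suc j)) * inverse ?z ^ Suc (Suc j))) (at t)"
    by (simp add: poisson_def)
  then show ?thesis
  proof (rule DERIV_cong)
    have re: "Re (of_real c * w) = c * Re w" for c w by simp
    have fs: "fact (Suc j) = real (Suc j) * fact j" by simp
    have "(-1) ^ j * fact j / pi * (- real (Suc j) * x) = (-1) ^ Suc j * (real (Suc j) * fact j) / pi * x" for x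
      by (simp add: algebra_simps)
    then show "(-1) ^ j * fact j / pi * Re (of_real (- of_nat (Suc j)) * inverse ?z ^ Suc (Suc j)) = poisson (Suc j) t r"
      unfolding poisson_def re fs .
  qed
qed

text \<open>Harmonicity in disguise: two derivatives in \<open>r\<close> bring out the square of
  \<open>\<i>\<close>, so they equal minus two derivatives in \<open>t\<close>.\<close>

lemma poisson_has_space_derivative:
  assumes "t > 0"
  shows "((\<lambda>r. poisson 0 t r) has_real_derivative poisson_dr t r) (at r)"
    and "((\<lambda>r. poisson_dr t r) has_real_derivative - poisson 2 t r) (at r)"
proof -
  let ?z = "of_real t + \<i> * of_real r :: complex"
  have z: "?z \<noteq> 0" using assms by (auto simp: complex_eq_iff)
  have i: "((\<lambda>w. of_real t + \<i> * w) has_field_derivative \<i>) (at (of_real r))"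
    by (auto intro!: derivative_eq_intros)
  have "((\<lambda>w. inverse (of_real t + \<i> * w) ^ Suc 0) has_field_derivative
      - \<i> * inverse ?z ^ 2) (at (of_real r))"
    by (rule DERIV_inverse_power[OF i z, of 0, THEN DERIV_cong]) (simp add: power2_eq_square)
  from has_vector_derivative_real_field[OF this, of UNIV]
  have "((\<lambda>r. inverse (of_real t + \<i> * of_real r) ^ Suc 0) has_vector_derivative - \<i> * inverse ?z ^ 2) (at r)" .
  from bounded_linear.has_vector_derivative[OF bounded_linear_Re this]
  have "((\<lambda>r. Re (inverse (of_real t + \<i> * of_real r) ^ Suc 0)) has_real_derivative
      Re (- \<i> * inverse ?z ^ 2)) (at r)"
    by (simp only: has_real_derivative_iff_has_vector_derivative)
  from DERIV_cmult[OF this, of "1 / pi"]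
  show "((\<lambda>r. poisson 0 t r) has_real_derivative poisson_dr t r) (at r)"
    by (simp add: poisson_def poisson_dr_def)
  have "((\<lambda>w. - \<i> * inverse (of_real t + \<i> * w) ^ 2) has_field_derivative
      - 2 * inverse ?z ^ 3) (at (of_real r))"
    unfolding numeral_2_eq_2 numeral_3_eq_3
    by (rule DERIV_cmult[OF DERIV_inverse_power[OF i z, of "Suc 0"], of "- \<i>", THEN DERIV_cong]) simp
  from has_vector_derivative_real_field[OF this, of UNIV]
  have "((\<lambda>r. - \<i> * inverse (of_real t + \<i> * of_real r) ^ 2) has_vector_derivative - 2 * inverse ?z ^ 3) (at r)" .
  from bounded_linear.has_vector_derivative[OF bounded_linear_Re this]
  have "((\<lambda>r. Re (- \<i> * inverse (of_real t + \<i> * of_real r) ^ 2)) has_real_derivative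
      Re (- 2 * inverse ?z ^ 3)) (at r)"
    by (simp only: has_real_derivative_iff_has_vector_derivative)
  note 1 = DERIV_cmult[OF this, of "1 / pi"]
  have "1 / pi * Re (- 2 * w) = - (2 / pi * Re w)" for w by simp
  moreover have "poisson 2 t r = 2 / pi * Re (inverse ?z ^ 3)"
    unfolding poisson_def by (simp only: numeral_3_eq_3 numeral_2_eq_2) (simp del: power_Suc)
  ultimately show "((\<lambda>r. poisson_dr t r) has_real_derivative - poisson 2 t r) (at r)"
    unfolding poisson_dr_def using 1 by metis
qed

lemma cmod_lower_bound:
  assumes "0 < a" "a \<le> t"
  shows "min 1 (a\<^sup>2) * (1 + r\<^sup>2) \<le> (cmod (of_real t + \<i> * of_real r))\<^sup>2"
proof -
  have "min 1 (a\<^sup>2) * 1 \<le> t\<^sup>2" using assms by (simp add: min.coboundedI2 power_mono)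
  moreover have "min 1 (a\<^sup>2) * r\<^sup>2 \<le> 1 * r\<^sup>2" by (intro mult_right_mono) auto
  ultimately show ?thesis by (simp add: cmod_def distrib_left)
qed

lemma poisson_dr_bound:
  assumes "0 < a" "a \<le> t"
  shows "\<bar>poisson_dr t r\<bar> \<le> 1 / pi / min 1 (a\<^sup>2) * inverse (1 + r\<^sup>2)"
proof -
  let ?z = "of_real t + \<i> * of_real r :: complex"
  have m: "0 < min 1 (a\<^sup>2)" using assms by simp
  have "\<bar>poisson_dr t r\<bar> = 1 / pi * \<bar>Re (- \<i> * inverse ?z ^ 2)\<bar>" by (simp add: poisson_dr_def abs_mult)
  also have "\<dots> \<le> 1 / pi * cmod (- \<i> * inverse ?z ^ 2)"
    by (intro mult_left_mono abs_Re_le_cmod) auto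
  also have "\<dots> = 1 / pi * inverse ((cmod ?z)\<^sup>2)" by (simp add: norm_mult norm_power norm_inverse power_inverse)
  also have "\<dots> \<le> 1 / pi * inverse (min 1 (a\<^sup>2) * (1 + r\<^sup>2))"
    using m by (intro mult_left_mono le_imp_inverse_le cmod_lower_bound assms mult_pos_pos) (auto intro: add_pos_nonneg)
  finally show ?thesis by (simp add: divide_inverse mult_ac)
qed

text \<open>For positive \<open>j\<close> the modulus of the complex power decays at least
  quadratically. For \<open>j = 0\<close> the modulus decays like \<open>1 / r\<close> only and is
  not integrable, so the real part is used exactly: its numerator is \<open>t\<close>, which is
  where the upper bound \<open>b\<close> enters.\<close>

lemma poisson_bound:
  assumes "0 < a"
  obtains C where "C \<ge> 0" "\<And>t r. a \<le> t \<Longrightarrow> t \<le> b \<Longrightarrow> \<bar>poisson j t r\<bar> \<le> C * inverse (1 + r\<^sup>2)"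
proof -
  define m where "m = min 1 (a\<^sup>2)"
  have m: "0 < m" using assms by (simp add: m_def)
  define C where "C = (if j = 0 then \<bar>b\<bar> else fact j * inverse a ^ (j - 1)) / pi / m"
  have "\<bar>poisson j t r\<bar> \<le> C * inverse (1 + r\<^sup>2)" if t: "a \<le> t" "t \<le> b" for t r
  proof -
    let ?z = "of_real t + \<i> * of_real r :: complex"
    have z: "m * (1 + r\<^sup>2) \<le> (cmod ?z)\<^sup>2" unfolding m_def by (rule cmod_lower_bound) (use assms t in auto)
    have r: "1 + r\<^sup>2 > 0" by (intro add_pos_nonneg) auto
    have inv: "inverse ((cmod ?z)\<^sup>2) \<le> inverse (m * (1 + r\<^sup>2))"
      using z m r by (intro le_imp_inverse_le) auto
    show ?thesis
    proof (cases j)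
      case 0
      have "\<bar>poisson 0 t r\<bar> = t / pi * inverse ((cmod ?z)\<^sup>2)"
        using assms t by (simp add: poisson_0 cmod_def divide_inverse)
      also have "\<dots> \<le> \<bar>b\<bar> / pi * inverse (m * (1 + r\<^sup>2))"
        using assms t inv by (intro mult_mono divide_right_mono) auto
      finally show ?thesis using 0 by (simp add: C_def divide_inverse mult_ac)
    next
      case (Suc i)
      have az: "a \<le> cmod ?z" using abs_Re_le_cmod[of ?z] assms t by simp
      have "\<bar>poisson j t r\<bar> = fact j / pi * \<bar>Re (inverse ?z ^ Suc j)\<bar>"
        by (simp add: poisson_def abs_mult power_abs)
      also have "\<dots> \<le> fact j / pi * cmod (inverse ?z ^ Suc j)"
        by (intro mult_left_mono abs_Re_le_cmod) auto
      also have "cmod (inverse ?z ^ Suc j) = inverse (cmod ?z) ^ i * inverse ((cmod ?z)\<^sup>2)"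
        by (simp add: norm_mult norm_power norm_inverse power_inverse power2_eq_square Suc mult_ac)
      also have "fact j / pi * (inverse (cmod ?z) ^ i * inverse ((cmod ?z)\<^sup>2)) \<le>
          fact j / pi * (inverse a ^ i * inverse (m * (1 + r\<^sup>2)))"
        using assms az by (intro mult_left_mono mult_mono power_mono inv le_imp_inverse_le[OF az]) auto
      finally show ?thesis using Suc by (simp add: C_def divide_inverse mult_ac)
    qed
  qed
  moreover have "C \<ge> 0" using assms m by (simp add: C_def)
  ultimately show thesis using that by blast
qed

lemma integrable_inverse_square: "integrable lborel (\<lambda>r :: real. inverse (1 + r\<^sup>2))"
  using integrable_inverse_1_plus_square by (simp add: set_integrable_def)

lemma continuous_on_poisson:
  assumes "t > 0" shows "continuous_on UNIV (poisson j t)"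
proof -
  have "of_real t + \<i> * of_real r \<noteq> (0 :: complex)" for r using assms by (auto simp: complex_eq_iff)
  then show ?thesis unfolding poisson_def[abs_def] by (intro continuous_intros) auto
qed

lemma borel_measurable_poisson[measurable]: "poisson j t \<in> borel_measurable borel"
  unfolding poisson_def[abs_def] by measurable

lemma integrable_poisson:
  assumes "t > 0" shows "integrable lborel (poisson j t)"
proof -
  obtain C where C: "\<And>s r. t \<le> s \<Longrightarrow> s \<le> t \<Longrightarrow> \<bar>poisson j s r\<bar> \<le> C * inverse (1 + r\<^sup>2)"
    using poisson_bound[OF assms] by metis
  show ?thesis
    by (rule Bochner_Integration.integrable_bound[OF integrable_mult_right[OF integrable_inverse_square, of C]])
      (use C in \<open>auto intro!: AE_I2 intro: order_trans[OF _ abs_ge_self]\<close>)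
qed

text \<open>Substituting \<open>r = t * x\<close>: a standard Cauchy variable scaled by
  \<open>t\<close> has the Poisson kernel at height \<open>t\<close> as its density.\<close>

lemma cauchy_integral_eq:
  fixes g :: "real \<Rightarrow> real"
  assumes "t > 0"
  shows "(\<integral>x. cauchy_density x * g (t * x) \<partial>lborel) = (\<integral>r. poisson 0 t r * g r \<partial>lborel)"
proof -
  have "t * poisson 0 t (t * x) = cauchy_density x" for x
  proof -
    have "t * poisson 0 t (t * x) = t\<^sup>2 / (pi * (t\<^sup>2 * (1 + x\<^sup>2)))"
      by (simp add: poisson_0 power_mult_distrib distrib_left power2_eq_square)
    then show ?thesis using assms by (simp add: cauchy_density_def)
  qed
  then show ?thesis
    using assms by (subst lborel_integral_real_affine[of t _ 0])
      (auto simp: mult.assoc[symmetric] simp flip: Bochner_Integration.integral_mult_right_zero)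
qed

text \<open>Integrating against a standard normal variable keeps \<open>s = 0\<close> meaningful,
  with value \<open>g r\<close>, whereas \<open>heat_kernel 0\<close> is identically zero.\<close>

definition gauss_avg :: "(real \<Rightarrow> real) \<Rightarrow> real \<Rightarrow> real \<Rightarrow> real" where
  "gauss_avg g s r = (\<integral>z. std_normal_density z * g (r + sqrt s * z) \<partial>lborel)"

lemma integrable_gauss_avg:
  assumes [measurable]: "g \<in> borel_measurable borel" and "\<And>x. \<bar>g x\<bar> \<le> K"
  shows "integrable lborel (\<lambda>z. std_normal_density z * g (r + sqrt s * z))"
  by (rule integrable_mult_bounded[where K=K]) (use assms integrable_normal_density in auto)

lemma gauss_avg_bound:
  assumes "g \<in> borel_measurable borel" "\<And>x. \<bar>g x\<bar> \<le> K"
  shows "\<bar>gauss_avg g s r\<bar> \<le> K"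
proof -
  have "\<bar>gauss_avg g s r\<bar> \<le> (\<integral>z. std_normal_density z * K \<partial>lborel)"
    unfolding gauss_avg_def using assms
    by (intro integral_abs_bound_integral integrable_gauss_avg integrable_mult_left integrable_normal_density)
      (auto simp: abs_mult intro!: mult_left_mono)
  also have "\<dots> = K" by (simp add: integral_normal_density)
  finally show ?thesis .
qed

lemma gauss_avg_eq_heat_int:
  assumes "s > 0"
  shows "gauss_avg g s r = heat_int [] s g r"
proof -
  have "heat_int [] s g r = sqrt s * (\<integral>z. heat_kernel s (r - (r + sqrt s * z)) * g (r + sqrt s * z) \<partial>lborel)"
    unfolding heat_int_def using assms by (subst lborel_integral_real_affine[of "sqrt s" _ r]) auto
  also have "\<dots> = (\<integral>z. sqrt s * (heat_kernel s (r - (r + sqrt s * z)) * g (r + sqrt s * z)) \<partial>lborel)"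
    by simp
  also have "\<dots> = gauss_avg g s r"
    unfolding gauss_avg_def
  proof (rule Bochner_Integration.integral_cong[OF refl])
    fix z
    have "sqrt s * heat_kernel s (r - (r + sqrt s * z)) = std_normal_density z"
      using assms by (simp add: heat_kernel_def std_normal_density_def real_sqrt_mult power2_eq_square[symmetric] power_mult_distrib)
    then show "sqrt s * (heat_kernel s (r - (r + sqrt s * z)) * g (r + sqrt s * z)) =
        std_normal_density z * g (r + sqrt s * z)" by (simp add: mult.assoc[symmetric])
  qed
  finally show ?thesis ..
qed

lemma heat_int_has_real_derivative:
  fixes g :: "real \<Rightarrow> real"
  assumes "s > 0" "l \<in> {[], [1]}" "g \<in> borel_measurable borel" "\<And>z. \<bar>g z\<bar> \<le> K"
  shows "(heat_int l s g has_real_derivative heat_int (1 # l) s g r) (at r)"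
proof -
  have "((\<lambda>h. heat_int l s g (r + h *\<^sub>R 1)) has_real_derivative heat_int (1 # l) s g r) (at 0)"
    by (rule heat_int_has_derivative_line) (use assms in auto)
  then show ?thesis using DERIV_shift[of "heat_int l s g" _ 0 r] by (simp add: add.commute)
qed

lemma heat_int_bounded:
  fixes g :: "real \<Rightarrow> real"
  assumes s: "s0 > 0" "s0 \<le> s" and l: "set l \<subseteq> {1}" and g: "g \<in> borel_measurable borel" "\<And>z. \<bar>g z\<bar> \<le> K"
  shows "\<bar>heat_int l s g r\<bar> \<le> 5 * sqrt 2 * (1 + 1 / s0) * (K + sqrt 2 * K)"
proof -
  have K: "K \<ge> 0" using g(2)[of 0] by linarith
  have "\<bar>heat_int l s g r\<bar> \<le> 5 * sqrt 2 ^ DIM(real) * (1 + 1 / s) * (K + sqrt 2 ^ DIM(real) * exp (- 1\<^sup>2 / (8 * s)) * K)"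
    by (rule heat_int_near_far_bound) (use s l g K in auto)
  also have "\<dots> \<le> 5 * sqrt 2 * (1 + 1 / s0) * (K + sqrt 2 * 1 * K)"
    using s K by (intro mult_mono add_mono divide_left_mono) (auto intro: mult_left_mono)
  finally show ?thesis by simp
qed

text \<open>Green's identity on the line. \<open>A\<close> is the boundary term; in its derivative
  the products of first derivatives cancel, and the second \<open>r\<close>-derivative of the
  Poisson kernel is \<open>- poisson 2 t r\<close>. Since \<open>A\<close> is bounded by a multiple
  of \<open>inverse (1 + r\<^sup>2)\<close>, it vanishes at both ends.\<close>

lemma poisson_heat_integration_by_parts:
  fixes g :: "real \<Rightarrow> real"
  assumes t: "t > 0" and s: "s > 0" and g[measurable]: "g \<in> borel_measurable borel" "\<And>z. \<bar>g z\<bar> \<le> K"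
  shows "(\<integral>r. poisson 0 t r * heat_int [1, 1] s g r \<partial>lborel) = - (\<integral>r. poisson 2 t r * heat_int [] s g r \<partial>lborel)"
proof -
  define C where "C = 5 * sqrt 2 * (1 + 1 / s) * (K + sqrt 2 * K)"
  have C: "\<bar>heat_int l s g r\<bar> \<le> C" if "set l \<subseteq> {1}" for l r
    unfolding C_def by (rule heat_int_bounded) (use s g that in auto)
  have C0: "C \<ge> 0" using C[of "[]" 0] by simp
  define A where "A r = poisson 0 t r * heat_int [1] s g r - poisson_dr t r * heat_int [] s g r" for r
  define A' where "A' r = poisson 0 t r * heat_int [1, 1] s g r + poisson 2 t r * heat_int [] s g r" for r
  have dA: "(A has_real_derivative A' r) (at r)" for r
  proof -
    have d0: "(heat_int [] s g has_real_derivative heat_int [1] s g r) (at r)"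
      and d1: "(heat_int [1] s g has_real_derivative heat_int [1, 1] s g r) (at r)"
      using heat_int_has_real_derivative[OF s _ g, of "[]" r] heat_int_has_real_derivative[OF s _ g, of "[1]" r] by auto
    show ?thesis unfolding A_def[abs_def] A'_def
      by (rule DERIV_diff[OF DERIV_mult[OF poisson_has_space_derivative(1)[OF t] d1]
            DERIV_mult[OF poisson_has_space_derivative(2)[OF t] d0], THEN DERIV_cong])
        (simp add: algebra_simps)
  qed
  have cont: "continuous_on UNIV (heat_int l s g)" if "set l \<subseteq> {1}" for l
  proof -
    have "continuous_on (UNIV \<times> UNIV) (\<lambda>(t :: real, x). heat_int l s g x)"
      by (rule continuous_on_heat_int[where K=K]) (use s g that in auto)
    then have "continuous_on UNIV ((\<lambda>(t :: real, x). heat_int l s g x) \<circ> (\<lambda>x. (0, x)))"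
      by (intro continuous_on_compose continuous_intros) (auto intro: continuous_on_subset)
    then show ?thesis by (simp add: comp_def)
  qed
  have contA': "continuous_on UNIV A'"
    unfolding A'_def[abs_def] by (intro continuous_intros cont continuous_on_poisson t) auto
  have i1: "integrable lborel (\<lambda>r. poisson 0 t r * heat_int [1, 1] s g r)"
    and i2: "integrable lborel (\<lambda>r. poisson 2 t r * heat_int [] s g r)"
    using t C by (auto intro!: integrable_mult_bounded[where K=C] integrable_poisson)
  obtain C' where C': "C' \<ge> 0" "\<And>u r. t \<le> u \<Longrightarrow> u \<le> t \<Longrightarrow> \<bar>poisson 0 u r\<bar> \<le> C' * inverse (1 + r\<^sup>2)"
    using poisson_bound[OF t] by metis
  define M where "M = C' * C + 1 / pi / min 1 (t\<^sup>2) * C"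
  have bA: "norm (A r) \<le> M * inverse (1 + r\<^sup>2)" for r
  proof -
    have "\<bar>poisson 0 t r * heat_int [1] s g r\<bar> \<le> (C' * inverse (1 + r\<^sup>2)) * C"
      unfolding abs_mult using C'(1) by (intro mult_mono C' C) auto
    moreover have "\<bar>poisson_dr t r * heat_int [] s g r\<bar> \<le> (1 / pi / min 1 (t\<^sup>2) * inverse (1 + r\<^sup>2)) * C"
      unfolding abs_mult using t by (intro mult_mono poisson_dr_bound C) auto
    ultimately have "\<bar>A r\<bar> \<le> (C' * inverse (1 + r\<^sup>2)) * C + (1 / pi / min 1 (t\<^sup>2) * inverse (1 + r\<^sup>2)) * C"
      unfolding A_def by linarith
    then show ?thesis by (simp add: M_def algebra_simps)
  qed
  have lim: "(A \<longlongrightarrow> 0) at_top" "(A \<longlongrightarrow> 0) at_bot"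
    by (rule Lim_null_comparison[OF always_eventually[OF allI[OF bA]]], real_asymp)+
  have "(LBINT r=-\<infinity>..\<infinity>. A' r) = 0 - 0"
  proof (rule interval_integral_FTC_integrable)
    show "(A has_vector_derivative A' r) (at r)" for r
      using dA by (simp add: has_real_derivative_iff_has_vector_derivative)
    show "isCont A' r" for r using contA' by (simp add: continuous_on_eq_continuous_at)
    show "set_integrable lborel (einterval (- \<infinity>) \<infinity>) A'"
      using i1 i2 by (simp add: set_integrable_def A'_def)
  qed (use lim in \<open>simp_all add: ereal_tendsto_simps1\<close>)
  then have "(\<integral>r. A' r \<partial>lborel) = 0"
    by (simp add: interval_lebesgue_integral_def set_lebesgue_integral_def)
  then show ?thesis unfolding A'_def by (simp add: i1 i2)
qed

text \<open>\<open>mix j f\<close> is the \<open>j\<close>-th derivative in \<open>t\<close> of \<open>E f (t X + sqrt s Z, y)\<close>.\<close>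

definition mix :: "nat \<Rightarrow> (real \<times> 'a \<Rightarrow> real) \<Rightarrow> real \<Rightarrow> real \<Rightarrow> 'a \<Rightarrow> real" where
  "mix j f t s y = (\<integral>r. poisson j t r * gauss_avg (\<lambda>x. f (x, y)) s r \<partial>lborel)"

context
  fixes f :: "real \<times> 'a::euclidean_space \<Rightarrow> real" and K :: real
  assumes f[measurable]: "f \<in> borel_measurable borel" and f_bound: "\<And>p. \<bar>f p\<bar> \<le> K"
begin

section \<open>Averages of \<open>f\<close> in its first argument against the Gaussian and the
  Poisson kernel\<close>

lemma f_section[measurable]: "(\<lambda>x. f (x, y)) \<in> borel_measurable borel"
proof -
  have "(\<lambda>x. (x, y)) \<in> borel_measurable borel" by (intro borel_measurable_continuous_onI continuous_intros)
  from measurable_compose[OF this f] show ?thesis .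
qed

lemma gauss_avg_measurable[measurable]:
  "(\<lambda>((s, y), r). gauss_avg (\<lambda>x. f (x, y)) s r) \<in> borel_measurable ((borel \<Otimes>\<^sub>M borel) \<Otimes>\<^sub>M borel)"
proof -
  have [measurable]: "f \<in> borel_measurable (borel \<Otimes>\<^sub>M borel)" using f by (simp add: borel_prod)
  have "(\<lambda>(q, z). std_normal_density z * f (snd q + sqrt (fst (fst q)) * z, snd (fst q))) \<in>
     borel_measurable (((borel \<Otimes>\<^sub>M borel) \<Otimes>\<^sub>M borel) \<Otimes>\<^sub>M lborel)"
    by measurable
  from sigma_finite_measure.borel_measurable_lebesgue_integral[OF sigma_finite_lborel this]
  show ?thesis
    unfolding gauss_avg_def split_def .
qed

lemma gauss_avg_measurable_r[measurable]: "gauss_avg (\<lambda>x. f (x, y)) s \<in> borel_measurable borel"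
  using measurable_compose[OF _ gauss_avg_measurable, of "\<lambda>r. ((s, y), r)" borel] by simp

lemma mix_measurable[measurable]: "(\<lambda>(s, y). mix j f t s y) \<in> borel_measurable (borel \<Otimes>\<^sub>M borel)"
proof -
  have "(\<lambda>((s, y), r). poisson j t r * gauss_avg (\<lambda>x. f (x, y)) s r) \<in> borel_measurable ((borel \<Otimes>\<^sub>M borel) \<Otimes>\<^sub>M lborel)"
    using gauss_avg_measurable by (simp add: split_def) 
  then show ?thesis unfolding mix_def split_def
    by (intro sigma_finite_measure.borel_measurable_lebesgue_integral[OF sigma_finite_lborel]) (simp add: split_def)
qed

lemma gauss_avg_f_bound: "\<bar>gauss_avg (\<lambda>x. f (x, y)) s r\<bar> \<le> K"
  by (rule gauss_avg_bound) (auto intro: f_bound)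

lemma integrable_mix:
  assumes "t > 0"
  shows "integrable lborel (\<lambda>r. poisson j t r * gauss_avg (\<lambda>x. f (x, y)) s r)"
  using assms gauss_avg_f_bound by (intro integrable_mult_bounded[where K=K] integrable_poisson) auto

lemma mix_bound:
  assumes "a > 0"
  obtains C where "\<And>t s y. a \<le> t \<Longrightarrow> t \<le> b \<Longrightarrow> \<bar>mix j f t s y\<bar> \<le> C"
proof -
  obtain C where C: "C \<ge> 0" "\<And>t r. a \<le> t \<Longrightarrow> t \<le> b \<Longrightarrow> \<bar>poisson j t r\<bar> \<le> C * inverse (1 + r\<^sup>2)"
    using poisson_bound[OF assms] by metis
  have "\<bar>mix j f t s y\<bar> \<le> (\<integral>r. C * inverse (1 + r\<^sup>2) * K \<partial>lborel)" if t: "a \<le> t" "t \<le> b" for t s y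
    unfolding mix_def
  proof (intro integral_abs_bound_integral integrable_mix integrable_mult_left integrable_mult_right integrable_inverse_square)
    show "\<bar>poisson j t r * gauss_avg (\<lambda>x. f (x, y)) s r\<bar> \<le> C * inverse (1 + r\<^sup>2) * K" for r
      unfolding abs_mult using C(1) t by (intro mult_mono C(2) gauss_avg_f_bound) auto
  qed (use assms t in auto)
  then show thesis by (rule that)
qed

lemma mix_has_time_derivative:
  assumes t: "t > 0"
  shows "((\<lambda>t. mix j f t s y) has_real_derivative mix (Suc j) f t s y) (at t)"
proof -
  have t2: "t / 2 > 0" using t by simp
  obtain C where C: "C \<ge> 0" "\<And>u r. t / 2 \<le> u \<Longrightarrow> u \<le> t + 1 \<Longrightarrow> \<bar>poisson (Suc j) u r\<bar> \<le> C * inverse (1 + r\<^sup>2)"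
    using poisson_bound[OF t2] by metis
  show ?thesis unfolding mix_def
  proof (rule has_real_derivative_lebesgue_integral[where a="t / 2" and b="t + 1" and w="\<lambda>r. C * inverse (1 + r\<^sup>2) * K"])
    fix u r :: real assume u: "t / 2 < u" "u < t + 1"
    then have u0: "u > 0" using t by simp
    show "integrable lborel (\<lambda>r. poisson j u r * gauss_avg (\<lambda>x. f (x, y)) s r)" by (rule integrable_mix[OF u0])
    show "((\<lambda>h. poisson j h r * gauss_avg (\<lambda>x. f (x, y)) s r) has_real_derivative
        poisson (Suc j) u r * gauss_avg (\<lambda>x. f (x, y)) s r) (at u)"
      by (rule DERIV_cmult_right[OF poisson_has_time_derivative[OF u0]])
    show "\<bar>poisson (Suc j) u r * gauss_avg (\<lambda>x. f (x, y)) s r\<bar> \<le> C * inverse (1 + r\<^sup>2) * K"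
      unfolding abs_mult using C(1) u by (intro mult_mono C(2) gauss_avg_f_bound) auto
  qed (use t in \<open>auto intro!: integrable_mult_left integrable_mult_right integrable_inverse_square\<close>)
qed

text \<open>The heat equation turns the \<open>s\<close>-derivative into half a second derivative of
  the Gaussian average. Integration by parts moves it onto the Poisson kernel, where harmonicity
  makes it minus a second \<open>t\<close>-derivative.\<close>

lemma mix_has_heat_derivative:
  assumes t: "t > 0" and s: "s > 0"
  shows "((\<lambda>s. mix 0 f t s y) has_real_derivative - mix 2 f t s y / 2) (at s)"
proof -
  define g where "g x = f (x, y)" for x
  have g[measurable]: "g \<in> borel_measurable borel" "\<bar>g z\<bar> \<le> K" for z
    unfolding g_def by (auto intro: f_bound)
  define C where "C = 5 * sqrt 2 * (1 + 1 / (s / 2)) * (K + sqrt 2 * K)"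
  have C: "\<bar>heat_int [1, 1] h g r\<bar> \<le> C" if "s / 2 < h" for h r
    unfolding C_def by (rule heat_int_bounded) (use s g that in auto)
  have "((\<lambda>s. \<integral>r. poisson 0 t r * gauss_avg g s r \<partial>lborel) has_real_derivative
      (\<integral>r. poisson 0 t r * (heat_int [1, 1] s g r / 2) \<partial>lborel)) (at s)"
  proof (rule has_real_derivative_lebesgue_integral[where a="s / 2" and b="s + 1" and w="\<lambda>r. \<bar>poisson 0 t r\<bar> * C"])
    fix h r :: real assume h: "s / 2 < h" "h < s + 1"
    then have h0: "h > 0" using s by simp
    show "integrable lborel (\<lambda>r. poisson 0 t r * gauss_avg g h r)"
      unfolding g_def by (rule integrable_mix[OF t])
    have "((\<lambda>h. heat_int [] h g r) has_real_derivative
      (\<Sum>b\<in>Basis. heat_int [b, b] h g r) / 2 + heat_int [] h (\<lambda>_. 0) r) (at h)"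
      by (rule heat_int_time_derivative[where K=K and K'=0]) (use h0 g in auto)
    then have "((\<lambda>h. heat_int [] h g r) has_real_derivative heat_int [1, 1] h g r / 2) (at h)"
      by (simp add: heat_int_def)
    then have "((\<lambda>h. gauss_avg g h r) has_real_derivative heat_int [1, 1] h g r / 2) (at h)"
      by (rule has_field_derivative_transform_within_open[of _ _ _ "{0<..}"])
        (use h0 in \<open>auto simp: gauss_avg_eq_heat_int\<close>)
    then show "((\<lambda>h. poisson 0 t r * gauss_avg g h r) has_real_derivative
        poisson 0 t r * (heat_int [1, 1] h g r / 2)) (at h)"
      by (rule DERIV_cmult)
    show "\<bar>poisson 0 t r * (heat_int [1, 1] h g r / 2)\<bar> \<le> \<bar>poisson 0 t r\<bar> * C"
      unfolding abs_mult using C[OF h(1), of r] by (intro mult_left_mono) auto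
  qed (use s t in \<open>auto intro!: integrable_mult_left integrable_abs integrable_poisson\<close>)
  also have "(\<integral>r. poisson 0 t r * (heat_int [1, 1] s g r / 2) \<partial>lborel) =
     (\<integral>r. poisson 0 t r * heat_int [1, 1] s g r \<partial>lborel) / 2"
    by simp
  also have "\<dots> = - (\<integral>r. poisson 2 t r * heat_int [] s g r \<partial>lborel) / 2"
    by (simp add: poisson_heat_integration_by_parts[OF t s g])
  finally show ?thesis
    by (simp add: mix_def gauss_avg_eq_heat_int[OF s] flip: g_def)
qed

end

section \<open>Hitting functionals of sampled paths\<close>

text \<open>Paths are recorded at rational times only, so that the path space has countably many
  coordinates and the hitting functionals are measurable; the absolute value turns every rational
  into a time. On sampled continuous paths \<open>hit_time\<close> is the hitting time, with value \<open>\<infinity>\<close> if there is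
  none.\<close>

definition rat_time :: "rat \<Rightarrow> real" where
  "rat_time q = \<bar>real_of_rat q\<bar>"

definition sample :: "(real \<Rightarrow> 'a) \<Rightarrow> rat \<Rightarrow> 'a" where
  "sample b q = b (rat_time q)"

abbreviation paths :: "(rat \<Rightarrow> 'a::euclidean_space) measure" where
  "paths \<equiv> Pi\<^sub>M UNIV (\<lambda>_. borel)"

definition hit_time :: "'a::euclidean_space set \<Rightarrow> (rat \<Rightarrow> 'a) \<Rightarrow> ereal" where
  "hit_time A w = (SUP k::nat. INF q::rat.
     if infdist (w q) A < 1 / real (Suc k) then ereal (rat_time q) else \<infinity>)"

text \<open>The hitting time may be irrational, so the position is read off at the dyadic times just
  above it. At each level only countably many times can occur, which gives measurability; continuity
  of the path identifies the limit.\<close>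

definition hit_pos :: "'a::euclidean_space set \<Rightarrow> (rat \<Rightarrow> 'a) \<Rightarrow> 'a" where
  "hit_pos A w = lim (\<lambda>m. w (of_int \<lceil>real_of_ereal (hit_time A w) * 2 ^ m\<rceil> / 2 ^ m))"

text \<open>The value 0 on paths that miss \<open>A\<close> matches the indicator in the set
  integral that prescribes \<open>u\<close>.\<close>

definition hit_val :: "(real \<Rightarrow> 'a \<Rightarrow> real) \<Rightarrow> 'a::euclidean_space set \<Rightarrow> (rat \<Rightarrow> 'a) \<Rightarrow> real" where
  "hit_val \<phi> A w = (if hit_time A w < \<infinity> then \<phi> (real_of_ereal (hit_time A w)) (hit_pos A w) else 0)"

lemma measurable_path_component[measurable]: "(\<lambda>w. w q) \<in> measurable paths borel"
  using measurable_component_singleton[of q UNIV "\<lambda>_. borel"] by simp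

lemma measurable_hit_time[measurable]: "hit_time A \<in> borel_measurable paths"
proof -
  have [measurable]: "(\<lambda>w :: rat \<Rightarrow> 'a. infdist (w q) A) \<in> borel_measurable paths" for q
    by (rule measurable_compose[OF measurable_path_component borel_measurable_continuous_onI])
      (intro continuous_intros)
  have "(\<lambda>w. if infdist (w q) A < 1 / real (Suc k) then ereal (rat_time q) else \<infinity>) \<in> borel_measurable paths" for q k
    by measurable
  then show ?thesis unfolding hit_time_def[abs_def]
    by (intro borel_measurable_SUP borel_measurable_INF) auto
qed

lemma measurable_hit_pos[measurable]: "hit_pos A \<in> measurable paths borel"
  unfolding hit_pos_def[abs_def]
proof (rule borel_measurable_lim_metric)
  fix m :: nat
  show "(\<lambda>w. w (of_int \<lceil>real_of_ereal (hit_time A w) * 2 ^ m\<rceil> / 2 ^ m)) \<in> borel_measurable paths"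
    by (rule measurable_compose_countable[where f="\<lambda>i w. w (of_int i / 2 ^ m)"]) measurable
qed

lemma measurable_hit_val[measurable]:
  assumes [measurable]: "(\<lambda>(\<theta>, y). \<phi> \<theta> y) \<in> borel_measurable (borel \<Otimes>\<^sub>M borel)"
  shows "hit_val \<phi> A \<in> borel_measurable paths"
  unfolding hit_val_def[abs_def] by measurable

section \<open>Hitting functionals of continuous paths\<close>

lemma rat_time_nonneg: "rat_time q \<ge> 0"
  by (simp add: rat_time_def)

lemma hit_time_nonneg: "hit_time A w \<ge> 0"
proof -
  have "0 \<le> (INF q. if infdist (w q) A < 1 / real (Suc 0) then ereal (rat_time q) else \<infinity>)"
    by (rule INF_greatest) (simp add: rat_time_nonneg)
  then show ?thesis unfolding hit_time_def by (rule SUP_upper2[OF UNIV_I])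
qed

text \<open>At \<open>t\<close> the path lies in every neighbourhood of \<open>A\<close>. By
  continuity it is still in a given one at rational times just after \<open>t\<close>, so each
  infimum is at most \<open>t\<close>.\<close>

lemma hit_time_le:
  assumes cont: "continuous_on {0..} b" and t: "0 \<le> t" "b t \<in> A"
  shows "hit_time A (sample b) \<le> ereal t"
  unfolding hit_time_def
proof (rule SUP_least, rule ereal_le_epsilon2)
  fix k :: nat and e :: real assume e: "e > 0"
  have "continuous_on {0..} (\<lambda>t. infdist (b t) A)" by (intro continuous_intros cont)
  then have "((\<lambda>t. infdist (b t) A) \<longlongrightarrow> infdist (b t) A) (at t within {0..})"
    using t unfolding continuous_on_def by blast
  moreover have "infdist (b t) A < 1 / real (Suc k)" using t by simp
  ultimately have "\<forall>\<^sub>F u in at t within {0..}. infdist (b u) A < 1 / real (Suc k)"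
    by (rule order_tendstoD(2))
  then obtain d where d: "d > 0" "\<And>u. 0 \<le> u \<Longrightarrow> u \<noteq> t \<Longrightarrow> dist u t < d \<Longrightarrow> infdist (b u) A < 1 / real (Suc k)"
    by (auto simp: eventually_at)
  obtain q where q: "t < of_rat q" "of_rat q < t + min d e"
    using of_rat_dense[of t "t + min d e"] d e by auto
  have rq: "rat_time q = of_rat q" using q t unfolding rat_time_def by (intro abs_of_nonneg) linarith
  have "infdist (sample b q) A < 1 / real (Suc k)"
    unfolding sample_def rq
  proof (rule d)
    show "0 \<le> real_of_rat q" using q(1) t(1) by linarith
    show "real_of_rat q \<noteq> t" using q(1) by (rule less_imp_neq[symmetric])
    show "dist (real_of_rat q) t < d" using q unfolding dist_real_def by linarith
  qed
  then have "(INF q. if infdist (sample b q) A < 1 / real (Suc k) then ereal (rat_time q) else \<infinity>) \<le> ereal (rat_time q)"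
    by (intro INF_lower2[of q]) auto
  also have "\<dots> \<le> ereal t + ereal e" using q rq by simp
  finally show "(INF q. if infdist (sample b q) A < 1 / real (Suc k) then ereal (rat_time q) else \<infinity>) \<le> ereal t + ereal e" .
qed

text \<open>For every \<open>k\<close> there is a sampled time before \<open>T + 1 / (k + 1)\<close>
  at which the path is within \<open>1 / (k + 1)\<close> of \<open>A\<close>. By compactness these
  times accumulate at a time up to \<open>T\<close> where the distance is 0, and \<open>A\<close> is
  closed.\<close>

lemma hit_time_attained:
  fixes b :: "real \<Rightarrow> 'a::euclidean_space"
  assumes cont: "continuous_on {0..} b" and A: "closed A" "A \<noteq> {}" and T: "hit_time A (sample b) \<le> ereal T"
  shows "\<exists>s. 0 \<le> s \<and> s \<le> T \<and> b s \<in> A"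
proof -
  have "\<exists>q. rat_time q < T + 1 / real (Suc k) \<and> infdist (sample b q) A < 1 / real (Suc k)" for k
  proof -
    have "(INF q. if infdist (sample b q) A < 1 / real (Suc k) then ereal (rat_time q) else \<infinity>) \<le> hit_time A (sample b)"
      unfolding hit_time_def by (rule SUP_upper) simp
    also have "\<dots> < ereal (T + 1 / real (Suc k))" using T by (rule le_less_trans) simp
    finally obtain q where "(if infdist (sample b q) A < 1 / real (Suc k) then ereal (rat_time q) else \<infinity>) <
        ereal (T + 1 / real (Suc k))" unfolding INF_less_iff by blast
    then show ?thesis by (intro exI[of _ q]) (simp split: if_splits)
  qed
  then obtain q where q: "\<And>k. rat_time (q k) < T + 1 / real (Suc k)"
    "\<And>k. infdist (sample b (q k)) A < 1 / real (Suc k)" by metis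
  define r where "r k = rat_time (q k)" for k
  have r: "r k \<in> {0..T + 1}" for k
  proof -
    have "1 / real (Suc k) \<le> 1" by simp
    then have "r k \<le> T + 1" using q(1)[of k] unfolding r_def by linarith
    then show ?thesis using rat_time_nonneg[of "q k"] unfolding r_def by simp
  qed
  obtain s \<sigma> where s: "strict_mono \<sigma>" "(r \<circ> \<sigma>) \<longlonglongrightarrow> s" "s \<in> {0..T + 1}"
    using compact_Icc[of 0 "T + 1"] r unfolding compact_def by metis
  have inv: "(\<lambda>k. 1 / real (Suc (\<sigma> k))) \<longlonglongrightarrow> 0"
    using LIMSEQ_subseq_LIMSEQ[OF LIMSEQ_inverse_real_of_nat s(1)] by (simp add: comp_def inverse_eq_divide)
  have sT: "s \<le> T + 0"
    by (rule LIMSEQ_le[OF s(2) tendsto_add[OF tendsto_const inv]]) (use q(1) in \<open>auto simp: r_def intro: less_imp_le\<close>)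
  have "(\<lambda>k. infdist (b ((r \<circ> \<sigma>) k)) A) \<longlonglongrightarrow> infdist (b s) A"
  proof (rule continuous_on_tendsto_compose[where s="{0..}" and f="\<lambda>t. infdist (b t) A"])
    show "continuous_on {0..} (\<lambda>t. infdist (b t) A)" by (intro continuous_intros cont)
  qed (use s r in \<open>auto simp: comp_def intro!: always_eventually\<close>)
  moreover have "(\<lambda>k. infdist (b ((r \<circ> \<sigma>) k)) A) \<longlonglongrightarrow> 0"
  proof (rule Lim_null_comparison[OF _ inv], rule always_eventually, rule allI)
    show "norm (infdist (b ((r \<circ> \<sigma>) k)) A) \<le> 1 / real (Suc (\<sigma> k))" for k
      using q(2)[of "\<sigma> k"] by (simp add: r_def sample_def infdist_nonneg)
  qed
  ultimately have "infdist (b s) A = 0" by (rule LIMSEQ_unique)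
  then have "b s \<in> A" using A by (simp add: in_closed_iff_infdist_zero)
  then show ?thesis using s(3) sT by auto
qed

lemma hit_time_sample:
  fixes b :: "real \<Rightarrow> 'a::euclidean_space"
  assumes cont: "continuous_on {0..} b" and A: "closed A" "A \<noteq> {}" and hits: "\<exists>t\<ge>0. b t \<in> A"
  defines "\<tau> \<equiv> LEAST t. 0 \<le> t \<and> b t \<in> A"
  shows "hit_time A (sample b) = ereal \<tau>" "0 \<le> \<tau>" "b \<tau> \<in> A" "\<And>t. 0 \<le> t \<Longrightarrow> b t \<in> A \<Longrightarrow> \<tau> \<le> t"
proof -
  obtain t where "0 \<le> t" "b t \<in> A" using hits by blast
  from hit_time_le[OF cont this] hit_time_nonneg[of A "sample b"]
  obtain h where h: "hit_time A (sample b) = ereal h"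
    by (cases "hit_time A (sample b)") auto
  obtain s where s: "0 \<le> s" "s \<le> h" "b s \<in> A"
    using hit_time_attained[OF cont A, of h] h by auto
  have least: "h \<le> t" if "0 \<le> t" "b t \<in> A" for t
    using hit_time_le[OF cont that] h by simp
  then have "s = h" using s by (intro antisym) auto
  then have "\<tau> = h" unfolding \<tau>_def using s least by (intro Least_equality) auto
  then show "hit_time A (sample b) = ereal \<tau>" "0 \<le> \<tau>" "b \<tau> \<in> A" "\<And>t. 0 \<le> t \<Longrightarrow> b t \<in> A \<Longrightarrow> \<tau> \<le> t"
    using h s \<open>s = h\<close> least by auto
qed

lemma hit_pos_sample:
  fixes b :: "real \<Rightarrow> 'a::euclidean_space"
  assumes cont: "continuous_on {0..} b" and \<tau>: "hit_time A (sample b) = ereal \<tau>" "0 \<le> \<tau>"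
  shows "hit_pos A (sample b) = b \<tau>"
  unfolding hit_pos_def \<tau>(1) real_of_ereal.simps
proof (rule limI)
  define r where "r m = of_int \<lceil>\<tau> * 2 ^ m\<rceil> / (2 :: real) ^ m" for m
  have r0: "r m \<ge> \<tau>" "r m \<le> \<tau> + (1/2) ^ m" for m
  proof -
    have "\<tau> * 2 ^ m \<le> of_int \<lceil>\<tau> * 2 ^ m\<rceil>" "of_int \<lceil>\<tau> * 2 ^ m\<rceil> \<le> \<tau> * 2 ^ m + 1" by linarith+
    then have 1: "\<tau> * 2 ^ m / 2 ^ m \<le> r m" "r m \<le> (\<tau> * 2 ^ m + 1) / 2 ^ m"
      unfolding r_def by (intro divide_right_mono; simp)+
    have 2: "\<tau> * 2 ^ m / 2 ^ m = \<tau>" by simp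
    have 3: "(\<tau> * 2 ^ m + 1) / 2 ^ m = \<tau> + (1/2) ^ m"
      by (simp only: add_divide_distrib power_one_over[symmetric]) simp
    show "r m \<ge> \<tau>" "r m \<le> \<tau> + (1/2) ^ m"
      using 1 unfolding 2 3 by blast+
  qed
  have "(\<lambda>m. \<tau> + (1/2 :: real) ^ m) \<longlonglongrightarrow> \<tau> + 0" by (intro tendsto_intros LIMSEQ_realpow_zero) auto
  then have "r \<longlonglongrightarrow> \<tau>" unfolding add_0_right
    by (rule tendsto_sandwich[OF always_eventually[OF allI[OF r0(1)]] always_eventually[OF allI[OF r0(2)]] tendsto_const])
  then have "(\<lambda>m. b (r m)) \<longlonglongrightarrow> b \<tau>"
    using \<tau> r0(1) by (intro continuous_on_tendsto_compose[OF cont])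
      (auto intro!: always_eventually intro: order_trans)
  moreover have "rat_time (of_int \<lceil>\<tau> * 2 ^ m\<rceil> / 2 ^ m) = r m" for m
  proof -
    have "0 \<le> \<tau> * 2 ^ m" using \<tau> by simp
    then have "0 \<le> real_of_int \<lceil>\<tau> * 2 ^ m\<rceil>" using le_of_int_ceiling by (rule order_trans)
    then show ?thesis by (simp add: rat_time_def r_def of_rat_divide of_rat_power)
  qed
  ultimately show "(\<lambda>m. sample b (of_int \<lceil>\<tau> * 2 ^ m\<rceil> / 2 ^ m)) \<longlonglongrightarrow> b \<tau>"
    by (simp add: sample_def)
qed

lemma hit_val_sample:
  fixes b :: "real \<Rightarrow> 'a::euclidean_space"
  assumes cont: "continuous_on {0..} b" and A: "closed A" "A \<noteq> {}"
  defines "\<tau> \<equiv> LEAST t. 0 \<le> t \<and> b t \<in> A"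
  shows "hit_val \<phi> A (sample b) = (if \<exists>t\<ge>0. b t \<in> A then \<phi> \<tau> (b \<tau>) else 0)"
proof (cases "\<exists>t\<ge>0. b t \<in> A")
  case True
  note h = hit_time_sample[OF cont A True, folded \<tau>_def]
  show ?thesis using True h(1) hit_pos_sample[OF cont h(1,2)] by (simp add: hit_val_def)
next
  case False
  have "\<not> hit_time A (sample b) < \<infinity>"
  proof
    assume "hit_time A (sample b) < \<infinity>"
    then obtain T where "hit_time A (sample b) \<le> ereal T"
      using hit_time_nonneg[of A "sample b"] by (cases "hit_time A (sample b)") auto
    from hit_time_attained[OF cont A this] False show False by auto
  qed
  then show ?thesis using False by (auto simp: hit_val_def)
qed

text \<open>The pathwise form of the Markov property: restarting at \<open>r\<close> before any hit
  lowers the hitting time by exactly \<open>r\<close> and keeps the hitting position, so adding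
  \<open>r\<close> to the time argument restores the value.\<close>

lemma hit_val_shift:
  fixes b :: "real \<Rightarrow> 'a::euclidean_space"
  assumes cont: "continuous_on {0..} b" and A: "closed A" "A \<noteq> {}" and r: "r \<ge> 0"
    and avoid: "\<And>t. 0 \<le> t \<Longrightarrow> t \<le> r \<Longrightarrow> b t \<notin> A"
  shows "hit_val (\<lambda>\<theta>. \<phi> (r + \<theta>)) A (sample (\<lambda>t. b (r + t))) = hit_val \<phi> A (sample b)"
proof -
  have cont': "continuous_on {0..} (\<lambda>t. b (r + t))"
    using r by (intro continuous_on_compose2[OF cont] continuous_intros) auto
  have iff: "(\<exists>t\<ge>0. b (r + t) \<in> A) \<longleftrightarrow> (\<exists>t\<ge>0. b t \<in> A)"
  proof
    assume "\<exists>t\<ge>0. b t \<in> A"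
    then obtain t where "t \<ge> 0" "b t \<in> A" by blast
    moreover from this have "t > r" using avoid[of t] by force
    ultimately show "\<exists>t\<ge>0. b (r + t) \<in> A" by (intro exI[of _ "t - r"]) auto
  next
    assume "\<exists>t\<ge>0. b (r + t) \<in> A"
    then obtain t where "t \<ge> 0" "b (r + t) \<in> A" by blast
    then show "\<exists>t\<ge>0. b t \<in> A" using r by (intro exI[of _ "r + t"]) auto
  qed
  show ?thesis
  proof (cases "\<exists>t\<ge>0. b t \<in> A")
    case True
    define \<tau> where "\<tau> = (LEAST t. 0 \<le> t \<and> b t \<in> A)"
    note h = hit_time_sample[OF cont A True, folded \<tau>_def]
    have "r \<le> \<tau>" using avoid[of \<tau>] h by force
    have "(LEAST t. 0 \<le> t \<and> b (r + t) \<in> A) = \<tau> - r"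
    proof (rule Least_equality)
      fix t assume t: "0 \<le> t \<and> b (r + t) \<in> A"
      then show "\<tau> - r \<le> t" using h(4)[of "r + t"] r by simp
    qed (use h \<open>r \<le> \<tau>\<close> in auto)
    then show ?thesis
      unfolding hit_val_sample[OF cont A] hit_val_sample[OF cont' A] iff using True by (simp add: \<tau>_def)
  next
    case False
    then show ?thesis
      unfolding hit_val_sample[OF cont A] hit_val_sample[OF cont' A] iff by (simp only: if_False)
  qed
qed

lemma hit_val_bound:
  assumes "\<And>\<theta> y. 0 \<le> \<theta> \<Longrightarrow> \<bar>\<phi> \<theta> y\<bar> \<le> K"
  shows "\<bar>hit_val \<phi> A w\<bar> \<le> K"
proof -
  have "0 \<le> real_of_ereal (hit_time A w)" using hit_time_nonneg by (rule real_of_ereal_pos)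
  moreover have "K \<ge> 0" using assms[of 0 undefined] by linarith
  ultimately show ?thesis using assms by (simp add: hit_val_def)
qed

text \<open>An odd grid point of one level is a single step away from an even one, which already
  belongs to the coarser grid. So every grid point is reached from 0 with at most one step per
  level, and continuity passes from the grid to all times.\<close>

lemma dyadic_chaining:
  fixes b :: "real \<Rightarrow> 'a::metric_space" and a :: "nat \<Rightarrow> real"
  assumes r: "r > 0" and cont: "continuous_on {0..r} b"
    and a: "\<And>n. a n \<ge> 0" "\<And>n. (\<Sum>m\<le>n. a m) \<le> S"
    and inc: "\<And>n k. k < 2 ^ n \<Longrightarrow> dist (b (real (Suc k) * r / 2 ^ n)) (b (real k * r / 2 ^ n)) \<le> a n"
    and q: "0 \<le> q" "q \<le> r"
  shows "dist (b q) (b 0) \<le> S"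
proof -
  have grid: "dist (b (real k * r / 2 ^ n)) (b 0) \<le> (\<Sum>m\<le>n. a m)" if "k \<le> 2 ^ n" for n k
    using that
  proof (induction n arbitrary: k)
    case 0
    then have "k = 0 \<or> k = 1" by auto
    then show ?case using inc[of 0 0] a(1)[of 0] by auto
  next
    case (Suc n)
    have even: "dist (b (real (2 * i) * r / 2 ^ Suc n)) (b 0) \<le> (\<Sum>m\<le>n. a m)" if "i \<le> 2 ^ n" for i
      using Suc.IH[OF that] by simp
    show ?case
    proof (cases "even k")
      case True
      then obtain i where "k = 2 * i" by blast
      then show ?thesis using even[of i] Suc.prems a(1)[of "Suc n"] by simp
    next
      case False
      then obtain i where i: "k = Suc (2 * i)" by (metis oddE Suc_eq_plus1)
      then have i2: "2 * i < 2 ^ Suc n" using Suc.prems by simp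
      have "dist (b (real k * r / 2 ^ Suc n)) (b 0) \<le>
         dist (b (real (Suc (2 * i)) * r / 2 ^ Suc n)) (b (real (2 * i) * r / 2 ^ Suc n)) + dist (b (real (2 * i) * r / 2 ^ Suc n)) (b 0)"
        unfolding i by (rule dist_triangle)
      also have "\<dots> \<le> a (Suc n) + (\<Sum>m\<le>n. a m)"
        using i2 by (intro add_mono inc even) auto
      finally show ?thesis by simp
    qed
  qed
  \<comment> \<open>The dyadic point of level \<open>n\<close> just below \<open>q\<close>, in units
    of \<open>r\<close>.\<close>
  define t where "t n = real (nat \<lfloor>q / r * 2 ^ n\<rfloor>) * r / 2 ^ n" for n
  have nat: "real (nat \<lfloor>q / r * 2 ^ n\<rfloor>) = of_int \<lfloor>q / r * 2 ^ n\<rfloor>" for n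
    using q r by simp
  have t: "t n \<le> q" "q - r * (1/2) ^ n \<le> t n" for n
  proof -
    have "of_int \<lfloor>q / r * 2 ^ n\<rfloor> \<le> q / r * 2 ^ n" "q / r * 2 ^ n - 1 \<le> of_int \<lfloor>q / r * 2 ^ n\<rfloor>"
      by linarith+
    then have 1: "t n \<le> q / r * 2 ^ n * r / 2 ^ n" "(q / r * 2 ^ n - 1) * r / 2 ^ n \<le> t n"
      unfolding t_def nat using r by (intro divide_right_mono mult_right_mono; simp)+
    have 2: "q / r * 2 ^ n * r / 2 ^ n = q" using r by simp
    have 3: "(q / r * 2 ^ n - 1) * r / 2 ^ n = q / r * 2 ^ n * r / 2 ^ n - r * (1/2) ^ n"
      by (simp only: left_diff_distrib diff_divide_distrib) (simp add: power_divide)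
    show "t n \<le> q" "q - r * (1/2) ^ n \<le> t n"
      using 1 unfolding 3 2 by blast+
  qed
  have kn: "nat \<lfloor>q / r * 2 ^ n\<rfloor> \<le> 2 ^ n" for n
  proof -
    have "q / r \<le> 1" using q r by simp
    then have "q / r * 2 ^ n \<le> 1 * 2 ^ n" by (intro mult_right_mono) auto
    then have "\<lfloor>q / r * 2 ^ n\<rfloor> \<le> 2 ^ n" by (simp add: floor_le_iff)
    then show ?thesis by (simp add: nat_le_iff)
  qed
  have "(\<lambda>n. q - r * (1/2 :: real) ^ n) \<longlonglongrightarrow> q - r * 0"
    by (intro tendsto_intros LIMSEQ_realpow_zero) auto
  then have "t \<longlonglongrightarrow> q" unfolding mult_zero_right diff_0_right
    by (rule tendsto_sandwich[OF always_eventually[OF allI[OF t(2)]] always_eventually[OF allI[OF t(1)]] _ tendsto_const])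
  moreover have "t n \<in> {0..r}" for n using t(1)[of n] q r by (auto simp: t_def)
  ultimately have "(\<lambda>n. b (t n)) \<longlonglongrightarrow> b q"
    using q by (intro continuous_on_tendsto_compose[OF cont]) (auto intro!: always_eventually)
  then have "(\<lambda>n. dist (b (t n)) (b 0)) \<longlonglongrightarrow> dist (b q) (b 0)" by (intro tendsto_intros)
  moreover have "dist (b (t n)) (b 0) \<le> S" for n
    using order_trans[OF grid[OF kn] a(2)] unfolding t_def .
  ultimately show ?thesis by (intro LIMSEQ_le_const2) auto
qed

section \<open>Brownian motion\<close>

lemma prod_normal_density_eq_heat_kernel:
  fixes y :: "real ^ 'd"
  assumes "s > 0"
  shows "(\<Prod>i\<in>UNIV. normal_density 0 (sqrt s) (y $ i)) = heat_kernel s y"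
proof -
  have n: "normal_density 0 (sqrt s) x = 1 / sqrt (2 * pi * s) * exp (- x\<^sup>2 / (2 * s))" for x
    using assms by (simp add: normal_density_def)
  show ?thesis
    unfolding n prod.distrib heat_kernel_def
    by (simp add: exp_sum[symmetric] inner_vec_def sum_negf sum_divide_distrib power2_eq_square)
qed

lemma time_grid:
  assumes "finite J"
  obtains n :: nat and T :: "nat \<Rightarrow> real" and k :: "rat \<Rightarrow> nat"
  where "n \<ge> 1" "T 0 = 0" "\<And>i. i < n \<Longrightarrow> T i < T (Suc i)" "\<And>q. q \<in> J \<Longrightarrow> k q \<le> n \<and> T (k q) = rat_time q"
proof -
  \<comment> \<open>The point 0 anchors the telescoping sums. The point 1 forces at least one
    increment even if all sampled times are 0 or \<open>J\<close> is empty, because the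
    characterisation of independence by a product law is applied to a nonempty index set.\<close>
  define X where "X = insert 0 (insert 1 (rat_time ` J))"
  have X: "finite X" "0 \<in> X" "1 \<in> X" using assms by (auto simp: X_def)
  define L where "L = sorted_list_of_set X"
  have L: "set L = X" "sorted_wrt (<) L"
    using X unfolding L_def by (auto simp: strict_sorted_iff)
  have "card {0, 1 :: real} \<le> card X" using X by (intro card_mono) auto
  then have len: "length L \<ge> 2" using X by (simp add: L_def)
  have nonneg: "x \<ge> 0" if "x \<in> X" for x using that rat_time_nonneg by (auto simp: X_def)
  define k where "k q = (SOME i. i < length L \<and> L ! i = rat_time q)" for q
  have k: "k q < length L \<and> L ! k q = rat_time q" if "q \<in> J" for q
  proof -
    have "rat_time q \<in> set L" using that L by (simp add: X_def)
    then obtain i where "i < length L \<and> L ! i = rat_time q" by (auto simp: in_set_conv_nth)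
    then show ?thesis unfolding k_def by (rule someI[where P="\<lambda>i. i < length L \<and> L ! i = rat_time q"])
  qed
  show thesis
  proof (rule that[of "length L - 1" "(!) L" k])
    show "L ! i < L ! Suc i" if "i < length L - 1" for i
      using sorted_wrt_nth_less[OF L(2), of i "Suc i"] that by simp
    obtain i where i: "i < length L" "L ! i = 0" using X(2) L(1) by (metis in_set_conv_nth)
    have "L ! 0 \<le> L ! i" using sorted_wrt_nth_less[OF L(2), of 0 i] i by (cases "i = 0") auto
    moreover have "L ! 0 \<in> set L" using len by (intro nth_mem) linarith
    then have "L ! 0 \<ge> 0" using nonneg L(1) by blast
    ultimately show "L ! 0 = 0" using i by simp
  qed (use k len in force)+
qed

text \<open>The start is exact at every sample point, not only almost surely, so that sums of
  increments equal the values of the path pointwise. Subtracting \<open>B 0\<close> achieves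
  this.\<close>

locale standard_bm =
  fixes M :: "'w measure" and W :: "real \<Rightarrow> 'w \<Rightarrow> real ^ 'd"
  assumes bm: "brownian_motion_from M 0 W"
    and start: "\<And>\<omega>. \<omega> \<in> space M \<Longrightarrow> W 0 \<omega> = 0"

lemma standard_bmI:
  assumes "brownian_motion_from M x B"
  shows "standard_bm M (\<lambda>t \<omega>. B t \<omega> - B 0 \<omega>)"
  using assms unfolding brownian_motion_from_def
  by unfold_locales (auto simp: brownian_motion_from_def intro!: continuous_intros borel_measurable_diff)

definition bm_law :: "'w measure \<Rightarrow> (real \<Rightarrow> 'w \<Rightarrow> real ^ 'd) \<Rightarrow> (rat \<Rightarrow> real ^ 'd) measure" where
  "bm_law M W = distr M paths (\<lambda>\<omega>. sample (\<lambda>t. W t \<omega>))"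

lemma measurable_sample:
  assumes "\<And>t. t \<ge> 0 \<Longrightarrow> B t \<in> borel_measurable M"
  shows "(\<lambda>\<omega>. sample (\<lambda>t. B t \<omega>)) \<in> measurable M paths"
  using assms rat_time_nonneg unfolding sample_def[abs_def]
  by (intro measurable_PiM_single') auto

context standard_bm
begin

sublocale prob_space M
  using bm by (simp add: brownian_motion_from_def)

lemma W_measurable[measurable]: "0 \<le> t \<Longrightarrow> W t \<in> borel_measurable M"
  using bm by (simp add: brownian_motion_from_def)

lemma W_continuous: "\<omega> \<in> space M \<Longrightarrow> continuous_on {0..} (\<lambda>t. W t \<omega>)"
  using bm by (simp add: brownian_motion_from_def)

lemma increment_distr:
  assumes "0 \<le> s" "s < t"
  shows "distr M borel (\<lambda>\<omega>. W t \<omega> - W s \<omega>) = density lborel (\<lambda>y. ennreal (heat_kernel (t - s) y))"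
proof -
  have "distributed M lborel (\<lambda>\<omega>. W t \<omega> - W s \<omega>)
     (\<lambda>y. ennreal (\<Prod>i\<in>UNIV. normal_density 0 (sqrt (t - s)) (y $ i)))"
    using bm assms unfolding brownian_motion_from_def by blast
  then have "distr M lborel (\<lambda>\<omega>. W t \<omega> - W s \<omega>) = density lborel (\<lambda>y. ennreal (heat_kernel (t - s) y))"
    using assms by (simp add: distributed_distr_eq_density prod_normal_density_eq_heat_kernel)
  moreover have "distr M lborel (\<lambda>\<omega>. W t \<omega> - W s \<omega>) = distr M borel (\<lambda>\<omega>. W t \<omega> - W s \<omega>)"
    by (rule distr_cong) simp_all
  ultimately show ?thesis by simp
qed

lemma increments_indep:
  assumes "0 \<le> T 0" "\<And>i. i < n \<Longrightarrow> T i < T (Suc i)"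
  shows "indep_vars (\<lambda>_. borel) (\<lambda>i \<omega>. W (T (Suc i)) \<omega> - W (T i) \<omega>) {..<n}"
  using bm assms unfolding brownian_motion_from_def by blast

lemma shift:
  assumes "r \<ge> 0"
  shows "standard_bm M (\<lambda>t \<omega>. W (r + t) \<omega> - W r \<omega>)"
proof
  show "brownian_motion_from M 0 (\<lambda>t \<omega>. W (r + t) \<omega> - W r \<omega>)"
    unfolding brownian_motion_from_def
  proof (intro conjI allI impI ballI)
    show "continuous_on {0..} (\<lambda>t. W (r + t) \<omega> - W r \<omega>)" if "\<omega> \<in> space M" for \<omega>
      using assms by (intro continuous_intros continuous_on_compose2[OF W_continuous[OF that]]) auto
    show "distributed M lborel (\<lambda>\<omega>. W (r + t) \<omega> - W r \<omega> - (W (r + s) \<omega> - W r \<omega>))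
      (\<lambda>y. ennreal (\<Prod>i\<in>UNIV. normal_density 0 (sqrt (t - s)) (y $ i)))"
      if "0 \<le> s \<and> s < t" for s t
    proof -
      have "0 \<le> r + s \<and> r + s < r + t" using assms that by simp
      then have "distributed M lborel (\<lambda>\<omega>. W (r + t) \<omega> - W (r + s) \<omega>)
        (\<lambda>y. ennreal (\<Prod>i\<in>UNIV. normal_density 0 (sqrt ((r + t) - (r + s))) (y $ i)))"
        using bm unfolding brownian_motion_from_def by blast
      then show ?thesis by simp
    qed
    show "indep_vars (\<lambda>_. borel) (\<lambda>i \<omega>. W (r + T (Suc i)) \<omega> - W r \<omega> - (W (r + T i) \<omega> - W r \<omega>)) {..<n}"
      if "0 \<le> T 0 \<and> (\<forall>i<n. T i < T (Suc i))" for n :: nat and T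
      using increments_indep[of "\<lambda>i. r + T i" n] that assms by simp
  qed (use assms prob_space_axioms in auto)
qed simp

lemma telescope:
  assumes "T 0 = 0" "\<omega> \<in> space M"
  shows "(\<Sum>i<k. W (T (Suc i)) \<omega> - W (T i) \<omega>) = W (T k) \<omega>"
  using sum_lessThan_telescope[of "\<lambda>i. W (T i) \<omega>" k] assms by (simp add: start)

lemma grid_set_measurable:
  fixes m n :: nat
  assumes "finite J" "\<And>q. q \<in> J \<Longrightarrow> A q \<in> sets borel" "\<And>q. q \<in> J \<Longrightarrow> k q \<le> n"
  shows "{v \<in> space (Pi\<^sub>M {m..<n} (\<lambda>_. borel)). \<forall>q\<in>J. (\<Sum>i=m..<k q. v i) \<in> A q} \<in>
    sets (Pi\<^sub>M {m..<n} (\<lambda>_. borel :: (real ^ 'd) measure))"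
proof (intro sets.sets_Collect_finite_All assms(1))
  fix q assume q: "q \<in> J"
  have "(\<lambda>v. \<Sum>i=m..<k q. v i) \<in> borel_measurable (Pi\<^sub>M {m..<n} (\<lambda>_. borel :: (real ^ 'd) measure))"
    using assms(3)[OF q]
    by (intro borel_measurable_sum measurable_component_singleton) (auto intro: order.strict_trans2)
  from measurable_sets[OF this assms(2)[OF q]]
  show "{v \<in> space (Pi\<^sub>M {m..<n} (\<lambda>_. borel)). (\<Sum>i=m..<k q. v i) \<in> A q} \<in>
    sets (Pi\<^sub>M {m..<n} (\<lambda>_. borel :: (real ^ 'd) measure))"
    by (simp add: vimage_def Int_def conj_commute)
qed

text \<open>The values of the path are partial sums of independent Gaussian increments. What matters
  is that the right side mentions neither \<open>M\<close> nor \<open>W\<close>, apart from the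
  event on the left being computed in them.\<close>

lemma finite_dim_distribution:
  assumes n: "n \<ge> 1" and T: "T 0 = 0" "\<And>i. i < n \<Longrightarrow> T i < T (Suc i)"
    and J: "finite J" "\<And>q. q \<in> J \<Longrightarrow> k q \<le> n \<and> T (k q) = rat_time q"
    and A: "\<And>q. q \<in> J \<Longrightarrow> A q \<in> sets borel"
  shows "emeasure M {\<omega> \<in> space M. \<forall>q\<in>J. W (rat_time q) \<omega> \<in> A q} =
    emeasure (Pi\<^sub>M {0..<n} (\<lambda>i. density lborel (\<lambda>y. ennreal (heat_kernel (T (Suc i) - T i) y))))
      {v \<in> space (Pi\<^sub>M {0..<n} (\<lambda>_. borel)). \<forall>q\<in>J. (\<Sum>i=0..<k q. v i) \<in> A q}"
    (is "_ = emeasure _ ?G")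
proof -
  define X where "X i \<omega> = W (T (Suc i)) \<omega> - W (T i) \<omega>" for i \<omega>
  have T0: "0 \<le> T i" if "i \<le> n" for i
    using that by (induction i) (use T in \<open>auto simp: Suc_le_eq intro: order_trans less_imp_le\<close>)
  have X: "X i \<in> borel_measurable M" if "i \<in> {0..<n}" for i
    unfolding X_def using that T0 by (intro borel_measurable_diff W_measurable) auto
  have "indep_vars (\<lambda>_. borel) X {0..<n}"
    unfolding X_def atLeast0LessThan using T by (intro increments_indep) auto
  then have "distr M (Pi\<^sub>M {0..<n} (\<lambda>_. borel)) (\<lambda>\<omega>. \<lambda>i\<in>{0..<n}. X i \<omega>) =
      Pi\<^sub>M {0..<n} (\<lambda>i. distr M borel (X i))"
    using n X by (subst (asm) indep_vars_iff_distr_eq_PiM') auto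
  also have "\<dots> = Pi\<^sub>M {0..<n} (\<lambda>i. density lborel (\<lambda>y. ennreal (heat_kernel (T (Suc i) - T i) y)))"
    using T T0 unfolding X_def[abs_def] by (intro PiM_cong increment_distr) auto
  finally have "emeasure (Pi\<^sub>M {0..<n} (\<lambda>i. density lborel (\<lambda>y. ennreal (heat_kernel (T (Suc i) - T i) y)))) ?G =
     emeasure (distr M (Pi\<^sub>M {0..<n} (\<lambda>_. borel)) (\<lambda>\<omega>. \<lambda>i\<in>{0..<n}. X i \<omega>)) ?G"
    by simp
  also have "\<dots> = emeasure M ((\<lambda>\<omega>. \<lambda>i\<in>{0..<n}. X i \<omega>) -` ?G \<inter> space M)"
    using J A by (intro emeasure_distr grid_set_measurable measurable_restrict X) auto
  also have "(\<lambda>\<omega>. \<lambda>i\<in>{0..<n}. X i \<omega>) -` ?G \<inter> space M = {\<omega> \<in> space M. \<forall>q\<in>J. W (rat_time q) \<omega> \<in> A q}"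
  proof -
    have "(\<Sum>i=0..<k q. (\<lambda>i\<in>{0..<n}. X i \<omega>) i) = W (rat_time q) \<omega>" if "q \<in> J" "\<omega> \<in> space M" for q \<omega>
    proof -
      have "(\<Sum>i=0..<k q. (\<lambda>i\<in>{0..<n}. X i \<omega>) i) = (\<Sum>i<k q. X i \<omega>)"
        using J(2)[OF that(1)] by (intro sum.cong) auto
      then show ?thesis using telescope[of T \<omega> "k q"] T that J(2) by (simp add: X_def)
    qed
    then show ?thesis by (auto simp: space_PiM)
  qed
  finally show ?thesis ..
qed

lemma emeasure_bm_law_cylinder:
  assumes "finite J" "\<And>q. q \<in> J \<Longrightarrow> A q \<in> sets borel"
  shows "emeasure (bm_law M W) (prod_emb UNIV (\<lambda>_. borel) J (Pi\<^sub>E J A)) =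
    emeasure M {\<omega> \<in> space M. \<forall>q\<in>J. W (rat_time q) \<omega> \<in> A q}"
proof -
  have "prod_emb UNIV (\<lambda>_. borel) J (Pi\<^sub>E J A) \<in> sets paths"
    using assms by (intro sets_PiM_I) auto
  then have "emeasure (bm_law M W) (prod_emb UNIV (\<lambda>_. borel) J (Pi\<^sub>E J A)) =
    emeasure M ((\<lambda>\<omega>. sample (\<lambda>t. W t \<omega>)) -` prod_emb UNIV (\<lambda>_. borel) J (Pi\<^sub>E J A) \<inter> space M)"
    unfolding bm_law_def by (intro emeasure_distr measurable_sample W_measurable)
  also have "(\<lambda>\<omega>. sample (\<lambda>t. W t \<omega>)) -` prod_emb UNIV (\<lambda>_. borel) J (Pi\<^sub>E J A) \<inter> space M =
     {\<omega> \<in> space M. \<forall>q\<in>J. W (rat_time q) \<omega> \<in> A q}"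
    by (auto simp: prod_emb_def sample_def PiE_iff restrict_def extensional_def)
  finally show ?thesis .
qed

lemma prob_space_bm_law: "prob_space (bm_law M W)"
  unfolding bm_law_def by (intro prob_space_distr measurable_sample W_measurable)

lemma sets_bm_law[measurable_cong, simp]: "sets (bm_law M W) = sets paths"
  by (simp add: bm_law_def)

end

text \<open>Cylinder sets determine a finite measure on \<open>paths\<close>, and their measure
  depends on the times alone. This identifies the law for all starting points, and that of the path
  after time \<open>r\<close> with the original one.\<close>

lemma bm_law_unique:
  fixes W :: "real \<Rightarrow> 'w \<Rightarrow> real ^ 'd" and W' :: "real \<Rightarrow> 'v \<Rightarrow> real ^ 'd"
  assumes "standard_bm M W" "standard_bm M' W'"
  shows "bm_law M W = bm_law M' W'"
proof (rule measure_eqI_PiM_infinite)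
  interpret M: standard_bm M W by fact
  interpret M': standard_bm M' W' by fact
  show "sets (bm_law M W) = sets paths" "sets (bm_law M' W') = sets paths" by simp_all
  show "finite_measure (bm_law M W)"
    using M.prob_space_bm_law by (rule prob_space.finite_measure)
  fix A :: "rat \<Rightarrow> (real ^ 'd) set" and J :: "rat set"
  assume J: "finite J" and A: "\<And>i. i \<in> J \<Longrightarrow> A i \<in> sets borel"
  obtain n :: nat and T :: "nat \<Rightarrow> real" and k :: "rat \<Rightarrow> nat"
    where g: "n \<ge> 1" "T 0 = 0" "\<And>i. i < n \<Longrightarrow> T i < T (Suc i)" "\<And>q. q \<in> J \<Longrightarrow> k q \<le> n \<and> T (k q) = rat_time q"
    using time_grid[OF J] by metis
  show "emeasure (bm_law M W) (prod_emb UNIV (\<lambda>_. borel) J (Pi\<^sub>E J A)) =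
      emeasure (bm_law M' W') (prod_emb UNIV (\<lambda>_. borel) J (Pi\<^sub>E J A))"
    using J A by (simp add: M.emeasure_bm_law_cylinder M'.emeasure_bm_law_cylinder
        M.finite_dim_distribution[OF g(1-3) J g(4) A] M'.finite_dim_distribution[OF g(1-3) J g(4) A])
qed

text \<open>For a fixed event of \<open>Y\<close>, the law \<open>Q\<close> of \<open>S\<close>
  restricted to that event and the scaled law of \<open>S\<close> are finite measures that agree on
  cylinders. Independence from finitely many coordinates thus extends to the whole sampled
  path.\<close>

lemma distr_pair_paths:
  fixes Y :: "'w \<Rightarrow> 'b::euclidean_space" and S :: "'w \<Rightarrow> rat \<Rightarrow> 'a::euclidean_space"
  assumes M: "prob_space M" and [measurable]: "Y \<in> borel_measurable M" "S \<in> measurable M paths"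
    and indep: "\<And>J A A0. finite J \<Longrightarrow> (\<And>q. q \<in> J \<Longrightarrow> A q \<in> sets borel) \<Longrightarrow> A0 \<in> sets borel \<Longrightarrow>
      measure M {\<omega> \<in> space M. Y \<omega> \<in> A0 \<and> (\<forall>q\<in>J. S \<omega> q \<in> A q)} =
      measure M {\<omega> \<in> space M. Y \<omega> \<in> A0} * measure M {\<omega> \<in> space M. \<forall>q\<in>J. S \<omega> q \<in> A q}"
  shows "distr M (borel \<Otimes>\<^sub>M paths) (\<lambda>\<omega>. (Y \<omega>, S \<omega>)) = distr M borel Y \<Otimes>\<^sub>M distr M paths S"
proof (rule sym, rule pair_measure_eqI)
  interpret prob_space M by fact
  interpret Y: prob_space "distr M borel Y" by (rule prob_space_distr) measurable
  interpret S: prob_space "distr M paths S" by (rule prob_space_distr) measurable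
  show "sigma_finite_measure (distr M borel Y)" "sigma_finite_measure (distr M paths S)" by unfold_locales
  show "sets (distr M borel Y \<Otimes>\<^sub>M distr M paths S) = sets (distr M (borel \<Otimes>\<^sub>M paths) (\<lambda>\<omega>. (Y \<omega>, S \<omega>)))"
    by simp
  fix A0 B assume "A0 \<in> sets (distr M borel Y)" "B \<in> sets (distr M paths S)"
  then have A0[measurable]: "A0 \<in> sets borel" and B[measurable]: "B \<in> sets paths" by simp_all
  define E where "E = {\<omega> \<in> space M. Y \<omega> \<in> A0}"
  have E[measurable]: "E \<in> sets M" unfolding E_def by measurable
  define Q where "Q = distr (density M (indicator E)) paths S"
  have Q: "emeasure Q B = emeasure M (E \<inter> (S -` B \<inter> space M))" if [measurable]: "B \<in> sets paths" for B
    unfolding Q_def by (simp add: emeasure_distr emeasure_density indicator_inter_arith[symmetric])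
  have "Q = scale_measure (emeasure M E) (distr M paths S)"
  proof (rule measure_eqI_PiM_infinite)
    show "finite_measure Q"
    proof
      show "emeasure Q (space Q) \<noteq> \<infinity>" using Q[of "space paths"] by (simp add: Q_def)
    qed
    fix A :: "rat \<Rightarrow> 'a set" and J assume J: "finite J" and A: "\<And>i. i \<in> J \<Longrightarrow> A i \<in> sets borel"
    let ?C = "prod_emb UNIV (\<lambda>_. borel) J (Pi\<^sub>E J A)"
    have C[measurable]: "?C \<in> sets paths" using J A by (intro sets_PiM_I) auto
    have pre: "S -` ?C \<inter> space M = {\<omega> \<in> space M. \<forall>q\<in>J. S \<omega> q \<in> A q}"
      by (auto simp: prod_emb_def PiE_iff restrict_def extensional_def)
    have "emeasure Q ?C = measure M {\<omega> \<in> space M. Y \<omega> \<in> A0 \<and> (\<forall>q\<in>J. S \<omega> q \<in> A q)}"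
      unfolding Q[OF C] pre by (simp add: E_def emeasure_eq_measure Int_def conj_ac cong: conj_cong)
    also have "\<dots> = emeasure M E * emeasure M (S -` ?C \<inter> space M)"
    proof -
      have "prob {\<omega> \<in> space M. Y \<omega> \<in> A0 \<and> (\<forall>q\<in>J. S \<omega> q \<in> A q)} = prob E * prob (S -` ?C \<inter> space M)"
        unfolding pre E_def by (rule indep[OF J A A0])
      then show ?thesis by (simp add: emeasure_eq_measure ennreal_mult)
    qed
    finally show "emeasure Q ?C = emeasure (scale_measure (emeasure M E) (distr M paths S)) ?C"
      by (simp add: emeasure_distr)
  qed (simp_all add: Q_def)
  then have "emeasure Q B = emeasure M E * emeasure M (S -` B \<inter> space M)"
    by (simp add: emeasure_distr)
  moreover have "(\<lambda>\<omega>. (Y \<omega>, S \<omega>)) -` (A0 \<times> B) \<inter> space M = E \<inter> (S -` B \<inter> space M)"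
    by (auto simp: E_def)
  moreover have "Y -` A0 \<inter> space M = E" by (auto simp: E_def)
  ultimately show "emeasure (distr M borel Y) A0 * emeasure (distr M paths S) B =
      emeasure (distr M (borel \<Otimes>\<^sub>M paths) (\<lambda>\<omega>. (Y \<omega>, S \<omega>))) (A0 \<times> B)"
    by (simp add: emeasure_distr Q)
qed

section \<open>The Markov property at a fixed time, and the probability of a large
  displacement\<close>

context standard_bm
begin

text \<open>Independence of \<open>W r\<close> and the later path reduces to finitely many times,
  where both are functions of disjoint blocks of independent increments.\<close>

lemma Markov_pair_law:
  assumes r: "r > 0"
  shows "distr M (borel \<Otimes>\<^sub>M paths) (\<lambda>\<omega>. (W r \<omega>, sample (\<lambda>t. W (r + t) \<omega> - W r \<omega>))) =
    density lborel (\<lambda>y. ennreal (heat_kernel r y)) \<Otimes>\<^sub>M bm_law M W"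
proof -
  interpret sh: standard_bm M "\<lambda>t \<omega>. W (r + t) \<omega> - W r \<omega>" using r by (intro shift) simp
  have "distr M (borel \<Otimes>\<^sub>M paths) (\<lambda>\<omega>. (W r \<omega>, sample (\<lambda>t. W (r + t) \<omega> - W r \<omega>))) =
    distr M borel (W r) \<Otimes>\<^sub>M bm_law M (\<lambda>t \<omega>. W (r + t) \<omega> - W r \<omega>)"
    unfolding bm_law_def
  proof (rule distr_pair_paths)
    show "prob_space M" by (rule prob_space_axioms)
    show "W r \<in> borel_measurable M" using r by simp
    show "(\<lambda>\<omega>. sample (\<lambda>t. W (r + t) \<omega> - W r \<omega>)) \<in> measurable M paths"
      by (intro measurable_sample sh.W_measurable)
    fix J :: "rat set" and A :: "rat \<Rightarrow> (real ^ 'd) set" and A0 :: "(real ^ 'd) set"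
    assume J: "finite J" and A: "\<And>q. q \<in> J \<Longrightarrow> A q \<in> sets borel" and A0: "A0 \<in> sets borel"
    obtain n :: nat and T :: "nat \<Rightarrow> real" and k :: "rat \<Rightarrow> nat"
      where g: "n \<ge> 1" "T 0 = 0" "\<And>i. i < n \<Longrightarrow> T i < T (Suc i)" "\<And>q. q \<in> J \<Longrightarrow> k q \<le> n \<and> T (k q) = rat_time q"
      using time_grid[OF J] by metis
    \<comment> \<open>The grid 0, \<open>r\<close>, \<open>r + T 1\<close>, and so on: increment 0
      is \<open>W r\<close>, and increments 1 to \<open>n\<close> belong to the path after
      \<open>r\<close>. This accounts for the \<open>Suc (k q)\<close> in the sums below.\<close>
    define T' where "T' i = (case i of 0 \<Rightarrow> 0 | Suc i \<Rightarrow> r + T i)" for i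
    define X where "X i \<omega> = W (T' (Suc i)) \<omega> - W (T' i) \<omega>" for i \<omega>
    have ind: "indep_vars (\<lambda>_. borel) X {..<Suc n}"
      unfolding X_def using g r by (intro increments_indep) (auto simp: T'_def less_Suc_eq_0_disj)
    let ?P0 = "Pi\<^sub>M {0 :: nat} (\<lambda>_. borel :: (real ^ 'd) measure)" and ?P1 = "Pi\<^sub>M {1..<Suc n} (\<lambda>_. borel :: (real ^ 'd) measure)"
    have iv: "indep_var ?P0 (\<lambda>\<omega>. restrict (\<lambda>i. X i \<omega>) {0}) ?P1 (\<lambda>\<omega>. restrict (\<lambda>i. X i \<omega>) {1..<Suc n})"
      by (rule indep_var_restrict[OF ind]) auto
    define G0 where "G0 = {v \<in> space ?P0. v 0 \<in> A0}"
    define G1 where "G1 = {v \<in> space ?P1. \<forall>q\<in>J. (\<Sum>i=1..<Suc (k q). v i) \<in> A q}"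
    have "(\<lambda>v. v 0) \<in> measurable ?P0 borel" by (rule measurable_component_singleton) simp
    from measurable_sets[OF this A0] have G0: "G0 \<in> sets ?P0"
      by (simp add: G0_def vimage_def Int_def conj_commute)
    have G1: "G1 \<in> sets ?P1" unfolding G1_def
      using J A g(4) by (intro grid_set_measurable[where k="\<lambda>q. Suc (k q)"]) auto
    have tel: "(\<Sum>i=1..<Suc m. X i \<omega>) = W (r + T m) \<omega> - W r \<omega>" if "\<omega> \<in> space M" for m \<omega>
    proof -
      have "(\<Sum>i=1..<Suc m. X i \<omega>) = (\<Sum>i<m. W (r + T (Suc i)) \<omega> - W (r + T i) \<omega>)"
        by (simp only: One_nat_def sum.shift_bounds_Suc_ivl) (simp add: atLeast0LessThan X_def T'_def)
      also have "\<dots> = W (r + T m) \<omega> - W (r + T 0) \<omega>" by (rule sum_lessThan_telescope)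
      finally show ?thesis using g(2) by simp
    qed
    have pre0: "(\<lambda>\<omega>. restrict (\<lambda>i. X i \<omega>) {0}) -` G0 \<inter> space M = {\<omega> \<in> space M. W r \<omega> \<in> A0}"
      using g(2) start by (auto simp: G0_def space_PiM X_def T'_def)
    define Y where "Y \<omega> = restrict (\<lambda>i. X i \<omega>) {1..<Suc n}" for \<omega>
    have Y_space: "Y \<omega> \<in> space ?P1" for \<omega> by (simp add: Y_def space_PiM)
    have Y_sum: "(\<Sum>i=1..<Suc (k q). Y \<omega> i) = sample (\<lambda>t. W (r + t) \<omega> - W r \<omega>) q"
      if "q \<in> J" "\<omega> \<in> space M" for q \<omega>
    proof -
      have "(\<Sum>i=1..<Suc (k q). Y \<omega> i) = (\<Sum>i=1..<Suc (k q). X i \<omega>)"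
        using g(4)[OF that(1)] by (intro sum.cong) (auto simp: Y_def)
      then show ?thesis using tel[OF that(2), of "k q"] g(4)[OF that(1)] by (simp add: sample_def)
    qed
    have "Y -` G1 \<inter> space M = {\<omega> \<in> space M. \<forall>q\<in>J. (\<Sum>i=1..<Suc (k q). Y \<omega> i) \<in> A q}"
      unfolding G1_def using Y_space by blast
    also have "\<dots> = {\<omega> \<in> space M. \<forall>q\<in>J. sample (\<lambda>t. W (r + t) \<omega> - W r \<omega>) q \<in> A q}"
      by (intro Collect_cong conj_cong refl ball_cong arg_cong2[where f="(\<in>)"] Y_sum)
    finally have pre1: "(\<lambda>\<omega>. restrict (\<lambda>i. X i \<omega>) {1..<Suc n}) -` G1 \<inter> space M =
      {\<omega> \<in> space M. \<forall>q\<in>J. sample (\<lambda>t. W (r + t) \<omega> - W r \<omega>) q \<in> A q}"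
      unfolding Y_def .
    have "(\<lambda>\<omega>. (restrict (\<lambda>i. X i \<omega>) {0}, restrict (\<lambda>i. X i \<omega>) {1..<Suc n})) -` (G0 \<times> G1) \<inter> space M =
       {\<omega> \<in> space M. W r \<omega> \<in> A0 \<and> (\<forall>q\<in>J. sample (\<lambda>t. W (r + t) \<omega> - W r \<omega>) q \<in> A q)}"
      using pre0 pre1 by blast
    then show "prob {\<omega> \<in> space M. W r \<omega> \<in> A0 \<and> (\<forall>q\<in>J. sample (\<lambda>t. W (r + t) \<omega> - W r \<omega>) q \<in> A q)} =
      prob {\<omega> \<in> space M. W r \<omega> \<in> A0} * prob {\<omega> \<in> space M. \<forall>q\<in>J. sample (\<lambda>t. W (r + t) \<omega> - W r \<omega>) q \<in> A q}"
      using indep_varD[OF iv G0 G1] pre0 pre1 by simp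
  qed
  also have "bm_law M (\<lambda>t \<omega>. W (r + t) \<omega> - W r \<omega>) = bm_law M W"
    by (rule bm_law_unique) unfold_locales
  also have "distr M borel (W r) = distr M borel (\<lambda>\<omega>. W r \<omega> - W 0 \<omega>)"
    by (rule distr_cong) (auto simp: start)
  also have "\<dots> = density lborel (\<lambda>y. ennreal (heat_kernel r y))"
    using increment_distr[of 0 r] r by simp
  finally show ?thesis .
qed

text \<open>On the tail, half of the Gaussian exponent is at most
  \<open>32 * (t - s)\<^sup>2 / a ^ 4\<close>; the other half is a kernel of total mass one. The
  fourth power of \<open>a\<close> against the square of the time is what the union over dyadic
  scales relies on.\<close>

lemma increment_tail:
  assumes st: "0 \<le> s" "s < t" and a: "a > 0"
  shows "prob {\<omega> \<in> space M. a < dist (W t \<omega>) (W s \<omega>)} \<le> sqrt 2 ^ CARD('d) * (32 * (t - s)\<^sup>2 / a ^ 4)"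
proof -
  define h where "h = t - s"
  have h: "h > 0" using st by (simp add: h_def)
  define D where "D = sqrt 2 ^ CARD('d)"
  have ex: "exp (- a\<^sup>2 / (4 * h)) \<le> 32 * h\<^sup>2 / a ^ 4"
  proof -
    define y where "y = a\<^sup>2 / (4 * h)"
    have y: "y > 0" using a h by (simp add: y_def)
    have "exp (- y) \<le> 2 / y\<^sup>2" by (rule exp_minus_le_inverse_square[OF y])
    also have "2 / y\<^sup>2 = 32 * h\<^sup>2 / a ^ 4"
      by (simp add: y_def power_divide power_mult_distrib flip: power_mult)
    finally show ?thesis by (simp add: y_def)
  qed
  let ?B = "{y :: real ^ 'd. a < norm y}"
  have B[measurable]: "?B \<in> sets borel" by measurable
  have "emeasure M {\<omega> \<in> space M. a < dist (W t \<omega>) (W s \<omega>)} = emeasure (distr M borel (\<lambda>\<omega>. W t \<omega> - W s \<omega>)) ?B"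
    using st by (subst emeasure_distr) (auto simp: dist_norm intro!: arg_cong[where f="emeasure M"])
  also have "\<dots> = (\<integral>\<^sup>+y. ennreal (heat_kernel h y) * indicator ?B y \<partial>lborel)"
    unfolding increment_distr[OF st] h_def[symmetric] by (simp add: emeasure_density)
  also have "\<dots> \<le> (\<integral>\<^sup>+y. ennreal (D * (32 * h\<^sup>2 / a ^ 4)) * ennreal (heat_kernel (2 * h) (y :: real ^ 'd)) \<partial>lborel)"
  proof (rule nn_integral_mono)
    fix y :: "real ^ 'd"
    show "ennreal (heat_kernel h y) * indicator ?B y \<le> ennreal (D * (32 * h\<^sup>2 / a ^ 4)) * ennreal (heat_kernel (2 * h) y)"
    proof (cases "y \<in> ?B")
      case True
      then have "a\<^sup>2 \<le> y \<bullet> y" using a by (simp add: power2_norm_eq_inner[symmetric] power_mono)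
      then have "exp (- (y \<bullet> y) / (4 * h)) \<le> exp (- a\<^sup>2 / (4 * h))" using h by (simp add: divide_right_mono)
      also note ex
      finally have "D * exp (- (y \<bullet> y) / (4 * h)) \<le> D * (32 * h\<^sup>2 / a ^ 4)"
        by (rule mult_left_mono) (simp add: D_def)
      then have "D * exp (- (y \<bullet> y) / (4 * h)) * heat_kernel (2 * h) y \<le> D * (32 * h\<^sup>2 / a ^ 4) * heat_kernel (2 * h) y"
        using h by (intro mult_right_mono) (simp_all add: heat_kernel_nonneg)
      then have "heat_kernel h y \<le> D * (32 * h\<^sup>2 / a ^ 4) * heat_kernel (2 * h) y"
        unfolding heat_kernel_double[OF h, of y] by (simp add: D_def)
      then show ?thesis using True h by (simp add: ennreal_mult[symmetric] D_def heat_kernel_nonneg)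
    qed simp
  qed
  also have "\<dots> = ennreal (D * (32 * h\<^sup>2 / a ^ 4))"
    using h by (simp add: nn_integral_cmult nn_integral_heat_kernel)
  finally show ?thesis
    unfolding emeasure_eq_measure by (subst (asm) ennreal_le_iff) (auto simp: D_def h_def)
qed

text \<open>A union bound over the increments on dyadic subintervals; their independence is not needed.\<close>

lemma sup_small:
  assumes \<delta>: "\<delta> > 0"
  obtains C where "\<And>r. r > 0 \<Longrightarrow> \<exists>E\<in>sets M. prob E \<le> C * r\<^sup>2 \<and>
    (\<forall>\<omega>\<in>space M - E. \<forall>q. 0 \<le> q \<longrightarrow> q \<le> r \<longrightarrow> norm (W q \<omega>) < \<delta>)"
proof -
  \<comment> \<open>The thresholds sum to at most \<open>\<delta> / 20 * 10 = \<delta> / 2\<close>.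
    The ratio 9/10 is close enough to 1 for its fourth power to exceed 1/2, which makes the union
    bound summable.\<close>
  define a where "a n = \<delta> / 20 * (9/10) ^ n" for n
  have a: "a n > 0" for n using \<delta> by (simp add: a_def)
  have asum: "(\<Sum>m\<le>n. a m) \<le> \<delta> / 2" for n
  proof -
    have "(\<Sum>m\<le>n. a m) = \<delta> / 20 * (\<Sum>m\<le>n. (9/10) ^ m)" by (simp add: a_def sum_distrib_left)
    also have "(\<Sum>m\<le>n. (9/10 :: real) ^ m) = (1 - (9/10) ^ Suc n) / (1 - 9/10)"
      by (subst sum_gp0) (simp add: lessThan_Suc_atMost)
    also have "\<delta> / 20 * ((1 - (9/10) ^ Suc n) / (1 - 9/10)) \<le> \<delta> / 20 * (1 / (1 - 9/10))"
      using \<delta> by (intro mult_left_mono divide_right_mono) auto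
    finally show ?thesis by simp
  qed
  define D where "D = sqrt 2 ^ CARD('d) * 32 * (20 / \<delta>) ^ 4"
  have D: "D \<ge> 0" using \<delta> by (simp add: D_def)
  \<comment> \<open>Level \<open>n\<close> has \<open>2 ^ n\<close> increments, each contributing
    \<open>(1/4) ^ n\<close> from the squared length divided by \<open>(6561/10000) ^ n\<close> from
    the fourth power of the threshold; the product is \<open>\<rho> ^ n\<close>.\<close>
  define \<rho> where "\<rho> = (5000 / 6561 :: real)"
  have summ: "summable (\<lambda>n. D * r\<^sup>2 * \<rho> ^ n)" for r by (intro summable_mult summable_geometric) (simp add: \<rho>_def)
  define C where "C = D * (1 / (1 - \<rho>))"
  have "\<exists>E\<in>sets M. prob E \<le> C * r\<^sup>2 \<and> (\<forall>\<omega>\<in>space M - E. \<forall>q. 0 \<le> q \<longrightarrow> q \<le> r \<longrightarrow> norm (W q \<omega>) < \<delta>)"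
    if r: "r > 0" for r
  proof -
    define F where "F n k = {\<omega> \<in> space M. a n < dist (W (real (Suc k) * r / 2 ^ n) \<omega>) (W (real k * r / 2 ^ n) \<omega>)}" for n k
    have F[measurable]: "F n k \<in> sets M" for n k
    proof -
      have [measurable]: "W (real (Suc k) * r / 2 ^ n) \<in> borel_measurable M" "W (real k * r / 2 ^ n) \<in> borel_measurable M"
        using r by simp_all
      show ?thesis unfolding F_def by measurable
    qed
    have pF: "prob (F n k) \<le> D * r\<^sup>2 * (\<rho> / 2) ^ n" for n k
    proof -
      have d: "real (Suc k) * r / 2 ^ n - real k * r / 2 ^ n = r / 2 ^ n" by (simp add: diff_divide_distrib[symmetric] left_diff_distrib[symmetric])
      have "prob (F n k) \<le> sqrt 2 ^ CARD('d) * (32 * (r / 2 ^ n)\<^sup>2 / a n ^ 4)"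
        using increment_tail[of "real k * r / 2 ^ n" "real (Suc k) * r / 2 ^ n" "a n"] a[of n] r
        unfolding d F_def by (simp add: divide_strict_right_mono)
      also have "(r / 2 ^ n)\<^sup>2 = r\<^sup>2 * (1/4) ^ n"
        by (simp add: power_divide power_mult[symmetric] mult.commute[of n] power_mult)
      also have "a n ^ 4 = (\<delta> / 20) ^ 4 * (6561/10000) ^ n"
      proof -
        have "((9/10 :: real) ^ n) ^ 4 = ((9/10) ^ 4) ^ n" by (simp add: power_mult[symmetric] mult.commute)
        moreover have "(9/10 :: real) ^ 4 = 6561/10000" by (simp add: power_divide)
        ultimately show ?thesis unfolding a_def power_mult_distrib by (simp only:)
      qed
      also have "sqrt 2 ^ CARD('d) * (32 * (r\<^sup>2 * (1/4) ^ n) / ((\<delta> / 20) ^ 4 * (6561/10000) ^ n)) =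
         D * r\<^sup>2 * ((1/4) ^ n / (6561/10000) ^ n)"
        using \<delta> by (simp add: D_def field_simps)
      also have "(1/4 :: real) ^ n / (6561/10000) ^ n = (\<rho> / 2) ^ n"
        by (simp add: power_divide[symmetric] \<rho>_def)
      finally show ?thesis .
    qed
    define E where "E = (\<Union>n. \<Union>k<2 ^ n. F n k)"
    have E: "E \<in> sets M" unfolding E_def by measurable
    have pn: "prob (\<Union>k<2 ^ n. F n k) \<le> D * r\<^sup>2 * \<rho> ^ n" for n
    proof -
      have "prob (\<Union>k<2 ^ n. F n k) \<le> (\<Sum>k<2 ^ n. prob (F n k))"
        by (intro finite_measure_subadditive_finite) auto
      also have "\<dots> \<le> (\<Sum>k<(2::nat) ^ n. D * r\<^sup>2 * (\<rho> / 2) ^ n)" by (intro sum_mono pF)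
      also have "\<dots> = D * r\<^sup>2 * \<rho> ^ n" by (simp add: power_divide)
      finally show ?thesis .
    qed
    have sumP: "summable (\<lambda>n. prob (\<Union>k<2 ^ n. F n k))"
      by (rule summable_comparison_test'[OF summ[of r]]) (use pn in simp)
    have "prob E \<le> (\<Sum>n. prob (\<Union>k<2 ^ n. F n k))"
      unfolding E_def by (intro finite_measure_subadditive_countably sumP) auto
    also have "\<dots> \<le> (\<Sum>n. D * r\<^sup>2 * \<rho> ^ n)" by (intro suminf_le pn sumP summ)
    also have "\<dots> = C * r\<^sup>2" unfolding C_def
      by (subst suminf_mult) (auto simp: suminf_geometric \<rho>_def)
    finally have "prob E \<le> C * r\<^sup>2" .
    moreover have "norm (W q \<omega>) < \<delta>" if \<omega>: "\<omega> \<in> space M - E" and q: "0 \<le> q" "q \<le> r" for \<omega> q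
    proof -
      have "dist (W q \<omega>) (W 0 \<omega>) \<le> \<delta> / 2"
      proof (rule dyadic_chaining[where b="\<lambda>t. W t \<omega>" and a=a and r=r])
        show "continuous_on {0..r} (\<lambda>t. W t \<omega>)"
          using W_continuous[of \<omega>] \<omega> by (auto intro: continuous_on_subset)
        show "dist (W (real (Suc k) * r / 2 ^ n) \<omega>) (W (real k * r / 2 ^ n) \<omega>) \<le> a n" if "k < 2 ^ n" for n k
        proof -
          have "\<omega> \<notin> F n k" using \<omega> that by (auto simp: E_def)
          then show ?thesis using \<omega> by (simp add: F_def not_less)
        qed
      qed (use a asum r q in \<open>auto intro: less_imp_le\<close>)
      then show ?thesis using start[of \<omega>] \<omega> \<delta> by (simp add: dist_norm)
    qed
    ultimately show ?thesis using E by blast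
  qed
  then show thesis by (rule that)
qed

end

section \<open>The exit problem\<close>

lemma measurable_path_translate:
  "(\<lambda>(z, w). \<lambda>q. z + w q) \<in> measurable (borel \<Otimes>\<^sub>M paths) (paths :: (rat \<Rightarrow> 'a::euclidean_space) measure)"
proof -
  have [measurable]: "(\<lambda>p. snd p q) \<in> measurable (borel \<Otimes>\<^sub>M (paths :: (rat \<Rightarrow> 'a) measure)) borel" for q
    by (rule measurable_compose[OF measurable_snd measurable_path_component])
  show ?thesis unfolding split_def by (intro measurable_PiM_single') auto
qed

lemma measurable_path_translate_fixed[measurable]:
  "(\<lambda>w. \<lambda>q. z + w q) \<in> measurable paths (paths :: (rat \<Rightarrow> 'a::euclidean_space) measure)"
  using measurable_compose[OF _ measurable_path_translate, of "\<lambda>w. (z, w)" paths] by simp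

locale exit_problem = standard_bm M W
  for M :: "'w measure" and W :: "real \<Rightarrow> 'w \<Rightarrow> real ^ 'd" +
  fixes D A :: "(real ^ 'd) set" and f :: "real \<times> (real ^ 'd) \<Rightarrow> real" and K :: real
  assumes open_D: "open D" and closed_A: "closed A" "A \<noteq> {}" and disjoint: "D \<inter> A = {}"
    and f_meas: "f \<in> borel_measurable borel" and f_bound: "\<And>p. \<bar>f p\<bar> \<le> K"
begin

abbreviation exit_val :: "nat \<Rightarrow> real \<Rightarrow> real \<Rightarrow> (rat \<Rightarrow> real ^ 'd) \<Rightarrow> real" where
  "exit_val j t s \<equiv> hit_val (\<lambda>\<theta> y. mix j f t (s + \<theta>) y) A"

text \<open>One law of the path started at 0, translated by \<open>z\<close>, represents every
  starting point. This makes the dependence on \<open>z\<close> measurable and independent of how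
  each \<open>P x\<close> is realised.\<close>

definition U :: "nat \<Rightarrow> real \<Rightarrow> real \<Rightarrow> real ^ 'd \<Rightarrow> real" where
  "U j t s z = (\<integral>w. exit_val j t s (\<lambda>q. z + w q) \<partial>bm_law M W)"

sublocale law: prob_space "bm_law M W"
  by (rule prob_space_bm_law)

lemma mix_shift_measurable[measurable]:
  "(\<lambda>(\<theta>, y). mix j f t (s + \<theta>) y) \<in> borel_measurable (borel \<Otimes>\<^sub>M borel)"
proof -
  have "(\<lambda>(\<theta> :: real, y :: real ^ 'd). (s + \<theta>, y)) \<in> measurable (borel \<Otimes>\<^sub>M borel) (borel \<Otimes>\<^sub>M borel)"
    by measurable
  from measurable_compose[OF this mix_measurable[OF f_meas f_bound, of j t]]
  show ?thesis by (simp add: split_def)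
qed

lemma hit_val_translate_measurable:
  "(\<lambda>(z, w). exit_val j t s (\<lambda>q. z + w q)) \<in> borel_measurable (borel \<Otimes>\<^sub>M bm_law M W)"
proof -
  have "(\<lambda>p. exit_val j t s (case p of (z, w) \<Rightarrow> \<lambda>q. z + w q)) \<in> borel_measurable (borel \<Otimes>\<^sub>M paths)"
    by (rule measurable_compose[OF measurable_path_translate measurable_hit_val[OF mix_shift_measurable]])
  then have "(\<lambda>(z, w). exit_val j t s (\<lambda>q. z + w q)) \<in> borel_measurable (borel \<Otimes>\<^sub>M paths)"
    by (simp add: split_def)
  then show ?thesis by (simp cong: measurable_cong_sets sets_pair_measure_cong)
qed

lemma hit_val_law_measurable:
  "(\<lambda>w. exit_val j t s (\<lambda>q. z + w q)) \<in> borel_measurable (bm_law M W)"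
  using measurable_compose[OF measurable_path_translate_fixed measurable_hit_val[OF mix_shift_measurable]]
  by (simp cong: measurable_cong_sets)

lemma U_measurable: "U j t s \<in> borel_measurable borel"
  unfolding U_def[abs_def]
  by (rule law.borel_measurable_lebesgue_integral[OF hit_val_translate_measurable])

lemma mix_boundE:
  assumes "a > 0"
  obtains C where "\<And>t s y. a \<le> t \<Longrightarrow> t \<le> b \<Longrightarrow> \<bar>mix j f t s y\<bar> \<le> C"
  using mix_bound[OF f_meas f_bound assms] by metis

lemma hit_val_integrable:
  assumes "t > 0"
  shows "integrable (bm_law M W) (\<lambda>w. exit_val j t s (\<lambda>q. z + w q))"
proof -
  obtain C where C: "\<And>u s y. t \<le> u \<Longrightarrow> u \<le> t \<Longrightarrow> \<bar>mix j f u s y\<bar> \<le> C" using mix_boundE[OF assms] by metis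
  show ?thesis
    by (rule law.integrable_const_bound[where B=C]) (use C in \<open>auto intro!: hit_val_law_measurable hit_val_bound\<close>)
qed

lemma U_bound:
  assumes C: "\<And>s y. \<bar>mix j f t s y\<bar> \<le> C" and t: "t > 0"
  shows "\<bar>U j t s z\<bar> \<le> C"
proof -
  have "\<bar>U j t s z\<bar> \<le> (\<integral>w. C \<partial>bm_law M W)"
    unfolding U_def using C t
    by (intro order_trans[OF integral_abs_bound integral_mono] integrable_abs hit_val_integrable)
      (auto intro!: hit_val_bound)
  then show ?thesis by (simp add: law.prob_space)
qed

lemma U_time_derivative:
  assumes t: "t > 0"
  shows "((\<lambda>t. U j t s z) has_real_derivative U (Suc j) t s z) (at t)"
proof -
  have t2: "t / 2 > 0" using t by simp
  obtain C where C: "\<And>u s y. t / 2 \<le> u \<Longrightarrow> u \<le> t + 1 \<Longrightarrow> \<bar>mix (Suc j) f u s y\<bar> \<le> C" using mix_boundE[OF t2] by metis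
  show ?thesis unfolding U_def
  proof (rule has_real_derivative_lebesgue_integral[where a="t / 2" and b="t + 1" and w="\<lambda>_. C"])
    fix u w assume u: "t / 2 < u" "u < t + 1"
    then have u0: "u > 0" using t by simp
    show "integrable (bm_law M W) (\<lambda>w. exit_val j u s (\<lambda>q. z + w q))"
      by (rule hit_val_integrable[OF u0])
    show "((\<lambda>h. exit_val j h s (\<lambda>q. z + w q)) has_real_derivative
        exit_val (Suc j) u s (\<lambda>q. z + w q)) (at u)"
      unfolding hit_val_def using mix_has_time_derivative[OF f_meas f_bound u0] by auto
    show "\<bar>exit_val (Suc j) u s (\<lambda>q. z + w q)\<bar> \<le> C"
      using u by (intro hit_val_bound C) auto
  qed (use t in auto)
qed

lemma U_heat_derivative:
  assumes t: "t > 0" and s: "s > 0"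
  shows "((\<lambda>s. U 0 t s z) has_real_derivative - U 2 t s z / 2) (at s)"
proof -
  obtain C where C: "\<And>u s y. t \<le> u \<Longrightarrow> u \<le> t \<Longrightarrow> \<bar>mix 2 f u s y\<bar> \<le> C" using mix_boundE[OF t] by metis
  have "((\<lambda>s. U 0 t s z) has_real_derivative
     (\<integral>w. - exit_val 2 t s (\<lambda>q. z + w q) / 2 \<partial>bm_law M W)) (at s)"
    unfolding U_def
  proof (rule has_real_derivative_lebesgue_integral[where a="s / 2" and b="s + 1" and w="\<lambda>_. C"])
    fix u w assume u: "s / 2 < u" "u < s + 1"
    show "integrable (bm_law M W) (\<lambda>w. exit_val 0 t u (\<lambda>q. z + w q))"
      by (rule hit_val_integrable[OF t])
    let ?h = "hit_time A (\<lambda>q. z + w q)"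
    \<comment> \<open>For a path that never hits, \<open>real_of_ereal ?h\<close> is 0 by
      convention, and the functional is constantly 0 there.\<close>
    have "0 \<le> real_of_ereal ?h" using hit_time_nonneg by (rule real_of_ereal_pos)
    then have "u + real_of_ereal ?h > 0" using u s by linarith
    from mix_has_heat_derivative[OF f_meas f_bound t this]
    have "((\<lambda>h. mix 0 f t (h + real_of_ereal ?h) y) has_real_derivative - mix 2 f t (u + real_of_ereal ?h) y / 2) (at u)" for y
      by (subst (asm) DERIV_shift) 
    then show "((\<lambda>h. exit_val 0 t h (\<lambda>q. z + w q)) has_real_derivative
        - exit_val 2 t u (\<lambda>q. z + w q) / 2) (at u)"
      unfolding hit_val_def by auto
    have "\<bar>exit_val 2 t u (\<lambda>q. z + w q)\<bar> \<le> C"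
      by (intro hit_val_bound C) auto
    then show "\<bar>- exit_val 2 t u (\<lambda>q. z + w q) / 2\<bar> \<le> C" by simp
  qed (use s in auto)
  then show ?thesis by (simp add: U_def)
qed

lemma U_eq_expectation:
  "U j t s z = (\<integral>\<omega>. exit_val j t s (sample (\<lambda>t. z + W t \<omega>)) \<partial>M)"
proof -
  have "U j t s z = (\<integral>\<omega>. exit_val j t s (\<lambda>q. z + sample (\<lambda>t. W t \<omega>) q) \<partial>M)"
    unfolding U_def bm_law_def
    by (rule integral_distr) (auto intro!: measurable_sample W_measurable
        measurable_compose[OF measurable_path_translate_fixed measurable_hit_val[OF mix_shift_measurable]])
  then show ?thesis by (simp add: sample_def[abs_def])
qed

text \<open>Averaging \<open>U\<close> over a Gaussian step means starting a fresh path at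
  \<open>z + W r\<close>. By the Markov property its law together with the step is that of
  \<open>W r\<close> and the increments after \<open>r\<close>, which recombine to the original path
  seen from time \<open>r\<close> on.\<close>

lemma heat_int_U_eq_expectation:
  assumes t: "t > 0" and r: "r > 0"
  shows "heat_int [] r (U j t s) z =
    (\<integral>\<omega>. exit_val j t s (sample (\<lambda>t. z + W (r + t) \<omega>)) \<partial>M)"
proof -
  let ?N = "density lborel (\<lambda>y :: real ^ 'd. ennreal (heat_kernel r y))"
  obtain C where C: "\<And>u s y. t \<le> u \<Longrightarrow> u \<le> t \<Longrightarrow> \<bar>mix j f u s y\<bar> \<le> C" using mix_boundE[OF t] by metis
  interpret N: prob_space ?N
    using r by (intro prob_spaceI) (simp add: emeasure_density nn_integral_heat_kernel)
  interpret NL: pair_prob_space ?N "bm_law M W" ..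
  have [measurable]: "U j t s \<in> borel_measurable borel" by (rule U_measurable)
  have 1: "(\<lambda>(y, w). exit_val j t s (\<lambda>q. (z + y) + w q)) \<in> borel_measurable (borel \<Otimes>\<^sub>M paths)"
  proof -
    have "(\<lambda>(y, w). (z + y, w)) \<in> measurable (borel \<Otimes>\<^sub>M paths) (borel \<Otimes>\<^sub>M (paths :: (rat \<Rightarrow> real ^ 'd) measure))"
      by measurable
    from measurable_compose[OF this measurable_compose[OF measurable_path_translate measurable_hit_val[OF mix_shift_measurable]]]
    show ?thesis by (simp add: split_def)
  qed
  have "heat_int [] r (U j t s) z = (\<integral>y. heat_kernel r (z - (z + y)) * U j t s (z + y) \<partial>lborel)"
    unfolding heat_int_def heat_deriv.simps by (rule integral_lborel_shift[symmetric]) measurable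
  also have "\<dots> = (\<integral>y. U j t s (z + y) \<partial>?N)"
    using r by (subst integral_density) (simp_all add: heat_kernel_minus heat_kernel_nonneg)
  also have "\<dots> = (\<integral>y. (\<integral>w. exit_val j t s (\<lambda>q. (z + y) + w q) \<partial>bm_law M W) \<partial>?N)"
    by (simp add: U_def)
  also have "\<dots> = (\<integral>p. (case p of (y, w) \<Rightarrow> exit_val j t s (\<lambda>q. (z + y) + w q)) \<partial>(?N \<Otimes>\<^sub>M bm_law M W))"
  proof (rule NL.integral_fst)
    show "integrable (?N \<Otimes>\<^sub>M bm_law M W) (\<lambda>(y, w). exit_val j t s (\<lambda>q. (z + y) + w q))"
      by (rule NL.P.integrable_const_bound[where B=C])
        (use C 1 in \<open>auto intro!: hit_val_bound simp: split_def cong: measurable_cong_sets sets_pair_measure_cong\<close>)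
  qed
  also have "?N \<Otimes>\<^sub>M bm_law M W = distr M (borel \<Otimes>\<^sub>M paths) (\<lambda>\<omega>. (W r \<omega>, sample (\<lambda>t. W (r + t) \<omega> - W r \<omega>)))"
    by (rule Markov_pair_law[OF r, symmetric])
  also have "(\<integral>p. (case p of (y, w) \<Rightarrow> exit_val j t s (\<lambda>q. (z + y) + w q)) \<partial>distr M (borel \<Otimes>\<^sub>M paths) (\<lambda>\<omega>. (W r \<omega>, sample (\<lambda>t. W (r + t) \<omega> - W r \<omega>)))) =
     (\<integral>\<omega>. exit_val j t s (\<lambda>q. (z + W r \<omega>) + sample (\<lambda>t. W (r + t) \<omega> - W r \<omega>) q) \<partial>M)"
  proof (subst integral_distr[OF _ 1])
    have "(\<lambda>\<omega>. sample (\<lambda>t. W (r + t) \<omega> - W r \<omega>)) \<in> measurable M paths"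
      using r by (intro measurable_sample borel_measurable_diff W_measurable) auto
    moreover have "W r \<in> borel_measurable M" using r by simp
    ultimately show "(\<lambda>\<omega>. (W r \<omega>, sample (\<lambda>t. W (r + t) \<omega> - W r \<omega>))) \<in> measurable M (borel \<Otimes>\<^sub>M paths)"
      by simp
  qed simp
  finally show ?thesis by (simp add: sample_def[abs_def])
qed

text \<open>Realised on the same path, the two integrands coincide as long as the path stays in the
  ball around \<open>z\<close>, which avoids \<open>A\<close>, up to time \<open>r\<close>. On the
  exceptional event they differ by at most \<open>2 * C\<close>, and its probability is quadratic in
  \<open>r\<close>.\<close>

lemma U_approx_Markov:
  assumes a: "0 < a" and \<delta>: "0 < \<delta>"
  shows "\<exists>K. \<forall>t\<in>{a..b}. \<forall>s\<ge>0. \<forall>r\<in>{0<..1}. \<forall>z. ball z \<delta> \<subseteq> D \<longrightarrow>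
        \<bar>heat_int [] r (U j t (s + r)) z - U j t s z\<bar> \<le> K * r\<^sup>2"
proof -
  obtain C where C: "\<And>t s y. a \<le> t \<Longrightarrow> t \<le> b \<Longrightarrow> \<bar>mix j f t s y\<bar> \<le> C" using mix_boundE[OF a] by metis
  obtain C' where C': "\<And>r. r > 0 \<Longrightarrow> \<exists>E\<in>sets M. prob E \<le> C' * r\<^sup>2 \<and>
    (\<forall>\<omega>\<in>space M - E. \<forall>q. 0 \<le> q \<longrightarrow> q \<le> r \<longrightarrow> norm (W q \<omega>) < \<delta>)"
    using sup_small[OF \<delta>] by metis
  have "\<bar>heat_int [] r (U j t (s + r)) z - U j t s z\<bar> \<le> 2 * C * C' * r\<^sup>2"
    if t: "a \<le> t" "t \<le> b" and s: "s \<ge> 0" and r: "0 < r" and z: "ball z \<delta> \<subseteq> D" for t s r z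
  proof -
    have t0: "t > 0" using a t by simp
    have C0: "C \<ge> 0" using order_trans[OF abs_ge_zero C[OF t]] .
    let ?\<phi> = "\<lambda>\<theta> y. mix j f t (s + \<theta>) y" and ?\<psi> = "\<lambda>\<theta> y. mix j f t (s + r + \<theta>) y"
    define X where "X \<omega> = hit_val ?\<psi> A (sample (\<lambda>t. z + W (r + t) \<omega>))" for \<omega>
    define Y where "Y \<omega> = hit_val ?\<phi> A (sample (\<lambda>t. z + W t \<omega>))" for \<omega>
    have X_meas: "X \<in> borel_measurable M"
      unfolding X_def using r
      by (intro measurable_compose[OF measurable_sample measurable_hit_val[OF mix_shift_measurable]]) auto
    have Y_meas: "Y \<in> borel_measurable M"
      unfolding Y_def
      by (intro measurable_compose[OF measurable_sample measurable_hit_val[OF mix_shift_measurable]]) auto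
    have X_bound: "\<bar>X \<omega>\<bar> \<le> C" and Y_bound: "\<bar>Y \<omega>\<bar> \<le> C" for \<omega>
      unfolding X_def Y_def using t by (intro hit_val_bound C; simp)+
    have X_int: "integrable M X" and Y_int: "integrable M Y"
      using X_meas Y_meas X_bound Y_bound by (auto intro!: integrable_const_bound[where B=C])
    obtain E where E: "E \<in> sets M" "prob E \<le> C' * r\<^sup>2"
      "\<And>\<omega> q. \<omega> \<in> space M - E \<Longrightarrow> 0 \<le> q \<Longrightarrow> q \<le> r \<Longrightarrow> norm (W q \<omega>) < \<delta>"
      using C'[OF r] by blast
    have eq: "X \<omega> = Y \<omega>" if \<omega>: "\<omega> \<in> space M - E" for \<omega>
    proof -
      have "hit_val (\<lambda>\<theta>. ?\<phi> (r + \<theta>)) A (sample (\<lambda>t. z + W (r + t) \<omega>)) = hit_val ?\<phi> A (sample (\<lambda>t. z + W t \<omega>))"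
      proof (rule hit_val_shift[OF _ closed_A])
        show "continuous_on {0..} (\<lambda>t. z + W t \<omega>)" using \<omega> by (intro continuous_intros W_continuous) auto
        show "z + W t \<omega> \<notin> A" if "0 \<le> t" "t \<le> r" for t
        proof -
          have "z + W t \<omega> \<in> ball z \<delta>" using E(3)[OF \<omega> that] by (simp add: dist_norm)
          then show ?thesis using z disjoint by blast
        qed
      qed (use r in simp)
      then show ?thesis by (simp add: X_def Y_def add.assoc)
    qed
    have "\<bar>heat_int [] r (U j t (s + r)) z - U j t s z\<bar> = \<bar>\<integral>\<omega>. X \<omega> - Y \<omega> \<partial>M\<bar>"
      unfolding heat_int_U_eq_expectation[OF t0 r] U_eq_expectation[of j t s z] X_def[symmetric] Y_def[symmetric]
      by (simp add: X_int Y_int)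
    also have "\<dots> \<le> (\<integral>\<omega>. 2 * C * indicator E \<omega> \<partial>M)"
    proof (rule order_trans[OF integral_abs_bound integral_mono])
      show "\<bar>X \<omega> - Y \<omega>\<bar> \<le> 2 * C * indicator E \<omega>" if "\<omega> \<in> space M" for \<omega>
        using eq[of \<omega>] that X_bound[of \<omega>] Y_bound[of \<omega>] by (cases "\<omega> \<in> E") auto
    qed (use X_int Y_int E(1) in \<open>auto intro!: integrable_mult_right integrable_real_indicator simp: emeasure_eq_measure\<close>)
    also have "\<dots> = 2 * C * prob E" using E(1) by simp
    also have "\<dots> \<le> 2 * C * (C' * r\<^sup>2)" using E(2) C0 by (intro mult_left_mono) auto
    finally show ?thesis by (simp add: mult.assoc)
  qed
  then show ?thesis by (intro exI[of _ "2 * C * C'"]) auto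
qed

sublocale caloric_family U D
proof
  show "open D" by (rule open_D)
  show "U j t s \<in> borel_measurable borel" for j t s by (rule U_measurable)
  show "\<exists>K. \<forall>t\<in>{a..b}. \<forall>s\<ge>0. \<forall>z. \<bar>U j t s z\<bar> \<le> K" if a: "0 < a" for j a b
  proof -
    obtain C where C: "\<And>t s y. a \<le> t \<Longrightarrow> t \<le> b \<Longrightarrow> \<bar>mix j f t s y\<bar> \<le> C" using mix_boundE[OF a] by metis
    show ?thesis by (intro exI[of _ C]) (use a C in \<open>auto intro!: U_bound\<close>)
  qed
qed (rule U_time_derivative U_heat_derivative U_approx_Markov; assumption)+

end

section \<open>Transfer to path space and integration over \<open>X\<close> and
  \<open>Z\<close>\<close>

lemma distr_sample_independent:
  fixes B :: "real \<Rightarrow> 'w \<Rightarrow> real ^ 'd"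
  assumes M: "prob_space M" and B: "\<And>t. t \<ge> 0 \<Longrightarrow> B t \<in> borel_measurable M"
    and X[measurable]: "X \<in> borel_measurable M" and Z[measurable]: "Z \<in> borel_measurable M"
    and indep: "mutually_independent M B X Z"
  shows "distr M (paths \<Otimes>\<^sub>M (borel \<Otimes>\<^sub>M borel)) (\<lambda>\<omega>. (sample (\<lambda>t. B t \<omega>), (X \<omega>, Z \<omega>))) =
    distr M paths (\<lambda>\<omega>. sample (\<lambda>t. B t \<omega>)) \<Otimes>\<^sub>M (distr M borel X \<Otimes>\<^sub>M distr M borel Z)"
proof -
  interpret prob_space M by fact
  define S where "S \<omega> = sample (\<lambda>t. B t \<omega>)" for \<omega>
  have S[measurable]: "S \<in> measurable M paths" unfolding S_def by (rule measurable_sample) (rule B)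
  \<comment> \<open>Sampling factors through the restriction of the process to nonnegative times, so
    events of the sampled path belong to the generated sigma-algebra in the independence
    hypothesis.\<close>
  have S_sigma: "S -` C \<inter> space M \<in> sigma_of_process M B" if "C \<in> sets paths" for C
  proof -
    define p where "p \<omega> = (\<lambda>t\<in>{0..}. B t \<omega>)" for \<omega>
    define g where "g v q = v (rat_time q)" for v :: "real \<Rightarrow> real ^ 'd" and q
    have g: "g \<in> measurable (Pi\<^sub>M {0..} (\<lambda>_. borel)) paths"
      unfolding g_def using rat_time_nonneg
      by (intro measurable_PiM_single' measurable_component_singleton) auto
    have p: "p \<in> space M \<rightarrow> space (Pi\<^sub>M {0..} (\<lambda>_. borel))" by (auto simp: p_def space_PiM)
    have "S \<omega> = g (p \<omega>)" for \<omega> using rat_time_nonneg by (auto simp: S_def g_def p_def sample_def)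
    then have "S -` C \<inter> space M = p -` (g -` C \<inter> space (Pi\<^sub>M {0..} (\<lambda>_. borel))) \<inter> space M"
      using p by auto
    moreover have "g -` C \<inter> space (Pi\<^sub>M {0..} (\<lambda>_. borel)) \<in> sets (Pi\<^sub>M {0..} (\<lambda>_. borel))"
      using g that by (rule measurable_sets)
    ultimately show ?thesis
      unfolding sigma_of_process_def p_def[symmetric] by (metis in_vimage_algebra)
  qed
  have rv_sigma: "Y -` C \<inter> space M \<in> sigma_of_rv M Y" if "C \<in> sets borel" for Y C
    unfolding sigma_of_rv_def using that by (rule in_vimage_algebra)
  have prod: "emeasure M ((S -` C \<inter> space M) \<inter> (X -` A \<inter> space M) \<inter> (Z -` A' \<inter> space M)) =
      emeasure M (S -` C \<inter> space M) * emeasure M (X -` A \<inter> space M) * emeasure M (Z -` A' \<inter> space M)"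
    if C: "C \<in> sets paths" and A: "A \<in> sets borel" and A': "A' \<in> sets borel" for C A A'
  proof -
    let ?L = "[S -` C \<inter> space M, X -` A \<inter> space M, Z -` A' \<inter> space M]"
    have "prob (\<Inter>j\<in>{..<3}. ?L ! j) = (\<Prod>j\<in>{..<3}. prob (?L ! j))"
    proof (rule indep_setsD[OF indep[unfolded mutually_independent_def]])
      show "\<forall>j\<in>{..<3}. ?L ! j \<in> [sigma_of_process M B, sigma_of_rv M X, sigma_of_rv M Z] ! j"
        using S_sigma[OF C] rv_sigma[OF A] rv_sigma[OF A'] by (auto simp: numeral_3_eq_3 less_Suc_eq)
    qed (auto simp: lessThan_empty_iff)
    moreover have "{..<3 :: nat} = {0, 1, 2}" by auto
    ultimately have "prob ((S -` C \<inter> space M) \<inter> (X -` A \<inter> space M) \<inter> (Z -` A' \<inter> space M)) =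
      prob (S -` C \<inter> space M) * prob (X -` A \<inter> space M) * prob (Z -` A' \<inter> space M)"
      by (simp add: Int_assoc mult.assoc)
    then show ?thesis by (simp add: emeasure_eq_measure ennreal_mult)
  qed
  interpret S: prob_space "distr M paths S" by (rule prob_space_distr) measurable
  interpret X: prob_space "distr M borel X" by (rule prob_space_distr) measurable
  interpret Z: prob_space "distr M borel Z" by (rule prob_space_distr) measurable
  interpret XZ: pair_prob_space "distr M borel X" "distr M borel Z" ..
  have "distr M paths S \<Otimes>\<^sub>M (distr M borel X \<Otimes>\<^sub>M distr M borel Z) =
     distr M (paths \<Otimes>\<^sub>M (borel \<Otimes>\<^sub>M borel)) (\<lambda>\<omega>. (S \<omega>, (X \<omega>, Z \<omega>)))"
  proof (rule pair_measure_eqI)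
    show "sigma_finite_measure (distr M paths S)" "sigma_finite_measure (distr M borel X \<Otimes>\<^sub>M distr M borel Z)"
      by unfold_locales
    show "sets (distr M paths S \<Otimes>\<^sub>M (distr M borel X \<Otimes>\<^sub>M distr M borel Z)) =
      sets (distr M (paths \<Otimes>\<^sub>M (borel \<Otimes>\<^sub>M borel)) (\<lambda>\<omega>. (S \<omega>, (X \<omega>, Z \<omega>))))"
      by (simp cong: sets_pair_measure_cong)
    fix C R assume "C \<in> sets (distr M paths S)" "R \<in> sets (distr M borel X \<Otimes>\<^sub>M distr M borel Z)"
    then have C[measurable]: "C \<in> sets paths" and R[measurable]: "R \<in> sets (borel \<Otimes>\<^sub>M borel)"
      by (simp_all cong: sets_pair_measure_cong)
    define E where "E = S -` C \<inter> space M"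
    have E[measurable]: "E \<in> sets M" unfolding E_def by measurable
    have E_density: "emeasure (density M (indicator E)) F = emeasure M (E \<inter> F)" if [measurable]: "F \<in> sets M" for F
      by (simp add: emeasure_density indicator_inter_arith[symmetric])
    \<comment> \<open>With the path event \<open>E\<close> fixed, the scaled product law of
      \<open>X\<close> and \<open>Z\<close> and their joint law restricted to \<open>E\<close> are
      both the product of \<open>N\<close> with the law of \<open>Z\<close>. So independence on
      rectangles extends to every \<open>R\<close>.\<close>
    define c where "c = emeasure M E"
    define N where "N = scale_measure c (distr M borel X)"
    have "emeasure N (space N) = c * emeasure (distr M borel X) (space (distr M borel X))"
      by (simp add: N_def space_scale_measure)
    then have "finite_measure N"
      by (intro finite_measureI) (simp add: X.emeasure_space_1 c_def del: space_distr)
    then have N: "sigma_finite_measure N" by (simp add: finite_measure.sigma_finite_measure)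
    have "N \<Otimes>\<^sub>M distr M borel Z = scale_measure c (distr M borel X \<Otimes>\<^sub>M distr M borel Z)"
    proof (rule pair_measure_eqI[OF N])
      fix A A' assume "A \<in> sets N" "A' \<in> sets (distr M borel Z)"
      then show "emeasure N A * emeasure (distr M borel Z) A' =
         emeasure (scale_measure c (distr M borel X \<Otimes>\<^sub>M distr M borel Z)) (A \<times> A')"
        by (simp add: N_def Z.emeasure_pair_measure_Times mult.assoc)
    qed (simp_all add: N_def Z.sigma_finite_measure_axioms cong: sets_pair_measure_cong)
    moreover have "N \<Otimes>\<^sub>M distr M borel Z = distr (density M (indicator E)) (borel \<Otimes>\<^sub>M borel) (\<lambda>\<omega>. (X \<omega>, Z \<omega>))"
    proof (rule pair_measure_eqI[OF N])
      fix A A' assume "A \<in> sets N" "A' \<in> sets (distr M borel Z)"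
      then have [measurable]: "A \<in> sets borel" "A' \<in> sets borel" by (simp_all add: N_def)
      have "(\<lambda>\<omega>. (X \<omega>, Z \<omega>)) -` (A \<times> A') \<inter> space M = (X -` A \<inter> space M) \<inter> (Z -` A' \<inter> space M)" by auto
      moreover have F: "(X -` A \<inter> space M) \<inter> (Z -` A' \<inter> space M) \<in> sets M" by measurable
      ultimately show "emeasure N A * emeasure (distr M borel Z) A' =
         emeasure (distr (density M (indicator E)) (borel \<Otimes>\<^sub>M borel) (\<lambda>\<omega>. (X \<omega>, Z \<omega>))) (A \<times> A')"
        using prod[of C A A'] E_density[OF F]
        by (simp add: N_def c_def emeasure_distr E_def Int_assoc)
    qed (simp_all add: N_def Z.sigma_finite_measure_axioms cong: sets_pair_measure_cong)
    ultimately have "c * emeasure (distr M borel X \<Otimes>\<^sub>M distr M borel Z) R =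
        emeasure (distr (density M (indicator E)) (borel \<Otimes>\<^sub>M borel) (\<lambda>\<omega>. (X \<omega>, Z \<omega>))) R"
      by (metis emeasure_scale_measure)
    also have "\<dots> = emeasure M (E \<inter> ((\<lambda>\<omega>. (X \<omega>, Z \<omega>)) -` R \<inter> space M))"
      by (simp add: emeasure_distr emeasure_density indicator_inter_arith[symmetric])
    also have "E \<inter> ((\<lambda>\<omega>. (X \<omega>, Z \<omega>)) -` R \<inter> space M) = (\<lambda>\<omega>. (S \<omega>, (X \<omega>, Z \<omega>))) -` (C \<times> R) \<inter> space M"
      by (auto simp: E_def)
    finally show "emeasure (distr M paths S) C * emeasure (distr M borel X \<Otimes>\<^sub>M distr M borel Z) R =
        emeasure (distr M (paths \<Otimes>\<^sub>M (borel \<Otimes>\<^sub>M borel)) (\<lambda>\<omega>. (S \<omega>, (X \<omega>, Z \<omega>)))) (C \<times> R)"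
      by (simp add: emeasure_distr c_def E_def)
  qed
  from this[symmetric] show ?thesis unfolding S_def .
qed

text \<open>Fubini with the normal variable first gives a Gaussian average around \<open>t\<close>
  times the Cauchy variable; scaling the Cauchy density then produces the Poisson kernel at height
  \<open>t\<close>.\<close>

lemma integral_mix:
  fixes g :: "real \<times> (real ^ 'd) \<Rightarrow> real"
  assumes g: "g \<in> borel_measurable borel" "\<And>p. \<bar>g p\<bar> \<le> K" and t: "t > 0"
  shows "(\<integral>p. g (t * fst p + sqrt \<theta> * snd p, y) \<partial>(density lborel (\<lambda>a. ennreal (cauchy_density a)) \<Otimes>\<^sub>M
      density lborel (\<lambda>b. ennreal (std_normal_density b)))) = mix 0 g t \<theta> y"
proof -
  let ?X = "density lborel (\<lambda>a. ennreal (cauchy_density a))"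
  let ?Z = "density lborel (\<lambda>b. ennreal (std_normal_density b))"
  have [measurable]: "cauchy_density \<in> borel_measurable borel" unfolding cauchy_density_def[abs_def] by measurable
  have c0: "cauchy_density a \<ge> 0" for a by (simp add: cauchy_density_def add_nonneg_nonneg)
  interpret Z: prob_space ?Z by (rule prob_space_normal_density) simp
  have cd: "cauchy_density a = poisson 0 1 a" for a by (simp add: cauchy_density_def poisson_0)
  interpret X: finite_measure ?X
  proof (rule finite_measureI)
    have "integrable lborel cauchy_density" unfolding cd[abs_def] by (rule integrable_poisson) simp
    then have "(\<integral>\<^sup>+a. ennreal (cauchy_density a) \<partial>lborel) \<noteq> \<infinity>"
      using c0 by (simp add: nn_integral_eq_integral)
    then show "emeasure ?X (space ?X) \<noteq> \<infinity>" by (simp add: emeasure_density)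
  qed
  interpret XZ: pair_sigma_finite ?X ?Z ..
  interpret XZf: finite_measure "?X \<Otimes>\<^sub>M ?Z"
    by (rule finite_measure_pair_measure) unfold_locales
  have m: "(\<lambda>p. g (t * fst p + sqrt \<theta> * snd p, y)) \<in> borel_measurable (?X \<Otimes>\<^sub>M ?Z)"
  proof -
    have "(\<lambda>p :: real \<times> real. (t * fst p + sqrt \<theta> * snd p, y)) \<in> measurable (borel \<Otimes>\<^sub>M borel) borel"
      by (simp add: borel_prod[symmetric])
    from measurable_compose[OF this g(1)] show ?thesis by (simp cong: measurable_cong_sets sets_pair_measure_cong)
  qed
  have [measurable]: "(\<lambda>x. g (x, y)) \<in> borel_measurable borel" by (rule f_section[OF g])
  have [measurable]: "gauss_avg (\<lambda>x. g (x, y)) \<theta> \<in> borel_measurable borel"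
    by (rule gauss_avg_measurable_r[OF g])
  have "(\<integral>p. g (t * fst p + sqrt \<theta> * snd p, y) \<partial>(?X \<Otimes>\<^sub>M ?Z)) =
     (\<integral>a. (\<integral>b. g (t * a + sqrt \<theta> * b, y) \<partial>?Z) \<partial>?X)"
    using XZ.integral_fst'[of "\<lambda>p. g (t * fst p + sqrt \<theta> * snd p, y)"]
      XZf.integrable_const_bound[of "\<lambda>p. g (t * fst p + sqrt \<theta> * snd p, y)" K] m g(2) by simp
  also have "\<dots> = (\<integral>a. gauss_avg (\<lambda>x. g (x, y)) \<theta> (t * a) \<partial>?X)"
    unfolding gauss_avg_def by (subst integral_density) simp_all
  also have "\<dots> = (\<integral>a. cauchy_density a * gauss_avg (\<lambda>x. g (x, y)) \<theta> (t * a) \<partial>lborel)"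
    using c0 by (subst integral_density) simp_all
  also have "\<dots> = mix 0 g t \<theta> y"
    unfolding mix_def by (rule cauchy_integral_eq[OF t])
  finally show ?thesis .
qed

lemma laplacian_x_eq_Basis_sum:
  fixes u :: "real \<times> (real ^ 'd) \<Rightarrow> real"
  shows "laplacian_x u p = (\<Sum>b\<in>Basis. partial_deriv (0, b) (partial_deriv (0, b) u) p)"
proof -
  have 1: "(Basis :: (real ^ 'd) set) = range (\<lambda>i. axis i 1)" by (auto simp: Basis_vec_def)
  have 2: "inj (\<lambda>i :: 'd. axis i (1 :: real))" by (auto simp: inj_on_def axis_eq_axis)
  show ?thesis unfolding laplacian_x_def 1 by (subst sum.reindex[OF 2]) simp
qed

theorem theorem1:
  fixes D :: "(real ^ 'd) set"
    and f :: "real \<times> (real ^ 'd) \<Rightarrow> real"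
    and P :: "real ^ 'd \<Rightarrow> 'w measure"
    and B :: "real \<Rightarrow> 'w \<Rightarrow> real ^ 'd"
    and X Z :: "'w \<Rightarrow> real"
    and u :: "real \<times> (real ^ 'd) \<Rightarrow> real"
  assumes D: "bounded D" "open D" "connected D"
    and f_measurable: "f \<in> borel_measurable (restrict_space borel (UNIV \<times> frontier D))"
    and f_bounded: "bounded (f ` (UNIV \<times> frontier D))"
    and B: "\<And>x. x \<in> D \<Longrightarrow> brownian_motion_from (P x) x B"
    and X: "\<And>x. x \<in> D \<Longrightarrow> distributed (P x) lborel X (\<lambda>z. ennreal (cauchy_density z))"
    and Z: "\<And>x. x \<in> D \<Longrightarrow> distributed (P x) lborel Z (\<lambda>z. ennreal (std_normal_density z))"
    and indep: "\<And>x. x \<in> D \<Longrightarrow> mutually_independent (P x) B X Z"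
    \<comment> \<open>\<open>f\<close> is only constrained on \<open>UNIV \<times> frontier D\<close>, so the integral leaves out the
      \<open>P x\<close>-null event that the path never reaches \<open>frontier D\<close>.\<close>
    and u: "\<And>t x. t > 0 \<Longrightarrow> x \<in> D \<Longrightarrow>
      u (t, x) =
        (LINT \<omega> : {\<omega> \<in> space (P x). hits B (frontier D) \<omega>} | P x.
          f (t * X \<omega> + sqrt (hitting_time B (frontier D) \<omega>) * Z \<omega>,
             B (hitting_time B (frontier D) \<omega>) \<omega>))"
  shows "cont_diff_on 2 ({0<..} \<times> D) u \<and>
         (\<forall>t>0. \<forall>x\<in>D. dtt u (t, x) = laplacian_x u (t, x))"
proof (cases "D = {}")
  case True
  then show ?thesis by (simp add: cont_diff_on_empty)
next
  case False
  then obtain x0 where x0: "x0 \<in> D" by blast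
  define A where "A = frontier D"
  \<comment> \<open>A set has empty frontier only if it is empty or the whole space, and a bounded
    set is not the whole space. Openness makes \<open>D\<close> disjoint from its frontier.\<close>
  have A: "closed A" "A \<noteq> {}" and DA: "D \<inter> A = {}"
    using False D frontier_eq_empty[of D] not_bounded_UNIV frontier_disjoint_eq[of D]
    by (auto simp: A_def)
  \<comment> \<open>Extension by zero: \<open>f\<close> is controlled on the boundary only, while
    the kernels average a globally measurable and bounded function.\<close>
  define g where "g p = indicator (UNIV \<times> A) p * f p" for p
  have "(UNIV :: real set) \<times> A \<in> sets borel"
    using A by (intro borel_closed closed_Times) auto
  then have g_meas: "g \<in> borel_measurable borel"
    using f_measurable borel_measurable_restrict_space_iff[of "UNIV \<times> A" borel f]
    by (simp add: A_def[symmetric] g_def[abs_def])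
  obtain K where K: "\<And>p. p \<in> UNIV \<times> A \<Longrightarrow> \<bar>f p\<bar> \<le> K"
    using f_bounded by (auto simp: bounded_iff A_def)
  have g_bound: "\<bar>g p\<bar> \<le> \<bar>K\<bar>" for p using K[of p] by (auto simp: g_def indicator_def)
  define W where "W t \<omega> = B t \<omega> - B 0 \<omega>" for t \<omega>
  have bm: "standard_bm (P x) W" if "x \<in> D" for x
    unfolding W_def using B[OF that] by (rule standard_bmI)
  \<comment> \<open>Any point of \<open>D\<close> can supply the reference law;
    \<open>bm_law_unique\<close> carries it over to every other \<open>P x\<close>.\<close>
  interpret bm0: standard_bm "P x0" W by (rule bm[OF x0])
  interpret exit_problem "P x0" W D A g "\<bar>K\<bar>"
    by unfold_locales (use D A DA g_meas g_bound in auto)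
  have u_eq: "u (t, x) = U 0 t 0 x" if t: "t > 0" and x: "x \<in> D" for t x
  proof -
    define N where "N = P x"
    interpret N: exit_problem N W D A g "\<bar>K\<bar>"
      unfolding N_def exit_problem_def using bm[OF x] exit_problem_axioms by (simp add: exit_problem_axioms_def exit_problem_def)
    have BN: "brownian_motion_from N x B" using B[OF x] by (simp add: N_def)
    then have B_meas: "\<And>t. t \<ge> 0 \<Longrightarrow> B t \<in> borel_measurable N"
      and B_cont: "\<And>\<omega>. \<omega> \<in> space N \<Longrightarrow> continuous_on {0..} (\<lambda>t. B t \<omega>)"
      and B_start: "AE \<omega> in N. B 0 \<omega> = x"
      by (auto simp: brownian_motion_from_def)
    have X_meas: "X \<in> borel_measurable N" and Z_meas: "Z \<in> borel_measurable N"
      using X[OF x] Z[OF x] by (auto simp: distributed_def N_def)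
    have "distr N borel X = distr N lborel X" "distr N borel Z = distr N lborel Z"
      by (rule distr_cong; simp)+
    then have X_law: "distr N borel X = density lborel (\<lambda>a. ennreal (cauchy_density a))"
      and Z_law: "distr N borel Z = density lborel (\<lambda>b. ennreal (std_normal_density b))"
      using X[OF x] Z[OF x] by (simp_all add: distributed_distr_eq_density N_def)
    define S where "S \<omega> = sample (\<lambda>t. B t \<omega>)" for \<omega>
    have S_meas: "S \<in> measurable N paths" unfolding S_def by (rule measurable_sample) (rule B_meas)
    \<comment> \<open>The path \<open>w\<close> and the pair \<open>p\<close> of values of
      \<open>X\<close> and \<open>Z\<close> are separated, so that integrating over \<open>p\<close>
      alone turns the functional into \<open>exit_val 0 t 0\<close>.\<close>
    define \<Psi> where "\<Psi> w p = hit_val (\<lambda>\<theta> y. g (t * fst p + sqrt \<theta> * snd p, y)) A w" for w p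
    have \<Psi>_meas: "(\<lambda>(w, p). \<Psi> w p) \<in> borel_measurable (paths \<Otimes>\<^sub>M (borel \<Otimes>\<^sub>M borel))"
    proof -
      have [measurable]: "g \<in> borel_measurable (borel \<Otimes>\<^sub>M borel)" using g_meas by (simp add: borel_prod)
      show ?thesis unfolding \<Psi>_def hit_val_def by measurable
    qed
    have \<Psi>_bound: "\<bar>\<Psi> w p\<bar> \<le> \<bar>K\<bar>" for w p
      unfolding \<Psi>_def by (intro hit_val_bound g_bound)
    interpret S: prob_space "distr N paths S" by (rule N.prob_space_distr) (rule S_meas)
    interpret DX: prob_space "distr N borel X" by (rule N.prob_space_distr) (rule X_meas)
    interpret DZ: prob_space "distr N borel Z" by (rule N.prob_space_distr) (rule Z_meas)
    interpret XZ: pair_prob_space "distr N borel X" "distr N borel Z" ..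
    interpret SXZ: pair_prob_space "distr N paths S" "distr N borel X \<Otimes>\<^sub>M distr N borel Z" ..
    have hits_eq: "indicator {\<omega> \<in> space N. hits B A \<omega>} \<omega> *\<^sub>R
        f (t * X \<omega> + sqrt (hitting_time B A \<omega>) * Z \<omega>, B (hitting_time B A \<omega>) \<omega>) = \<Psi> (S \<omega>) (X \<omega>, Z \<omega>)"
      if \<omega>: "\<omega> \<in> space N" for \<omega>
    proof (cases "\<exists>s\<ge>0. B s \<omega> \<in> A")
      case True
      then show ?thesis
        using hit_time_sample(3)[OF B_cont[OF \<omega>] A True] \<omega>
        by (simp add: \<Psi>_def S_def hit_val_sample[OF B_cont[OF \<omega>] A] hits_def hitting_time_def g_def)
    next
      case False
      then show ?thesis
        by (auto simp: \<Psi>_def S_def hit_val_sample[OF B_cont[OF \<omega>] A] hits_def)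
    qed
    have inner: "(\<integral>p. \<Psi> w p \<partial>(distr N borel X \<Otimes>\<^sub>M distr N borel Z)) = exit_val 0 t 0 w" for w
      unfolding \<Psi>_def hit_val_def X_law Z_law by (simp add: integral_mix[OF g_meas g_bound t])
    have "u (t, x) = (\<integral>\<omega>. \<Psi> (S \<omega>) (X \<omega>, Z \<omega>) \<partial>N)"
      unfolding u[OF t x] N_def[symmetric] A_def[symmetric] set_lebesgue_integral_def
      by (rule Bochner_Integration.integral_cong[OF refl hits_eq])
    also have "\<dots> = (\<integral>q. (case q of (w, p) \<Rightarrow> \<Psi> w p) \<partial>distr N (paths \<Otimes>\<^sub>M (borel \<Otimes>\<^sub>M borel)) (\<lambda>\<omega>. (S \<omega>, (X \<omega>, Z \<omega>))))"
      using S_meas X_meas Z_meas by (subst integral_distr[OF _ \<Psi>_meas]) simp_all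
    also have "distr N (paths \<Otimes>\<^sub>M (borel \<Otimes>\<^sub>M borel)) (\<lambda>\<omega>. (S \<omega>, (X \<omega>, Z \<omega>))) =
        distr N paths S \<Otimes>\<^sub>M (distr N borel X \<Otimes>\<^sub>M distr N borel Z)"
      unfolding S_def
      by (rule distr_sample_independent[OF N.prob_space_axioms B_meas X_meas Z_meas])
        (use indep[OF x] in \<open>simp_all add: N_def\<close>)
    also have "(\<integral>q. (case q of (w, p) \<Rightarrow> \<Psi> w p) \<partial>(distr N paths S \<Otimes>\<^sub>M (distr N borel X \<Otimes>\<^sub>M distr N borel Z))) =
        (\<integral>w. (\<integral>p. \<Psi> w p \<partial>(distr N borel X \<Otimes>\<^sub>M distr N borel Z)) \<partial>distr N paths S)"
    proof (rule SXZ.integral_fst[symmetric])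
      show "integrable (distr N paths S \<Otimes>\<^sub>M (distr N borel X \<Otimes>\<^sub>M distr N borel Z)) (\<lambda>(w, p). \<Psi> w p)"
        by (rule SXZ.P.integrable_const_bound[where B="\<bar>K\<bar>"])
          (use \<Psi>_bound \<Psi>_meas in \<open>auto simp: split_def cong: measurable_cong_sets sets_pair_measure_cong\<close>)
    qed
    also have "\<dots> = (\<integral>w. exit_val 0 t 0 w \<partial>distr N paths S)"
      unfolding inner ..
    also have "\<dots> =
        (\<integral>\<omega>. exit_val 0 t 0 (S \<omega>) \<partial>N)"
      by (rule integral_distr[OF S_meas measurable_hit_val[OF mix_shift_measurable]])
    \<comment> \<open>\<open>B 0\<close> equals \<open>x\<close> almost surely only, so the path and
      the translate of its centred version are exchanged under the integral.\<close>
    also have "\<dots> = (\<integral>\<omega>. exit_val 0 t 0 (sample (\<lambda>t. x + W t \<omega>)) \<partial>N)"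
    proof (rule integral_cong_AE)
      show "(\<lambda>\<omega>. exit_val 0 t 0 (S \<omega>)) \<in> borel_measurable N"
        by (rule measurable_compose[OF S_meas measurable_hit_val[OF mix_shift_measurable]])
      show "(\<lambda>\<omega>. exit_val 0 t 0 (sample (\<lambda>t. x + W t \<omega>))) \<in> borel_measurable N"
        by (intro measurable_compose[OF measurable_sample measurable_hit_val[OF mix_shift_measurable]]) auto
      show "AE \<omega> in N. exit_val 0 t 0 (S \<omega>) =
          exit_val 0 t 0 (sample (\<lambda>t. x + W t \<omega>))"
        using B_start by eventually_elim (simp add: S_def W_def)
    qed
    also have "\<dots> = N.U 0 t 0 x" by (rule N.U_eq_expectation[symmetric])
    also have "\<dots> = U 0 t 0 x"
      unfolding U_def N.U_def using bm_law_unique[OF bm[OF x] bm[OF x0]] by (simp add: N_def)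
    finally show ?thesis .
  qed
  then have "u (t, x) = U 0 t 0 x" if "(t, x) \<in> cylinder" for t x
    using that by (simp add: cylinder_def)
  from wave_solution[OF this] show ?thesis
    by (simp add: cylinder_def dtt_def laplacian_x_eq_Basis_sum)
qed

end
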